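(* Let $\mathcal A$ be an abelian category. Then $$\Phi:\{\text{TTF triples in }\mathcal A\}\longrightarrow\{\text{TTF model structures on }\mathcal A\},\qquad (\mathcal C,\mathcal W,\mathcal F)\longmapsto(\mathrm{CoFib},\mathrm{Fib},\mathrm{Weq})$$ is a bijection, where $$\mathrm{CoFib}=\{f\in\mathrm{Mor}(\mathcal A)\mid \mathrm{Coker} f\in\mathcal C\},\qquad \mathrm{Fib}=\{f\in\mathrm{Mor}(\mathcal A)\mid \mathrm{Ker} f\in\mathcal F\},$$ $$\mathrm{Weq}=\{f\in\mathrm{Mor}(\mathcal A)\mid \mathrm{Ker} f\in\mathcal W,\ \mathrm{Coker} f\in\mathcal W\},$$ with inverse $\Psi:(\mathrm{CoFib},\mathrm{Fib},\mathrm{Weq})\longmapsto(\mathcal C,\mathcal W,\mathcal F)$, where $\mathcal C$, $\mathcal F$ and $\mathcal W$ are respectively the classes of cofibrant objects, fibrant objects and trivial objects. In this case the homotopy category $\mathrm{Ho}(\mathcal A)=\mathcal A[\mathrm{Weq}^{-1}]$ is an abelian category, and it is equivalent to $\mathcal C\cap\mathcal F$ as a category. In particular, the full subcategory $\mathcal C\cap\mathcal F$ of $\mathcal A$ enjoys a structure of an abelian category.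
   Context: Torsion pairs: a torsion pair in an abelian category $\mathcal A$ is a pair $(\mathcal T,\mathcal F)$ of full subcategories (closed under isomorphisms) such that $\mathrm{Hom}_{\mathcal A}(T,F)=0$ for $T\in\mathcal T$, $F\in\mathcal F$, and every object $X$ admits an exact sequence $0\to T\to X\to F\to 0$ with $T\in\mathcal T$, $F\in\mathcal F$. A TTF triple is a triple $(\mathcal C,\mathcal W,\mathcal F)$ of full subcategories such that $(\mathcal C,\mathcal W)$ and $(\mathcal W,\mathcal F)$ are torsion pairs. Model structures: a model structure on a category $\mathcal A$ is a triple $(\mathrm{CoFib},\mathrm{Fib},\mathrm{Weq})$ of classes of morphisms such that, with $\mathrm{TCoFib}:=\mathrm{CoFib}\cap\mathrm{Weq}$ and $\mathrm{TFib}:=\mathrm{Fib}\cap\mathrm{Weq}$: (CM1) $\mathrm{Weq}$ has the two-out-of-three property (if two of $f,g,g\circ f$ are in $\mathrm{Weq}$, so is the third); (CM2) the three classes are closed under retracts; (CM3) for every commutative square $p\circ a=b\circ i$ with $i:A\to B$, $p:X\to Y$, and either $i\in\mathrm{TCoFib}$, $p\in\mathrm{Fib}$ or $i\in\mathrm{CoFib}$, $p\in\mathrm{TFib}$, there is a lifting $s:B\to X$ with $s\circ i=a$, $p\circ s=b$; (CM4) every morphism factors as $p\circ i$ with $i\in\mathrm{TCoFib}$, $p\in\mathrm{Fib}$ and as $q\circ j$ with $j\in\mathrm{CoFib}$, $q\in\mathrm{TFib}$. It is orthogonal if the lifting in (CM3) is always unique. An object $X$ is cofibrant if $0\to X$ is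 in $\mathrm{CoFib}$, fibrant if $X\to 0$ is in $\mathrm{Fib}$, trivial if $0\to X$ is in $\mathrm{Weq}$ (equivalently $X\to0$ is in $\mathrm{Weq}$). A TTF model structure on an abelian category $\mathcal A$ is an orthogonal model structure $(\mathrm{CoFib},\mathrm{Fib},\mathrm{Weq})$ such that $\mathrm{CoFib}=\{f\mid\mathrm{Coker} f\in\mathcal C\}$ and $\mathrm{Fib}=\{f\mid \mathrm{Ker} f\in\mathcal F\}$, where $\mathcal C$ and $\mathcal F$ are its classes of cofibrant and fibrant objects. *)

theory Defs
  imports "HOL-Algebra.Group"
begin

section \<open>Categories\<close>

text \<open>
  Objects and morphisms are the elements of carrier sets inside two types. The operations are
  only meaningful on the carriers, and \<open>Comp A g f\<close>, written \<open>g \<cdot> f\<close>, is ``\<open>g\<close> after \<open>f\<close>''.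
\<close>

record ('o, 'm) cat =
  Obj :: "'o set"
  Mor :: "'m set"
  Dom :: "'m \<Rightarrow> 'o"
  Cod :: "'m \<Rightarrow> 'o"
  Id :: "'o \<Rightarrow> 'm"
  Comp :: "'m \<Rightarrow> 'm \<Rightarrow> 'm" (infixl "\<cdot>\<index>" 70)

locale category =
  fixes A :: "('o, 'm) cat" (structure)
  assumes Dom_closed: "f \<in> Mor A \<Longrightarrow> Dom A f \<in> Obj A"
    and Cod_closed: "f \<in> Mor A \<Longrightarrow> Cod A f \<in> Obj A"
    and Id_closed: "X \<in> Obj A \<Longrightarrow> Id A X \<in> Mor A"
    and Dom_Id: "X \<in> Obj A \<Longrightarrow> Dom A (Id A X) = X"
    and Cod_Id: "X \<in> Obj A \<Longrightarrow> Cod A (Id A X) = X"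
    and Comp_closed: "\<lbrakk>f \<in> Mor A; g \<in> Mor A; Cod A f = Dom A g\<rbrakk> \<Longrightarrow> g \<cdot> f \<in> Mor A"
    and Dom_Comp: "\<lbrakk>f \<in> Mor A; g \<in> Mor A; Cod A f = Dom A g\<rbrakk> \<Longrightarrow> Dom A (g \<cdot> f) = Dom A f"
    and Cod_Comp: "\<lbrakk>f \<in> Mor A; g \<in> Mor A; Cod A f = Dom A g\<rbrakk> \<Longrightarrow> Cod A (g \<cdot> f) = Cod A g"
    and Comp_assoc: "\<lbrakk>f \<in> Mor A; g \<in> Mor A; h \<in> Mor A; Cod A f = Dom A g; Cod A g = Dom A h\<rbrakk>
      \<Longrightarrow> h \<cdot> (g \<cdot> f) = (h \<cdot> g) \<cdot> f"
    and Comp_Id_right: "f \<in> Mor A \<Longrightarrow> f \<cdot> Id A (Dom A f) = f"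
    and Comp_Id_left: "f \<in> Mor A \<Longrightarrow> Id A (Cod A f) \<cdot> f = f"

definition Hom :: "('o, 'm) cat \<Rightarrow> 'o \<Rightarrow> 'o \<Rightarrow> 'm set" where
  "Hom A X Y = {f \<in> Mor A. Dom A f = X \<and> Cod A f = Y}"

definition monic :: "('o, 'm) cat \<Rightarrow> 'm \<Rightarrow> bool" where
  "monic A f \<longleftrightarrow> f \<in> Mor A \<and>
     (\<forall>g\<in>Mor A. \<forall>h\<in>Mor A. Dom A g = Dom A h \<and> Cod A g = Dom A f \<and> Cod A h = Dom A f \<and>
        f \<cdot>\<^bsub>A\<^esub> g = f \<cdot>\<^bsub>A\<^esub> h \<longrightarrow> g = h)"

definition epic :: "('o, 'm) cat \<Rightarrow> 'm \<Rightarrow> bool" where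
  "epic A f \<longleftrightarrow> f \<in> Mor A \<and>
     (\<forall>g\<in>Mor A. \<forall>h\<in>Mor A. Cod A g = Cod A h \<and> Dom A g = Cod A f \<and> Dom A h = Cod A f \<and>
        g \<cdot>\<^bsub>A\<^esub> f = h \<cdot>\<^bsub>A\<^esub> f \<longrightarrow> g = h)"

definition iso_mor :: "('o, 'm) cat \<Rightarrow> 'm \<Rightarrow> bool" where
  "iso_mor A f \<longleftrightarrow> f \<in> Mor A \<and>
     (\<exists>g\<in>Hom A (Cod A f) (Dom A f). g \<cdot>\<^bsub>A\<^esub> f = Id A (Dom A f) \<and> f \<cdot>\<^bsub>A\<^esub> g = Id A (Cod A f))"

definition iso_obj :: "('o, 'm) cat \<Rightarrow> 'o \<Rightarrow> 'o \<Rightarrow> bool" where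
  "iso_obj A X Y \<longleftrightarrow> (\<exists>f\<in>Hom A X Y. iso_mor A f)"

definition zero_object :: "('o, 'm) cat \<Rightarrow> 'o \<Rightarrow> bool" where
  "zero_object A Z \<longleftrightarrow> Z \<in> Obj A \<and>
     (\<forall>X\<in>Obj A. (\<exists>!f. f \<in> Hom A Z X) \<and> (\<exists>!f. f \<in> Hom A X Z))"

definition zero_mor :: "('o, 'm) cat \<Rightarrow> 'm \<Rightarrow> bool" where
  "zero_mor A f \<longleftrightarrow> (\<exists>Z g h. zero_object A Z \<and> g \<in> Hom A (Dom A f) Z \<and> h \<in> Hom A Z (Cod A f) \<and>
     f = h \<cdot>\<^bsub>A\<^esub> g)"

text \<open>\<open>is_kernel A f k\<close>: the morphism \<open>k\<close> (with its domain) is a kernel of \<open>f\<close>; dually for cokernels.\<close>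

definition is_kernel :: "('o, 'm) cat \<Rightarrow> 'm \<Rightarrow> 'm \<Rightarrow> bool" where
  "is_kernel A f k \<longleftrightarrow> f \<in> Mor A \<and> k \<in> Mor A \<and> Cod A k = Dom A f \<and> zero_mor A (f \<cdot>\<^bsub>A\<^esub> k) \<and>
     (\<forall>g\<in>Mor A. Cod A g = Dom A f \<and> zero_mor A (f \<cdot>\<^bsub>A\<^esub> g) \<longrightarrow>
        (\<exists>!u. u \<in> Hom A (Dom A g) (Dom A k) \<and> k \<cdot>\<^bsub>A\<^esub> u = g))"

definition is_cokernel :: "('o, 'm) cat \<Rightarrow> 'm \<Rightarrow> 'm \<Rightarrow> bool" where
  "is_cokernel A f q \<longleftrightarrow> f \<in> Mor A \<and> q \<in> Mor A \<and> Dom A q = Cod A f \<and> zero_mor A (q \<cdot>\<^bsub>A\<^esub> f) \<and>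
     (\<forall>g\<in>Mor A. Dom A g = Cod A f \<and> zero_mor A (g \<cdot>\<^bsub>A\<^esub> f) \<longrightarrow>
        (\<exists>!u. u \<in> Hom A (Cod A q) (Cod A g) \<and> u \<cdot>\<^bsub>A\<^esub> q = g))"

section \<open>Abelian categories\<close>

locale preadditive_category = category +
  fixes add :: "'m \<Rightarrow> 'm \<Rightarrow> 'm" and zero :: "'o \<Rightarrow> 'o \<Rightarrow> 'm"
  assumes Hom_group: "\<lbrakk>X \<in> Obj A; Y \<in> Obj A\<rbrakk>
      \<Longrightarrow> comm_group \<lparr>carrier = Hom A X Y, monoid.mult = add, one = zero X Y\<rparr>"
    and Comp_add_right: "\<lbrakk>X \<in> Obj A; Y \<in> Obj A; Z \<in> Obj A; f \<in> Hom A X Y; f' \<in> Hom A X Y; g \<in> Hom A Y Z\<rbrakk>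
      \<Longrightarrow> g \<cdot> (add f f') = add (g \<cdot> f) (g \<cdot> f')"
    and Comp_add_left: "\<lbrakk>X \<in> Obj A; Y \<in> Obj A; Z \<in> Obj A; f \<in> Hom A X Y; g \<in> Hom A Y Z; g' \<in> Hom A Y Z\<rbrakk>
      \<Longrightarrow> (add g g') \<cdot> f = add (g \<cdot> f) (g' \<cdot> f)"

definition has_biproduct ::
  "('o, 'm) cat \<Rightarrow> ('m \<Rightarrow> 'm \<Rightarrow> 'm) \<Rightarrow> ('o \<Rightarrow> 'o \<Rightarrow> 'm) \<Rightarrow> 'o \<Rightarrow> 'o \<Rightarrow> bool" where
  "has_biproduct A add zero X Y \<longleftrightarrow>
     (\<exists>S\<in>Obj A. \<exists>i\<in>Hom A X S. \<exists>j\<in>Hom A Y S. \<exists>p\<in>Hom A S X. \<exists>q\<in>Hom A S Y.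
        p \<cdot>\<^bsub>A\<^esub> i = Id A X \<and> q \<cdot>\<^bsub>A\<^esub> j = Id A Y \<and> p \<cdot>\<^bsub>A\<^esub> j = zero Y X \<and> q \<cdot>\<^bsub>A\<^esub> i = zero X Y \<and>
        add (i \<cdot>\<^bsub>A\<^esub> p) (j \<cdot>\<^bsub>A\<^esub> q) = Id A S)"

locale additive_category = preadditive_category +
  assumes ex_zero_object: "\<exists>Z. zero_object A Z"
    and ex_biproduct: "\<lbrakk>X \<in> Obj A; Y \<in> Obj A\<rbrakk> \<Longrightarrow> has_biproduct A add zero X Y"

text \<open>
  The additive structure of an additive category is unique, so being abelian is a property of the
  underlying category.
\<close>

definition abelian_category :: "('o, 'm) cat \<Rightarrow> bool" where
  "abelian_category A \<longleftrightarrow> (\<exists>add zero. additive_category A add zero) \<and>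
     (\<forall>f\<in>Mor A. \<exists>k. is_kernel A f k) \<and>
     (\<forall>f\<in>Mor A. \<exists>q. is_cokernel A f q) \<and>
     (\<forall>f. monic A f \<longrightarrow> (\<exists>g. is_kernel A g f)) \<and>
     (\<forall>f. epic A f \<longrightarrow> (\<exists>g. is_cokernel A g f))"

section \<open>Subcategories, functors and equivalences\<close>

definition full_subcategory :: "('o, 'm) cat \<Rightarrow> 'o set \<Rightarrow> ('o, 'm) cat" where
  "full_subcategory A S = A\<lparr>Obj := S, Mor := {f \<in> Mor A. Dom A f \<in> S \<and> Cod A f \<in> S}\<rparr>"

definition is_functor ::
  "('o, 'm) cat \<Rightarrow> ('p, 'n) cat \<Rightarrow> ('o \<Rightarrow> 'p) \<Rightarrow> ('m \<Rightarrow> 'n) \<Rightarrow> bool" where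
  "is_functor A B Fo Fm \<longleftrightarrow>
     (\<forall>X\<in>Obj A. Fo X \<in> Obj B \<and> Fm (Id A X) = Id B (Fo X)) \<and>
     (\<forall>f\<in>Mor A. Fm f \<in> Hom B (Fo (Dom A f)) (Fo (Cod A f))) \<and>
     (\<forall>f\<in>Mor A. \<forall>g\<in>Mor A. Cod A f = Dom A g \<longrightarrow> Fm (g \<cdot>\<^bsub>A\<^esub> f) = Fm g \<cdot>\<^bsub>B\<^esub> Fm f)"

definition naturally_isomorphic ::
  "('o, 'm) cat \<Rightarrow> ('p, 'n) cat \<Rightarrow> ('o \<Rightarrow> 'p) \<Rightarrow> ('m \<Rightarrow> 'n) \<Rightarrow> ('o \<Rightarrow> 'p) \<Rightarrow> ('m \<Rightarrow> 'n) \<Rightarrow> bool" where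
  "naturally_isomorphic A B Fo Fm Go Gm \<longleftrightarrow>
     (\<exists>\<eta>. (\<forall>X\<in>Obj A. \<eta> X \<in> Hom B (Fo X) (Go X) \<and> iso_mor B (\<eta> X)) \<and>
          (\<forall>f\<in>Mor A. Gm f \<cdot>\<^bsub>B\<^esub> \<eta> (Dom A f) = \<eta> (Cod A f) \<cdot>\<^bsub>B\<^esub> Fm f))"

definition equivalent_categories :: "('o, 'm) cat \<Rightarrow> ('p, 'n) cat \<Rightarrow> bool" where
  "equivalent_categories A B \<longleftrightarrow> (\<exists>Fo Fm Go Gm. is_functor A B Fo Fm \<and> is_functor B A Go Gm \<and>
     naturally_isomorphic A A (Go \<circ> Fo) (Gm \<circ> Fm) id id \<and>
     naturally_isomorphic B B (Fo \<circ> Go) (Fm \<circ> Gm) id id)"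

section \<open>Localization\<close>

text \<open>
  The localization of \<open>A\<close> at \<open>W\<close> is the Gabriel--Zisman category of fractions: morphisms are
  zigzags of morphisms of \<open>A\<close> and formal inverses of morphisms in \<open>W\<close>, modulo the smallest
  congruence making \<open>A\<close> map functorially and each formal inverse an inverse. A zigzag is stored
  with its endpoints and is read in diagrammatic order, first step first.
\<close>

datatype 'm letter = Fwd 'm | Bwd 'm

inductive zigzag :: "('o, 'm) cat \<Rightarrow> 'm set \<Rightarrow> 'o \<Rightarrow> 'm letter list \<Rightarrow> 'o \<Rightarrow> bool"
  for A :: "('o, 'm) cat" and W :: "'m set" where
  empty: "X \<in> Obj A \<Longrightarrow> zigzag A W X [] X"
| forward: "\<lbrakk>f \<in> Mor A; zigzag A W (Cod A f) p Y\<rbrakk> \<Longrightarrow> zigzag A W (Dom A f) (Fwd f # p) Y"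
| backward: "\<lbrakk>w \<in> Mor A; w \<in> W; zigzag A W (Dom A w) p Y\<rbrakk> \<Longrightarrow> zigzag A W (Cod A w) (Bwd w # p) Y"

definition zigzags :: "('o, 'm) cat \<Rightarrow> 'm set \<Rightarrow> ('o \<times> 'm letter list \<times> 'o) set" where
  "zigzags A W = {(X, p, Y). zigzag A W X p Y}"

inductive zigzag_rule :: "('o, 'm) cat \<Rightarrow> 'm set \<Rightarrow> 'm letter list \<Rightarrow> 'm letter list \<Rightarrow> bool"
  for A :: "('o, 'm) cat" and W :: "'m set" where
  identity: "X \<in> Obj A \<Longrightarrow> zigzag_rule A W [Fwd (Id A X)] []"
| composite: "\<lbrakk>f \<in> Mor A; g \<in> Mor A; Cod A f = Dom A g\<rbrakk>
    \<Longrightarrow> zigzag_rule A W [Fwd f, Fwd g] [Fwd (g \<cdot>\<^bsub>A\<^esub> f)]"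
| left_inverse: "\<lbrakk>w \<in> Mor A; w \<in> W\<rbrakk> \<Longrightarrow> zigzag_rule A W [Fwd w, Bwd w] []"
| right_inverse: "\<lbrakk>w \<in> Mor A; w \<in> W\<rbrakk> \<Longrightarrow> zigzag_rule A W [Bwd w, Fwd w] []"

inductive zigzag_eq ::
  "('o, 'm) cat \<Rightarrow> 'm set \<Rightarrow> 'o \<times> 'm letter list \<times> 'o \<Rightarrow> 'o \<times> 'm letter list \<times> 'o \<Rightarrow> bool"
  for A :: "('o, 'm) cat" and W :: "'m set" where
  step: "\<lbrakk>zigzag_rule A W l r; zigzag A W X (u @ l @ v) Y; zigzag A W X (u @ r @ v) Y\<rbrakk>
    \<Longrightarrow> zigzag_eq A W (X, u @ l @ v, Y) (X, u @ r @ v, Y)"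
| refl: "P \<in> zigzags A W \<Longrightarrow> zigzag_eq A W P P"
| sym: "zigzag_eq A W P Q \<Longrightarrow> zigzag_eq A W Q P"
| trans: "\<lbrakk>zigzag_eq A W P Q; zigzag_eq A W Q R\<rbrakk> \<Longrightarrow> zigzag_eq A W P R"

definition zigzag_rel ::
  "('o, 'm) cat \<Rightarrow> 'm set \<Rightarrow> (('o \<times> 'm letter list \<times> 'o) \<times> ('o \<times> 'm letter list \<times> 'o)) set" where
  "zigzag_rel A W = {(P, Q). zigzag_eq A W P Q}"

definition localization ::
  "('o, 'm) cat \<Rightarrow> 'm set \<Rightarrow> ('o, ('o \<times> 'm letter list \<times> 'o) set) cat" where
  "localization A W =
     \<lparr>Obj = Obj A,
      Mor = zigzags A W // zigzag_rel A W,
      Dom = (\<lambda>\<phi>. THE X. \<exists>p Y. (X, p, Y) \<in> \<phi>),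
      Cod = (\<lambda>\<phi>. THE Y. \<exists>X p. (X, p, Y) \<in> \<phi>),
      Id = (\<lambda>X. zigzag_rel A W `` {(X, [], X)}),
      Comp = (\<lambda>\<psi> \<phi>. zigzag_rel A W ``
        {(X, p @ q, Z) | X p q Z. \<exists>Y. (X, p, Y) \<in> \<phi> \<and> (Y, q, Z) \<in> \<psi>})\<rparr>"

section \<open>Torsion pairs and TTF triples\<close>

text \<open>Full subcategories closed under isomorphisms are given by their sets of objects.\<close>

definition iso_closed :: "('o, 'm) cat \<Rightarrow> 'o set \<Rightarrow> bool" where
  "iso_closed A S \<longleftrightarrow> S \<subseteq> Obj A \<and> (\<forall>X\<in>S. \<forall>Y\<in>Obj A. iso_obj A X Y \<longrightarrow> Y \<in> S)"

text \<open>Exactness of \<open>0 \<rightarrow> T \<rightarrow> X \<rightarrow> F \<rightarrow> 0\<close> with maps \<open>i\<close> and \<open>p\<close>.\<close>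

definition short_exact :: "('o, 'm) cat \<Rightarrow> 'm \<Rightarrow> 'm \<Rightarrow> bool" where
  "short_exact A i p \<longleftrightarrow> is_kernel A p i \<and> is_cokernel A i p"

definition torsion_pair :: "('o, 'm) cat \<Rightarrow> 'o set \<Rightarrow> 'o set \<Rightarrow> bool" where
  "torsion_pair A T F \<longleftrightarrow> iso_closed A T \<and> iso_closed A F \<and>
     (\<forall>X\<in>T. \<forall>Y\<in>F. \<forall>f\<in>Hom A X Y. zero_mor A f) \<and>
     (\<forall>X\<in>Obj A. \<exists>T'\<in>T. \<exists>F'\<in>F. \<exists>i\<in>Hom A T' X. \<exists>p\<in>Hom A X F'. short_exact A i p)"

definition TTF_triples :: "('o, 'm) cat \<Rightarrow> ('o set \<times> 'o set \<times> 'o set) set" where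
  "TTF_triples A = {(C, W, F). torsion_pair A C W \<and> torsion_pair A W F}"

section \<open>Model structures\<close>

definition two_out_of_three :: "('o, 'm) cat \<Rightarrow> 'm set \<Rightarrow> bool" where
  "two_out_of_three A S \<longleftrightarrow> (\<forall>f\<in>Mor A. \<forall>g\<in>Mor A. Cod A f = Dom A g \<longrightarrow>
     (f \<in> S \<and> g \<in> S \<longrightarrow> g \<cdot>\<^bsub>A\<^esub> f \<in> S) \<and>
     (f \<in> S \<and> g \<cdot>\<^bsub>A\<^esub> f \<in> S \<longrightarrow> g \<in> S) \<and>
     (g \<in> S \<and> g \<cdot>\<^bsub>A\<^esub> f \<in> S \<longrightarrow> f \<in> S))"

text \<open>\<open>f\<close> is a retract of \<open>g\<close> in the category of morphisms of \<open>A\<close>.\<close>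

definition retract_of :: "('o, 'm) cat \<Rightarrow> 'm \<Rightarrow> 'm \<Rightarrow> bool" where
  "retract_of A f g \<longleftrightarrow> f \<in> Mor A \<and> g \<in> Mor A \<and>
     (\<exists>s\<in>Hom A (Dom A f) (Dom A g). \<exists>t\<in>Hom A (Cod A f) (Cod A g).
      \<exists>s'\<in>Hom A (Dom A g) (Dom A f). \<exists>t'\<in>Hom A (Cod A g) (Cod A f).
        g \<cdot>\<^bsub>A\<^esub> s = t \<cdot>\<^bsub>A\<^esub> f \<and> f \<cdot>\<^bsub>A\<^esub> s' = t' \<cdot>\<^bsub>A\<^esub> g \<and>
        s' \<cdot>\<^bsub>A\<^esub> s = Id A (Dom A f) \<and> t' \<cdot>\<^bsub>A\<^esub> t = Id A (Cod A f))"

definition retract_closed :: "('o, 'm) cat \<Rightarrow> 'm set \<Rightarrow> bool" where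
  "retract_closed A S \<longleftrightarrow> (\<forall>f g. retract_of A f g \<and> g \<in> S \<longrightarrow> f \<in> S)"

definition comm_square :: "('o, 'm) cat \<Rightarrow> 'm \<Rightarrow> 'm \<Rightarrow> 'm \<Rightarrow> 'm \<Rightarrow> bool" where
  "comm_square A i p a b \<longleftrightarrow> i \<in> Mor A \<and> p \<in> Mor A \<and>
     a \<in> Hom A (Dom A i) (Dom A p) \<and> b \<in> Hom A (Cod A i) (Cod A p) \<and> p \<cdot>\<^bsub>A\<^esub> a = b \<cdot>\<^bsub>A\<^esub> i"

definition is_lifting :: "('o, 'm) cat \<Rightarrow> 'm \<Rightarrow> 'm \<Rightarrow> 'm \<Rightarrow> 'm \<Rightarrow> 'm \<Rightarrow> bool" where
  "is_lifting A i p a b s \<longleftrightarrow> s \<in> Hom A (Cod A i) (Dom A p) \<and> s \<cdot>\<^bsub>A\<^esub> i = a \<and> p \<cdot>\<^bsub>A\<^esub> s = b"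

definition factors_through :: "('o, 'm) cat \<Rightarrow> 'm set \<Rightarrow> 'm set \<Rightarrow> 'm \<Rightarrow> bool" where
  "factors_through A L R f \<longleftrightarrow> (\<exists>i\<in>L. \<exists>p\<in>R. Cod A i = Dom A p \<and> f = p \<cdot>\<^bsub>A\<^esub> i)"

locale model_structure =
  fixes A :: "('o, 'm) cat" and CoFib Fib Weq :: "'m set"
  assumes classes: "CoFib \<subseteq> Mor A" "Fib \<subseteq> Mor A" "Weq \<subseteq> Mor A"
    and CM1: "two_out_of_three A Weq"
    and CM2: "retract_closed A CoFib" "retract_closed A Fib" "retract_closed A Weq"
    and CM3: "\<lbrakk>comm_square A i p a b;
        (i \<in> CoFib \<inter> Weq \<and> p \<in> Fib) \<or> (i \<in> CoFib \<and> p \<in> Fib \<inter> Weq)\<rbrakk>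
      \<Longrightarrow> \<exists>s. is_lifting A i p a b s"
    and CM4: "f \<in> Mor A \<Longrightarrow> factors_through A (CoFib \<inter> Weq) Fib f"
      "f \<in> Mor A \<Longrightarrow> factors_through A CoFib (Fib \<inter> Weq) f"

locale orthogonal_model_structure = model_structure +
  assumes lifting_unique: "\<lbrakk>comm_square A i p a b;
        (i \<in> CoFib \<inter> Weq \<and> p \<in> Fib) \<or> (i \<in> CoFib \<and> p \<in> Fib \<inter> Weq);
        is_lifting A i p a b s; is_lifting A i p a b s'\<rbrakk>
      \<Longrightarrow> s = s'"

definition cofibrant_objects :: "('o, 'm) cat \<Rightarrow> 'm set \<Rightarrow> 'o set" where
  "cofibrant_objects A CoFib = {X \<in> Obj A. \<exists>Z. zero_object A Z \<and> (\<exists>f\<in>Hom A Z X. f \<in> CoFib)}"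

definition fibrant_objects :: "('o, 'm) cat \<Rightarrow> 'm set \<Rightarrow> 'o set" where
  "fibrant_objects A Fib = {X \<in> Obj A. \<exists>Z. zero_object A Z \<and> (\<exists>f\<in>Hom A X Z. f \<in> Fib)}"

definition trivial_objects :: "('o, 'm) cat \<Rightarrow> 'm set \<Rightarrow> 'o set" where
  "trivial_objects A Weq = {X \<in> Obj A. \<exists>Z. zero_object A Z \<and> (\<exists>f\<in>Hom A Z X. f \<in> Weq)}"

text \<open>
  Kernels and cokernels are determined only up to isomorphism. The conditions below ask for some
  (co)kernel in \<open>S\<close>, which for an isomorphism-closed \<open>S\<close> is the same as asking it of every one.
\<close>

definition Ker_in :: "('o, 'm) cat \<Rightarrow> 'o set \<Rightarrow> 'm set" where
  "Ker_in A S = {f \<in> Mor A. \<exists>k. is_kernel A f k \<and> Dom A k \<in> S}"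

definition Coker_in :: "('o, 'm) cat \<Rightarrow> 'o set \<Rightarrow> 'm set" where
  "Coker_in A S = {f \<in> Mor A. \<exists>q. is_cokernel A f q \<and> Cod A q \<in> S}"

definition TTF_model_structures :: "('o, 'm) cat \<Rightarrow> ('m set \<times> 'm set \<times> 'm set) set" where
  "TTF_model_structures A = {(CoFib, Fib, Weq). orthogonal_model_structure A CoFib Fib Weq \<and>
     CoFib = Coker_in A (cofibrant_objects A CoFib) \<and>
     Fib = Ker_in A (fibrant_objects A Fib)}"

fun TTF_to_model :: "('o, 'm) cat \<Rightarrow> 'o set \<times> 'o set \<times> 'o set \<Rightarrow> 'm set \<times> 'm set \<times> 'm set" where
  "TTF_to_model A (C, W, F) = (Coker_in A C, Ker_in A F, Ker_in A W \<inter> Coker_in A W)"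

fun model_to_TTF :: "('o, 'm) cat \<Rightarrow> 'm set \<times> 'm set \<times> 'm set \<Rightarrow> 'o set \<times> 'o set \<times> 'o set" where
  "model_to_TTF A (CoFib, Fib, Weq) =
     (cofibrant_objects A CoFib, trivial_objects A Weq, fibrant_objects A Fib)"

end

theory Submission
  imports Defs
begin

text \<open>
  For a TTF triple \<open>(C, W, F)\<close> the three classes are described by test objects: \<open>f\<close> is a
  cofibration iff \<open>Hom(f, w)\<close> is injective for \<open>w \<in> W\<close>, a fibration iff \<open>Hom(w, f)\<close> is
  injective for \<open>w \<in> W\<close>, and a weak equivalence iff \<open>Hom(c, f)\<close> and \<open>Hom(f, x)\<close> are injective
  for \<open>c \<in> C\<close>, \<open>x \<in> F\<close>. Retracts are then immediate, and two-out-of-three follows by pulling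
  back to covers. Trivial cofibrations are the epimorphisms with kernel in \<open>W\<close>, which gives the
  unique lifting; \<open>X \<rightarrow> X/wK \<rightarrow> Y\<close>, with \<open>wK\<close> the \<open>W\<close>-torsion part of \<open>K = Ker f\<close>, is the
  factorization.

  Conversely, in a TTF model structure monomorphisms are fibrations and epimorphisms are
  cofibrations, so cofibrant trivial objects vanish by unique lifting, trivial fibrations are
  monic, and \<open>0 \<rightarrow> Q \<rightarrow> X\<close> gives the torsion sequence of \<open>X\<close> for (cofibrant, trivial).

  The functor sending \<open>X\<close> to the torsion-free quotient (for \<open>(W, F)\<close>) of its torsion part (for
  \<open>(C, W)\<close>) inverts weak equivalences and is the identity on \<open>C \<inter> F\<close>; on the localization it is
  an equivalence, along which the abelian structure of \<open>C \<inter> F\<close> is transported. The dual half of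
  every argument is obtained by passing to the opposite category.
\<close>

section \<open>Categories and duality\<close>

text \<open>Being abelian is a property of the bare category, but all calculation runs in a fixed
  choice of \<open>add\<close> and \<open>zero\<close>: injectivity of \<open>Hom(T, f)\<close> then
  means that \<open>f\<close> kills only zero morphisms from \<open>T\<close>, and diagrams are
  chased with such test morphisms. The obstacle is that a test morphism into the image of
  \<open>f\<close> lifts along \<open>f\<close> only after passing to a cover, and a cover of an
  object of \<open>C\<close> need not lie in \<open>C\<close>. Hence the chase for two-out-of-three
  also decomposes the cover by its own torsion sequence. In the converse direction
  \<open>CoFib\<close> and \<open>Fib\<close> are given by formulas, whereas \<open>Weq\<close> is
  not. Its formula is recovered indirectly: the triple read off from the model structure yields a
  second model structure with the same cofibrations and fibrations, and these two classes determine
  the weak equivalences. The ambient kernel of a morphism of \<open>C \<inter> F\<close> lies in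
  \<open>F\<close> but need not lie in \<open>C\<close>, and dually for cokernels; kernels in
  \<open>C \<inter> F\<close> are therefore ambient kernels cut down to their
  \<open>C\<close>-part.\<close>

definition opc :: "('o, 'm) cat \<Rightarrow> ('o, 'm) cat" where
  "opc A = A\<lparr>Dom := Cod A, Cod := Dom A, Comp := (\<lambda>g f. f \<cdot>\<^bsub>A\<^esub> g)\<rparr>"

text \<open>Objects and morphisms stay the same sets, so a statement about \<open>opc A\<close> has
  the same types as one about \<open>A\<close>. The rewrite rules from here on turn each notion into
  its dual, and a dual lemma becomes an instance at \<open>opc A\<close> followed by
  simplification.\<close>

lemma opc_simps [simp]:
  "Obj (opc A) = Obj A" "Mor (opc A) = Mor A" "Dom (opc A) = Cod A" "Cod (opc A) = Dom A"
  "Id (opc A) = Id A" "g \<cdot>\<^bsub>opc A\<^esub> f = f \<cdot>\<^bsub>A\<^esub> g"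
  by (simp_all add: opc_def)

lemma Hom_opc [simp]: "Hom (opc A) X Y = Hom A Y X"
  by (auto simp: Hom_def)

lemma monic_opc [simp]: "monic (opc A) f = epic A f"
  by (simp add: monic_def epic_def)

lemma epic_opc [simp]: "epic (opc A) f = monic A f"
  by (simp add: monic_def epic_def)

lemma iso_mor_opc [simp]: "iso_mor (opc A) f = iso_mor A f"
  unfolding iso_mor_def by (auto)

lemma zero_object_opc [simp]: "zero_object (opc A) Z = zero_object A Z"
  unfolding zero_object_def by auto

lemma zero_mor_opc [simp]: "zero_mor (opc A) f = zero_mor A f"
  unfolding zero_mor_def by auto

lemma is_kernel_opc [simp]: "is_kernel (opc A) f k = is_cokernel A f k"
  unfolding is_kernel_def is_cokernel_def by simp

lemma is_cokernel_opc [simp]: "is_cokernel (opc A) f k = is_kernel A f k"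
  unfolding is_kernel_def is_cokernel_def by simp

lemma Ker_in_opc [simp]: "Ker_in (opc A) S = Coker_in A S"
  unfolding Ker_in_def Coker_in_def by simp

lemma Coker_in_opc [simp]: "Coker_in (opc A) S = Ker_in A S"
  unfolding Ker_in_def Coker_in_def by simp

lemma short_exact_opc [simp]: "short_exact (opc A) i p = short_exact A p i"
  unfolding short_exact_def by auto

lemma has_biproduct_opcI:
  assumes "has_biproduct A add zero X Y"
  shows "has_biproduct (opc A) add (\<lambda>X Y. zero Y X) X Y"
proof -
  obtain S i j p q where
    "S \<in> Obj A" "i \<in> Hom A X S" "j \<in> Hom A Y S" "p \<in> Hom A S X" "q \<in> Hom A S Y"
    "p \<cdot>\<^bsub>A\<^esub> i = Id A X" "q \<cdot>\<^bsub>A\<^esub> j = Id A Y" "p \<cdot>\<^bsub>A\<^esub> j = zero Y X" "q \<cdot>\<^bsub>A\<^esub> i = zero X Y"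
    "add (i \<cdot>\<^bsub>A\<^esub> p) (j \<cdot>\<^bsub>A\<^esub> q) = Id A S"
    using assms unfolding has_biproduct_def by blast
  then show ?thesis
    unfolding has_biproduct_def
    by (intro bexI[of _ S] bexI[of _ p] bexI[of _ q] bexI[of _ i] bexI[of _ j]) simp_all
qed

lemma full_subcategory_opc [simp]: "full_subcategory (opc A) S = opc (full_subcategory A S)"
  by (simp add: full_subcategory_def opc_def conj_commute)

section \<open>Hom-set calculus in a category\<close>

context category
begin

declare Dom_closed [simp] Cod_closed [simp] Id_closed [simp] Dom_Id [simp] Cod_Id [simp]
  Comp_closed [simp] Dom_Comp [simp] Cod_Comp [simp]

lemma Hom_Obj: "f \<in> Hom A X Y \<Longrightarrow> X \<in> Obj A" "f \<in> Hom A X Y \<Longrightarrow> Y \<in> Obj A"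
  by (auto simp: Hom_def)

lemma Hom_Mor: "f \<in> Hom A X Y \<Longrightarrow> f \<in> Mor A"
  by (simp add: Hom_def)

lemma Mor_Hom: "f \<in> Mor A \<Longrightarrow> f \<in> Hom A (Dom A f) (Cod A f)"
  by (simp add: Hom_def)

lemma Id_Hom: "X \<in> Obj A \<Longrightarrow> Id A X \<in> Hom A X X"
  by (simp add: Hom_def)

lemma comp_Hom: "\<lbrakk>f \<in> Hom A X Y; g \<in> Hom A Y Z\<rbrakk> \<Longrightarrow> g \<cdot> f \<in> Hom A X Z"
  by (simp add: Hom_def)

lemma comp_assoc:
  "\<lbrakk>f \<in> Hom A X Y; g \<in> Hom A Y Z; h \<in> Hom A Z V\<rbrakk> \<Longrightarrow> h \<cdot> (g \<cdot> f) = (h \<cdot> g) \<cdot> f"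
  by (auto simp: Hom_def Comp_assoc)

lemma comp_assoc4:
  "\<lbrakk>f \<in> Hom A X Y; g \<in> Hom A Y Z; h \<in> Hom A Z V; k \<in> Hom A V U\<rbrakk>
    \<Longrightarrow> (k \<cdot> h) \<cdot> (g \<cdot> f) = k \<cdot> ((h \<cdot> g) \<cdot> f)"
  by (auto simp: Hom_def Comp_assoc)

lemma comp_Id: "f \<in> Hom A X Y \<Longrightarrow> f \<cdot> Id A X = f" "f \<in> Hom A X Y \<Longrightarrow> Id A Y \<cdot> f = f"
  by (auto simp: Hom_def Comp_Id_left Comp_Id_right)

lemma category_opc: "category (opc A)"
  by unfold_locales (auto simp: Comp_assoc Comp_Id_left Comp_Id_right)

lemma iso_mor_iff:
  assumes "f \<in> Hom A X Y"
  shows "iso_mor A f \<longleftrightarrow> (\<exists>g\<in>Hom A Y X. g \<cdot> f = Id A X \<and> f \<cdot> g = Id A Y)"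
  using assms unfolding iso_mor_def by (auto simp: Hom_def)

lemma monicD: "\<lbrakk>monic A f; f \<in> Hom A X Y; u \<in> Hom A T X; v \<in> Hom A T X; f \<cdot> u = f \<cdot> v\<rbrakk> \<Longrightarrow> u = v"
  unfolding monic_def Hom_def by auto

lemma epicD: "\<lbrakk>epic A f; f \<in> Hom A X Y; u \<in> Hom A Y T; v \<in> Hom A Y T; u \<cdot> f = v \<cdot> f\<rbrakk> \<Longrightarrow> u = v"
  unfolding epic_def Hom_def by auto

lemma iso_mor_Id: "X \<in> Obj A \<Longrightarrow> iso_mor A (Id A X)"
  using iso_mor_iff[OF Id_Hom[of X]] Id_Hom[of X] comp_Id[OF Id_Hom[of X]] by auto

end

section \<open>Abelian categories\<close>

context preadditive_category
begin

abbreviation homgrp where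
  "homgrp X Y \<equiv> \<lparr>carrier = Hom A X Y, monoid.mult = add, one = zero X Y\<rparr>"

text \<open>The endpoints are arguments because one \<open>add\<close> serves all hom-sets, while an
  inverse is taken in a particular group.\<close>

definition neg :: "'o \<Rightarrow> 'o \<Rightarrow> 'm \<Rightarrow> 'm" where
  "neg X Y f = m_inv (homgrp X Y) f"

lemma hom_group: "\<lbrakk>X \<in> Obj A; Y \<in> Obj A\<rbrakk> \<Longrightarrow> comm_group (homgrp X Y)"
  by (rule Hom_group)

lemma zero_Hom: "\<lbrakk>X \<in> Obj A; Y \<in> Obj A\<rbrakk> \<Longrightarrow> zero X Y \<in> Hom A X Y"
  using monoid.one_closed[OF comm_monoid.axioms(1)[OF comm_group.axioms(1)[OF hom_group]], of X Y]
  by simp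

lemma add_Hom: "\<lbrakk>f \<in> Hom A X Y; g \<in> Hom A X Y\<rbrakk> \<Longrightarrow> add f g \<in> Hom A X Y"
  using monoid.m_closed[OF comm_monoid.axioms(1)[OF comm_group.axioms(1)[OF hom_group]], of X Y f g]
  by (simp add: Hom_Obj)

lemma add_zero: "f \<in> Hom A X Y \<Longrightarrow> add f (zero X Y) = f" "f \<in> Hom A X Y \<Longrightarrow> add (zero X Y) f = f"
  using monoid.r_one[OF comm_monoid.axioms(1)[OF comm_group.axioms(1)[OF hom_group]], of X Y f]
    monoid.l_one[OF comm_monoid.axioms(1)[OF comm_group.axioms(1)[OF hom_group]], of X Y f]
  by (simp_all add: Hom_Obj)

lemma neg_Hom: "f \<in> Hom A X Y \<Longrightarrow> neg X Y f \<in> Hom A X Y"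
  using group.inv_closed[OF comm_group.axioms(2)[OF hom_group], of X Y f]
  by (simp add: Hom_Obj neg_def)

lemma add_neg: "f \<in> Hom A X Y \<Longrightarrow> add f (neg X Y f) = zero X Y"
  using group.r_inv[OF comm_group.axioms(2)[OF hom_group], of X Y f]
  by (simp add: Hom_Obj neg_def)

lemma add_cancel_neg:
  assumes "f \<in> Hom A X Y" "g \<in> Hom A X Y" "add f (neg X Y g) = zero X Y"
  shows "f = g"
proof -
  interpret G: comm_group "homgrp X Y"
    using hom_group assms Hom_Obj by blast
  show ?thesis
    using G.right_cancel[of "neg X Y g" f g] assms neg_Hom[of g X Y] add_neg[of g X Y] by simp
qed

text \<open>Distributivity makes each composite equal to its own double, and cancellation in the
  hom-group leaves the unit.\<close>

lemma comp_zero: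
  assumes "f \<in> Hom A X Y"
  shows "T \<in> Obj A \<Longrightarrow> f \<cdot> zero T X = zero T Y" "T \<in> Obj A \<Longrightarrow> zero Y T \<cdot> f = zero X T"
proof -
  assume T: "T \<in> Obj A"
  note XY = Hom_Obj[OF assms]
  interpret G: comm_group "homgrp T Y"
    using hom_group T XY by blast
  interpret G': comm_group "homgrp X T"
    using hom_group T XY by blast
  have z: "zero T X \<in> Hom A T X" "zero Y T \<in> Hom A Y T"
    using zero_Hom T XY by auto
  have "f \<cdot> zero T X = add (f \<cdot> zero T X) (f \<cdot> zero T X)"
    using Comp_add_right[OF T XY z(1) z(1) assms] add_zero[OF z(1)] by simp
  then show "f \<cdot> zero T X = zero T Y"
    using G.l_cancel_one'[of "f \<cdot> zero T X" "f \<cdot> zero T X"] comp_Hom[OF z(1) assms] by simp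
  have "zero Y T \<cdot> f = add (zero Y T \<cdot> f) (zero Y T \<cdot> f)"
    using Comp_add_left[OF XY T assms z(2) z(2)] add_zero[OF z(2)] by simp
  then show "zero Y T \<cdot> f = zero X T"
    using G'.l_cancel_one'[of "zero Y T \<cdot> f" "zero Y T \<cdot> f"] comp_Hom[OF assms z(2)] by simp
qed

lemma comp_neg:
  assumes "f \<in> Hom A X Y"
  shows "u \<in> Hom A T X \<Longrightarrow> f \<cdot> neg T X u = neg T Y (f \<cdot> u)"
    "u \<in> Hom A Y T \<Longrightarrow> neg Y T u \<cdot> f = neg X T (u \<cdot> f)"
proof -
  note XY = Hom_Obj[OF assms]
  {
    assume u: "u \<in> Hom A T X"
    then have T: "T \<in> Obj A" by (rule Hom_Obj)
    interpret G: comm_group "homgrp T Y"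
      using hom_group T XY by blast
    have "add (f \<cdot> u) (f \<cdot> neg T X u) = zero T Y"
      using Comp_add_right[OF T XY u neg_Hom[OF u] assms] add_neg[OF u] comp_zero[OF assms] T by simp
    then show "f \<cdot> neg T X u = neg T Y (f \<cdot> u)"
      unfolding neg_def[of T Y] using comp_Hom[OF u assms] comp_Hom[OF neg_Hom[OF u] assms]
        G.inv_equality[of "f \<cdot> neg T X u" "f \<cdot> u"] G.m_comm[of "f \<cdot> neg T X u" "f \<cdot> u"] by simp
  next
    assume u: "u \<in> Hom A Y T"
    then have T: "T \<in> Obj A" by (rule Hom_Obj)
    interpret G: comm_group "homgrp X T"
      using hom_group T XY by blast
    have "add (u \<cdot> f) (neg Y T u \<cdot> f) = zero X T"
      using Comp_add_left[OF XY T assms u neg_Hom[OF u]] add_neg[OF u] comp_zero[OF assms] T by simp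
    then show "neg Y T u \<cdot> f = neg X T (u \<cdot> f)"
      unfolding neg_def[of X T] using comp_Hom[OF assms u] comp_Hom[OF assms neg_Hom[OF u]]
        G.inv_equality[of "neg Y T u \<cdot> f" "u \<cdot> f"] G.m_comm[of "neg Y T u \<cdot> f" "u \<cdot> f"] by simp
  }
qed

text \<open>If \<open>f\<close> identifies two morphisms, it kills their difference.\<close>

lemma monicI_null:
  assumes "f \<in> Hom A X Y" "\<And>T u. \<lbrakk>u \<in> Hom A T X; f \<cdot> u = zero T Y\<rbrakk> \<Longrightarrow> u = zero T X"
  shows "monic A f"
  unfolding monic_def
proof (intro conjI ballI impI)
  show "f \<in> Mor A" using assms by (simp add: Hom_def)
  fix g h assume gh: "g \<in> Mor A" "h \<in> Mor A"
    "Dom A g = Dom A h \<and> Cod A g = Dom A f \<and> Cod A h = Dom A f \<and> f \<cdot> g = f \<cdot> h"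
  let ?T = "Dom A g"
  have g: "g \<in> Hom A ?T X" and h: "h \<in> Hom A ?T X" and e: "f \<cdot> g = f \<cdot> h"
    using gh assms(1) by (auto simp: Hom_def)
  have "f \<cdot> add g (neg ?T X h) = add (f \<cdot> g) (neg ?T Y (f \<cdot> h))"
    using Comp_add_right[OF _ _ _ g neg_Hom[OF h] assms(1)] Hom_Obj[OF g] Hom_Obj[OF assms(1)]
      comp_neg(1)[OF assms(1) h] by simp
  then have "f \<cdot> add g (neg ?T X h) = zero ?T Y"
    using add_neg[OF comp_Hom[OF h assms(1)]] e by simp
  then have "add g (neg ?T X h) = zero ?T X"
    using assms(2) add_Hom[OF g neg_Hom[OF h]] by blast
  then show "g = h"
    using add_cancel_neg g h by blast
qed

lemma monic_null:
  assumes "monic A f" "f \<in> Hom A X Y" "u \<in> Hom A T X" "f \<cdot> u = zero T Y"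
  shows "u = zero T X"
  using monicD[OF assms(1-3), of "zero T X"] assms(3,4) zero_Hom comp_zero(1)[OF assms(2)]
    Hom_Obj by metis

lemma zero_objectI:
  assumes "Z \<in> Obj A" "Id A Z = zero Z Z"
  shows "zero_object A Z"
proof -
  have "f = zero Z X" if "f \<in> Hom A Z X" for f X
    using that assms comp_Id comp_zero Hom_Obj by metis
  moreover have "f = zero X Z" if "f \<in> Hom A X Z" for f X
    using that assms comp_Id comp_zero Hom_Obj by metis
  ultimately show ?thesis
    unfolding zero_object_def using assms(1) zero_Hom by metis
qed

lemma preadditive_category_opc: "preadditive_category (opc A) add (\<lambda>X Y. zero Y X)"
proof -
  interpret C: category "opc A" by (rule category_opc)
  show ?thesis
    by (intro preadditive_category.intro C.category_axioms preadditive_category_axioms.intro)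
      (simp_all add: Hom_group Comp_add_right Comp_add_left)
qed

end

section \<open>Zero morphisms and kernels in additive categories\<close>

context additive_category
begin

lemma additive_category_opc: "additive_category (opc A) add (\<lambda>X Y. zero Y X)"
proof -
  interpret C: preadditive_category "opc A" add "\<lambda>X Y. zero Y X" by (rule preadditive_category_opc)
  show ?thesis
    by (intro additive_category.intro C.preadditive_category_axioms additive_category_axioms.intro)
      (auto simp: ex_zero_object ex_biproduct intro: has_biproduct_opcI)
qed

lemma zero_object_Hom:
  assumes "zero_object A Z"
  shows "f \<in> Hom A Z X \<Longrightarrow> f = zero Z X" "f \<in> Hom A X Z \<Longrightarrow> f = zero X Z"
  using assms Hom_Obj zero_Hom unfolding zero_object_def by metis+

lemma zero_object_Obj: "zero_object A Z \<Longrightarrow> Z \<in> Obj A"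
  by (simp add: zero_object_def)

text \<open>Bridges the intrinsic notion used in the definitions of kernel and torsion pair,
  factorization through a zero object, and the unit of the hom-group used in calculations.\<close>

lemma zero_mor_iff:
  assumes "f \<in> Hom A X Y"
  shows "zero_mor A f \<longleftrightarrow> f = zero X Y"
proof
  assume "zero_mor A f"
  then obtain Z g h where *: "zero_object A Z" "g \<in> Hom A X Z" "h \<in> Hom A Z Y" "f = h \<cdot> g"
    using assms unfolding zero_mor_def Hom_def by auto
  then show "f = zero X Y"
    using zero_object_Hom(1)[OF *(1)] comp_zero(2) Hom_Obj by metis
next
  assume f: "f = zero X Y"
  obtain Z where Z: "zero_object A Z" using ex_zero_object by blast
  have g: "zero X Z \<in> Hom A X Z" and h: "zero Z Y \<in> Hom A Z Y"
    using zero_Hom Hom_Obj[OF assms] zero_object_Obj[OF Z] by auto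
  show "zero_mor A f"
    unfolding zero_mor_def
  proof (intro exI conjI)
    show "zero_object A Z" by fact
    show "zero X Z \<in> Hom A (Dom A f) Z" "zero Z Y \<in> Hom A Z (Cod A f)"
      using g h assms by (simp_all add: Hom_def)
    show "f = zero Z Y \<cdot> zero X Z" using f comp_zero(1)[OF h] Hom_Obj[OF assms] by simp
  qed
qed

lemma zero_object_iff: "zero_object A Z \<longleftrightarrow> Z \<in> Obj A \<and> Id A Z = zero Z Z"
  using zero_objectI zero_object_Obj zero_object_Hom(1)[OF _ Id_Hom] by blast

lemma is_kernelD:
  assumes "is_kernel A f k" "f \<in> Hom A X Y"
  shows "\<exists>K\<in>Obj A. k \<in> Hom A K X"
    "k \<in> Hom A K X \<Longrightarrow> f \<cdot> k = zero K Y"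
    "\<lbrakk>k \<in> Hom A K X; g \<in> Hom A T X; f \<cdot> g = zero T Y\<rbrakk> \<Longrightarrow> \<exists>u\<in>Hom A T K. k \<cdot> u = g"
    "monic A k"
proof -
  note k = assms(1)[unfolded is_kernel_def]
  have X: "X = Dom A f" "Y = Cod A f" using assms(2) by (auto simp: Hom_def)
  show "\<exists>K\<in>Obj A. k \<in> Hom A K X"
    using k X by (auto simp: Hom_def)
  show z: "f \<cdot> k = zero K Y" if "k \<in> Hom A K X" for K
    using k that zero_mor_iff[OF comp_Hom[OF that assms(2)]] by blast
  have lift: "\<exists>!u. u \<in> Hom A T K \<and> k \<cdot> u = g"
    if "k \<in> Hom A K X" "g \<in> Hom A T X" "f \<cdot> g = zero T Y" for K T g
  proof -
    have g: "g \<in> Mor A" "Cod A g = Dom A f" "Dom A g = T" "Dom A k = K"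
      using that X by (auto simp: Hom_def)
    have "zero_mor A (f \<cdot> g)"
      using zero_mor_iff[OF comp_Hom[OF that(2) assms(2)]] that(3) by simp
    then show ?thesis
      using k g by blast
  qed
  then show "\<lbrakk>k \<in> Hom A K X; g \<in> Hom A T X; f \<cdot> g = zero T Y\<rbrakk> \<Longrightarrow> \<exists>u\<in>Hom A T K. k \<cdot> u = g"
    by blast
  obtain K where K: "k \<in> Hom A K X" using k X by (auto simp: Hom_def)
  show "monic A k"
  proof (rule monicI_null[OF K])
    fix T u assume u: "u \<in> Hom A T K" "k \<cdot> u = zero T X"
    have T: "T \<in> Obj A" "K \<in> Obj A" using Hom_Obj[OF u(1)] by auto
    have "zero T X \<in> Hom A T X" "f \<cdot> zero T X = zero T Y"
      using zero_Hom Hom_Obj[OF assms(2)] T comp_zero(1)[OF assms(2)] by auto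
    then show "u = zero T K"
      using lift[OF K, of "zero T X" T] u zero_Hom[OF T] comp_zero(1)[OF K T(1)] by auto
  qed
qed

lemma is_kernelI:
  assumes f: "f \<in> Hom A X Y" and k: "k \<in> Hom A K X" and z: "f \<cdot> k = zero K Y" and m: "monic A k"
    and l: "\<And>T g. \<lbrakk>g \<in> Hom A T X; f \<cdot> g = zero T Y\<rbrakk> \<Longrightarrow> \<exists>u\<in>Hom A T K. k \<cdot> u = g"
  shows "is_kernel A f k"
  unfolding is_kernel_def
proof (intro conjI ballI impI)
  show "f \<in> Mor A" "k \<in> Mor A" "Cod A k = Dom A f" using f k by (auto simp: Hom_def)
  show "zero_mor A (f \<cdot> k)" using zero_mor_iff[OF comp_Hom[OF k f]] z by simp
  fix g assume g: "g \<in> Mor A" "Cod A g = Dom A f \<and> zero_mor A (f \<cdot> g)"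
  then have g': "g \<in> Hom A (Dom A g) X" using f by (auto simp: Hom_def)
  then have "f \<cdot> g = zero (Dom A g) Y" using zero_mor_iff[OF comp_Hom[OF g' f]] g by simp
  then obtain u where "u \<in> Hom A (Dom A g) K" "k \<cdot> u = g" using l g' by blast
  moreover have "Dom A k = K" using k by (simp add: Hom_def)
  ultimately show "\<exists>!u. u \<in> Hom A (Dom A g) (Dom A k) \<and> k \<cdot> u = g"
    using monicD[OF m k] by metis
qed

end

text \<open>The existentially quantified additive structure of \<open>abelian_category\<close>
  becomes a pair of locale parameters, so that arguments can name it.\<close>

locale abelian = additive_category +
  assumes ex_kernel: "f \<in> Mor A \<Longrightarrow> \<exists>k. is_kernel A f k"
    and ex_cokernel: "f \<in> Mor A \<Longrightarrow> \<exists>q. is_cokernel A f q"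
    and monic_is_kernel: "monic A f \<Longrightarrow> \<exists>g. is_kernel A g f"
    and epic_is_cokernel: "epic A f \<Longrightarrow> \<exists>g. is_cokernel A g f"

lemma abelian_category_iff: "abelian_category A \<longleftrightarrow> (\<exists>add zero. abelian A add zero)"
  unfolding abelian_category_def abelian_def abelian_axioms_def by blast

section \<open>Images, covers and exactness in abelian categories\<close>

context abelian
begin

text \<open>The zero morphism from \<open>X\<close> to \<open>Y\<close> in \<open>opc A\<close> is
  the one from \<open>Y\<close> to \<open>X\<close> in \<open>A\<close>, whence the swapped
  arguments; addition is untouched. Every dual lemma below instantiates the locale in this
  way.\<close>

lemma abelian_opc: "abelian (opc A) add (\<lambda>X Y. zero Y X)"
proof -
  interpret C: additive_category "opc A" add "\<lambda>X Y. zero Y X" by (rule additive_category_opc)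
  show ?thesis
    by (intro abelian.intro C.additive_category_axioms abelian_axioms.intro)
      (simp_all add: ex_kernel ex_cokernel monic_is_kernel epic_is_cokernel)
qed

lemmas op_additive = abelian.axioms(1)[OF abelian_opc]
lemmas op_preadditive = additive_category.axioms(1)[OF op_additive]

lemma epicI_null:
  assumes "f \<in> Hom A X Y" "\<And>T u. \<lbrakk>u \<in> Hom A Y T; u \<cdot> f = zero X T\<rbrakk> \<Longrightarrow> u = zero Y T"
  shows "epic A f"
  using preadditive_category.monicI_null[OF op_preadditive, of f Y X] assms by simp

lemma epic_null:
  assumes "epic A f" "f \<in> Hom A X Y" "u \<in> Hom A Y T" "u \<cdot> f = zero X T"
  shows "u = zero Y T"
  using preadditive_category.monic_null[OF op_preadditive, of f Y X u T] assms by simp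

lemma is_cokernelD:
  assumes "is_cokernel A f q" "f \<in> Hom A X Y"
  shows "\<exists>Q\<in>Obj A. q \<in> Hom A Y Q"
    "q \<in> Hom A Y Q \<Longrightarrow> q \<cdot> f = zero X Q"
    "\<lbrakk>q \<in> Hom A Y Q; g \<in> Hom A Y T; g \<cdot> f = zero X T\<rbrakk> \<Longrightarrow> \<exists>u\<in>Hom A Q T. u \<cdot> q = g"
    "epic A q"
  using additive_category.is_kernelD[OF op_additive, of f q Y X] assms by simp_all

lemma is_cokernelI:
  assumes "f \<in> Hom A X Y" "q \<in> Hom A Y Q" "q \<cdot> f = zero X Q" "epic A q"
    "\<And>T g. \<lbrakk>g \<in> Hom A Y T; g \<cdot> f = zero X T\<rbrakk> \<Longrightarrow> \<exists>u\<in>Hom A Q T. u \<cdot> q = g"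
  shows "is_cokernel A f q"
  using additive_category.is_kernelI[OF op_additive, of f Y X q Q] assms by simp

lemma obtain_kernel:
  assumes "f \<in> Hom A X Y"
  obtains K k where "K \<in> Obj A" "k \<in> Hom A K X" "is_kernel A f k"
  using ex_kernel[OF Hom_Mor[OF assms]] is_kernelD(1)[OF _ assms] by blast

lemma obtain_cokernel:
  assumes "f \<in> Hom A X Y"
  obtains Q q where "Q \<in> Obj A" "q \<in> Hom A Y Q" "is_cokernel A f q"
  using ex_cokernel[OF Hom_Mor[OF assms]] is_cokernelD(1)[OF _ assms] by blast

text \<open>\<open>f\<close> is a cokernel of some \<open>g\<close>, and \<open>g\<close> factors
  through the kernel \<open>k\<close>; hence whatever kills \<open>k\<close> kills \<open>g\<close>
  and factors through \<open>f\<close>.\<close>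

lemma epic_cokernel_of_kernel:
  assumes e: "epic A f" and k: "is_kernel A f k"
  shows "is_cokernel A k f"
proof -
  obtain X Y where f: "f \<in> Hom A X Y" using e Mor_Hom unfolding epic_def by blast
  obtain g where g: "is_cokernel A g f" using epic_is_cokernel[OF e] by blast
  then obtain S where gS: "g \<in> Hom A S X"
    unfolding is_cokernel_def using f by (auto simp: Hom_def)
  obtain K where K: "k \<in> Hom A K X" using is_kernelD(1)[OF k f] by blast
  have "f \<cdot> g = zero S Y" using is_cokernelD(2)[OF g gS f] .
  then obtain u where u: "u \<in> Hom A S K" "k \<cdot> u = g"
    using is_kernelD(3)[OF k f K gS] by blast
  show ?thesis
  proof (rule is_cokernelI[OF K f is_kernelD(2)[OF k f K] e])
    fix T h assume h: "h \<in> Hom A X T" "h \<cdot> k = zero K T"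
    have "h \<cdot> g = zero S T"
      using u h comp_assoc[OF u(1) K h(1)] comp_zero(2)[OF u(1)] Hom_Obj[OF h(1)] by simp
    then show "\<exists>u\<in>Hom A Y T. u \<cdot> f = h"
      using is_cokernelD(3)[OF g gS f h(1)] by blast
  qed
qed

lemma monic_kernel_of_cokernel: "\<lbrakk>monic A f; is_cokernel A f q\<rbrakk> \<Longrightarrow> is_kernel A q f"
  using abelian.epic_cokernel_of_kernel[OF abelian_opc, of f q] by simp

text \<open>The kernel of \<open>f\<close> is zero, so the identity of \<open>X\<close> kills it and
  factors through \<open>f\<close>, the cokernel of its kernel. This left inverse is two-sided
  because \<open>f\<close> is epic.\<close>

lemma monic_epic_iso:
  assumes "monic A f" "epic A f"
  shows "iso_mor A f"
proof -
  obtain X Y where f: "f \<in> Hom A X Y" using assms Mor_Hom unfolding epic_def by blast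
  obtain K k where k: "K \<in> Obj A" "k \<in> Hom A K X" "is_kernel A f k" using obtain_kernel[OF f] .
  have X: "X \<in> Obj A" "Y \<in> Obj A" using Hom_Obj[OF f] .
  have "k = zero K X"
    using monic_null[OF assms(1) f k(2)] is_kernelD(2)[OF k(3) f k(2)] by blast
  then have "Id A X \<cdot> k = zero K X" using comp_Id(2)[OF k(2)] by simp
  then obtain g where g: "g \<in> Hom A Y X" "g \<cdot> f = Id A X"
    using is_cokernelD(3)[OF epic_cokernel_of_kernel[OF assms(2) k(3)] k(2) f Id_Hom[OF X(1)]] by blast
  have "(f \<cdot> g) \<cdot> f = Id A Y \<cdot> f"
    using comp_assoc[OF f g(1) f] g(2) comp_Id[OF f] by simp
  then have "f \<cdot> g = Id A Y"
    using epicD[OF assms(2) f comp_Hom[OF g(1) f] Id_Hom[OF X(2)]] by simp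
  then show ?thesis using iso_mor_iff[OF f] g by blast
qed

lemma zero_objectI_monic:
  assumes "monic A f" "f \<in> Hom A X Y" "f = zero X Y"
  shows "zero_object A X"
proof -
  have X: "X \<in> Obj A" using Hom_Obj[OF assms(2)] by simp
  have "f \<cdot> Id A X = zero X Y" using comp_Id(1)[OF assms(2)] assms(3) by simp
  then have "Id A X = zero X X" using monic_null[OF assms(1,2) Id_Hom[OF X]] by simp
  then show ?thesis using zero_objectI X by blast
qed

text \<open>The image is the kernel \<open>n\<close> of the cokernel \<open>q\<close>. If
  \<open>h\<close> kills the corestriction \<open>e\<close>, then \<open>f\<close> factors through
  the monomorphism \<open>n \<cdot> j\<close> with \<open>j\<close> a kernel of \<open>h\<close>.
  This is a kernel of some \<open>r\<close>, and \<open>r\<close> kills \<open>f\<close>, so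
  \<open>r\<close> factors through \<open>q\<close> and kills \<open>n\<close> too. Thus
  \<open>n\<close> factors through \<open>n \<cdot> j\<close>, which makes \<open>j\<close> a split
  epimorphism and \<open>h\<close> zero.\<close>

lemma image_factorization:
  assumes f: "f \<in> Hom A X Y" and q: "q \<in> Hom A Y Q" "is_cokernel A f q"
    and n: "n \<in> Hom A I Y" "is_kernel A q n"
  obtains e where "e \<in> Hom A X I" "epic A e" "n \<cdot> e = f"
proof -
  have qf: "q \<cdot> f = zero X Q" using is_cokernelD(2)[OF q(2) f q(1)] .
  have qn: "q \<cdot> n = zero I Q" using is_kernelD(2)[OF n(2) q(1) n(1)] .
  have nm: "monic A n" using is_kernelD(4)[OF n(2) q(1)] .
  obtain e where e: "e \<in> Hom A X I" "n \<cdot> e = f"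
    using is_kernelD(3)[OF n(2) q(1) n(1) f qf] by blast
  have I: "I \<in> Obj A" using Hom_Obj[OF n(1)] by simp
  have "epic A e"
  proof (rule epicI_null[OF e(1)])
    fix T h assume h: "h \<in> Hom A I T" "h \<cdot> e = zero X T"
    obtain J j where j: "J \<in> Obj A" "j \<in> Hom A J I" "is_kernel A h j" using obtain_kernel[OF h(1)] .
    obtain d where d: "d \<in> Hom A X J" "j \<cdot> d = e"
      using is_kernelD(3)[OF j(3) h(1) j(2) e(1) h(2)] by blast
    have nj: "n \<cdot> j \<in> Hom A J Y" using comp_Hom[OF j(2) n(1)] .
    have "monic A (n \<cdot> j)"
    proof (rule monicI_null[OF nj])
      fix S u assume u: "u \<in> Hom A S J" "(n \<cdot> j) \<cdot> u = zero S Y"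
      have "n \<cdot> (j \<cdot> u) = zero S Y" using comp_assoc[OF u(1) j(2) n(1)] u(2) by simp
      then have "j \<cdot> u = zero S I" using monic_null[OF nm n(1) comp_Hom[OF u(1) j(2)]] by simp
      then show "u = zero S J" using monic_null[OF is_kernelD(4)[OF j(3) h(1)] j(2) u(1)] by simp
    qed
    then obtain r where r: "is_kernel A r (n \<cdot> j)" using monic_is_kernel by blast
    then obtain R where rR: "r \<in> Hom A Y R"
      unfolding is_kernel_def using nj by (auto simp: Hom_def)
    have rnj: "r \<cdot> (n \<cdot> j) = zero J R" using is_kernelD(2)[OF r rR nj] .
    have "r \<cdot> f = (r \<cdot> (n \<cdot> j)) \<cdot> d"
      using comp_assoc[OF d(1) nj rR] comp_assoc[OF d(1) j(2) n(1)] d(2) e(2) by simp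
    also have "\<dots> = zero X R" using rnj comp_zero(2)[OF d(1)] Hom_Obj[OF rR] by simp
    finally obtain r' where r': "r' \<in> Hom A Q R" "r' \<cdot> q = r"
      using is_cokernelD(3)[OF q(2) f q(1) rR] by blast
    have "r \<cdot> n = zero I R"
      using comp_assoc[OF n(1) q(1) r'(1)] r'(2) qn comp_zero(1)[OF r'(1) I] by simp
    then obtain s where s: "s \<in> Hom A I J" "(n \<cdot> j) \<cdot> s = n"
      using is_kernelD(3)[OF r rR nj n(1)] by blast
    have "n \<cdot> (j \<cdot> s) = n \<cdot> Id A I"
      using comp_assoc[OF s(1) j(2) n(1)] s(2) comp_Id[OF n(1)] by simp
    then have js: "j \<cdot> s = Id A I"
      using monicD[OF nm n(1) comp_Hom[OF s(1) j(2)] Id_Hom[OF I]] by simp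
    have "h = (h \<cdot> j) \<cdot> s" using js comp_assoc[OF s(1) j(2) h(1)] comp_Id[OF h(1)] by simp
    also have "\<dots> = zero I T"
      using is_kernelD(2)[OF j(3) h(1) j(2)] comp_zero(2)[OF s(1)] Hom_Obj[OF h(1)] by simp
    finally show "h = zero I T" .
  qed
  then show ?thesis using that e by blast
qed

text \<open>Lifting along epimorphisms up to a cover: the substitute for choosing elements.\<close>

lemma epic_pullback:
  assumes p: "p \<in> Hom A X Y" "epic A p" and u: "u \<in> Hom A T Y"
  obtains P e v where "P \<in> Obj A" "e \<in> Hom A P T" "epic A e" "v \<in> Hom A P X" "p \<cdot> v = u \<cdot> e"
    "\<forall>S. \<forall>x\<in>Hom A S P. \<forall>y\<in>Hom A S P. e \<cdot> x = e \<cdot> y \<and> v \<cdot> x = v \<cdot> y \<longrightarrow> x = y"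
    "\<forall>S. \<forall>a\<in>Hom A S T. \<forall>b\<in>Hom A S X. p \<cdot> b = u \<cdot> a \<longrightarrow>
      (\<exists>x\<in>Hom A S P. e \<cdot> x = a \<and> v \<cdot> x = b)"
proof -
  have O: "X \<in> Obj A" "Y \<in> Obj A" "T \<in> Obj A" using Hom_Obj[OF p(1)] Hom_Obj[OF u] by auto
  obtain B i j \<pi> \<rho> where B: "B \<in> Obj A" "i \<in> Hom A X B" "j \<in> Hom A T B" "\<pi> \<in> Hom A B X" "\<rho> \<in> Hom A B T"
    and b: "\<pi> \<cdot> i = Id A X" "\<rho> \<cdot> j = Id A T" "\<pi> \<cdot> j = zero T X" "\<rho> \<cdot> i = zero X T"
      "add (i \<cdot> \<pi>) (j \<cdot> \<rho>) = Id A B"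
    using ex_biproduct[OF O(1) O(3)] unfolding has_biproduct_def by blast
  define u' where "u' = neg T Y u"
  have u': "u' \<in> Hom A T Y" using neg_Hom[OF u] u'_def by simp
  have pp: "p \<cdot> \<pi> \<in> Hom A B Y" and ur: "u' \<cdot> \<rho> \<in> Hom A B Y" using comp_Hom B p u' by auto
  \<comment> \<open>The pullback is built as the kernel of \<open>(p, -u)\<close> on the biproduct
    of \<open>X\<close> and \<open>T\<close>.\<close>
  define h where "h = add (p \<cdot> \<pi>) (u' \<cdot> \<rho>)"
  have h: "h \<in> Hom A B Y" unfolding h_def using add_Hom pp ur .
  have comp_h: "h \<cdot> x = add (p \<cdot> (\<pi> \<cdot> x)) (u' \<cdot> (\<rho> \<cdot> x))" if x: "x \<in> Hom A S B" for x S
    unfolding h_def using Comp_add_left[OF Hom_Obj(1)[OF x] B(1) O(2) x pp ur]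
      comp_assoc[OF x B(4) p(1)] comp_assoc[OF x B(5) u'] by simp
  have hi: "h \<cdot> i = p"
    using comp_h[OF B(2)] b comp_Id[OF p(1)] comp_zero(1)[OF u' O(1)] add_zero[OF p(1)] by simp
  have he: "epic A h"
  proof (rule epicI_null[OF h])
    fix S x assume x: "x \<in> Hom A Y S" "x \<cdot> h = zero B S"
    have "x \<cdot> p = (x \<cdot> h) \<cdot> i" using comp_assoc[OF B(2) h x(1)] hi by simp
    also have "\<dots> = zero X S" using x comp_zero(2)[OF B(2)] Hom_Obj[OF x(1)] by simp
    finally show "x = zero Y S" using epic_null[OF p(2,1) x(1)] by simp
  qed
  obtain P k where k: "P \<in> Obj A" "k \<in> Hom A P B" "is_kernel A h k" using obtain_kernel[OF h] .
  have hk: "h \<cdot> k = zero P Y" using is_kernelD(2)[OF k(3) h k(2)] .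
  have km: "monic A k" using is_kernelD(4)[OF k(3) h] .
  define e v where "e = \<rho> \<cdot> k" and "v = \<pi> \<cdot> k"
  have e: "e \<in> Hom A P T" and v: "v \<in> Hom A P X" using e_def v_def comp_Hom B k by auto
  have "add (p \<cdot> v) (u' \<cdot> e) = zero P Y" using comp_h[OF k(2)] hk e_def v_def by simp
  then have pv: "p \<cdot> v = u \<cdot> e"
    using comp_neg(2)[OF e u] u'_def add_cancel_neg[OF comp_Hom[OF v p(1)] comp_Hom[OF e u]] by simp
  \<comment> \<open>If \<open>x\<close> kills \<open>e\<close>, then \<open>x \<cdot> \<rho>\<close>
    kills the kernel of the epimorphism \<open>h\<close> and factors as \<open>t \<cdot> h\<close>.
    Restricting to the summand \<open>X\<close> gives \<open>t \<cdot> p = 0\<close>, so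
    \<open>t\<close> vanishes, and restricting to the summand \<open>T\<close> gives
    \<open>x = 0\<close>.\<close>
  have ee: "epic A e"
  proof (rule epicI_null[OF e])
    fix S x assume x: "x \<in> Hom A T S" "x \<cdot> e = zero P S"
    have S: "S \<in> Obj A" using Hom_Obj[OF x(1)] by simp
    have xr: "x \<cdot> \<rho> \<in> Hom A B S" using comp_Hom[OF B(5) x(1)] .
    have "(x \<cdot> \<rho>) \<cdot> k = zero P S" using comp_assoc[OF k(2) B(5) x(1)] x(2) e_def by simp
    then obtain t where t: "t \<in> Hom A Y S" "t \<cdot> h = x \<cdot> \<rho>"
      using is_cokernelD(3)[OF epic_cokernel_of_kernel[OF he k(3)] k(2) h xr] by blast
    have "t \<cdot> p = (x \<cdot> \<rho>) \<cdot> i" using comp_assoc[OF B(2) h t(1)] hi t(2) by simp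
    also have "\<dots> = zero X S" using comp_assoc[OF B(2) B(5) x(1)] b comp_zero(1)[OF x(1) O(1)] by simp
    finally have "t = zero Y S" using epic_null[OF p(2,1) t(1)] by simp
    then have "x \<cdot> \<rho> = zero B S" using t(2) comp_zero(2)[OF h S] by simp
    then have "x \<cdot> (\<rho> \<cdot> j) = zero T S"
      using comp_assoc[OF B(3) B(5) x(1)] comp_zero(2)[OF B(3) S] by simp
    then show "x = zero T S" using b comp_Id[OF x(1)] by simp
  qed
  \<comment> \<open>Morphisms into the biproduct are determined by their two projections; with
    \<open>k\<close> monic this gives uniqueness in the pullback.\<close>
  have decomp: "y = add (i \<cdot> (\<pi> \<cdot> y)) (j \<cdot> (\<rho> \<cdot> y))" if y: "y \<in> Hom A S B" for y S
    using Comp_add_left[OF Hom_Obj(1)[OF y] B(1) B(1) y comp_Hom[OF B(4) B(2)] comp_Hom[OF B(5) B(3)]]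
      b(5) comp_Id[OF y] comp_assoc[OF y B(4) B(2)] comp_assoc[OF y B(5) B(3)] by simp
  have inj: "x = y" if x: "x \<in> Hom A S P" and y: "y \<in> Hom A S P"
    and eq: "e \<cdot> x = e \<cdot> y" "v \<cdot> x = v \<cdot> y" for x y S
  proof -
    have "\<rho> \<cdot> (k \<cdot> x) = \<rho> \<cdot> (k \<cdot> y)" "\<pi> \<cdot> (k \<cdot> x) = \<pi> \<cdot> (k \<cdot> y)"
      using eq e_def v_def comp_assoc[OF x k(2) B(5)] comp_assoc[OF x k(2) B(4)]
        comp_assoc[OF y k(2) B(5)] comp_assoc[OF y k(2) B(4)] by auto
    then have "k \<cdot> x = k \<cdot> y"
      using decomp[OF comp_Hom[OF x k(2)]] decomp[OF comp_Hom[OF y k(2)]] by simp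
    then show ?thesis using monicD[OF km k(2) x y] by simp
  qed
  have ex: "\<exists>x\<in>Hom A S P. e \<cdot> x = a \<and> v \<cdot> x = c"
    if a: "a \<in> Hom A S T" and c: "c \<in> Hom A S X" and eq: "p \<cdot> c = u \<cdot> a" for S a c
  proof -
    have S: "S \<in> Obj A" using Hom_Obj[OF a] by simp
    have ic: "i \<cdot> c \<in> Hom A S B" and ja: "j \<cdot> a \<in> Hom A S B" using comp_Hom a c B by auto
    define y where "y = add (i \<cdot> c) (j \<cdot> a)"
    have y: "y \<in> Hom A S B" unfolding y_def using add_Hom[OF ic ja] .
    have py: "\<pi> \<cdot> y = c"
      unfolding y_def using Comp_add_right[OF S B(1) O(1) ic ja B(4)] comp_assoc[OF c B(2,4)]
        comp_assoc[OF a B(3,4)] b comp_Id[OF c] comp_zero(2)[OF a O(1)] add_zero[OF c] by simp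
    have ry: "\<rho> \<cdot> y = a"
      unfolding y_def using Comp_add_right[OF S B(1) O(3) ic ja B(5)] comp_assoc[OF c B(2,5)]
        comp_assoc[OF a B(3,5)] b comp_Id[OF a] comp_zero(2)[OF c O(3)] add_zero[OF a] by simp
    have "h \<cdot> y = add (u \<cdot> a) (neg S Y (u \<cdot> a))"
      using comp_h[OF y] py ry eq u'_def comp_neg(2)[OF a u] by simp
    then have "h \<cdot> y = zero S Y" using add_neg[OF comp_Hom[OF a u]] by simp
    then obtain x where x: "x \<in> Hom A S P" "k \<cdot> x = y" using is_kernelD(3)[OF k(3) h k(2) y] by blast
    then show ?thesis using e_def v_def py ry comp_assoc[OF x(1) k(2) B(4)] comp_assoc[OF x(1) k(2) B(5)]
      by auto
  qed
  show ?thesis using that[OF k(1) e ee v pv] inj ex by blast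
qed

end

section \<open>Torsion pairs\<close>

definition null_monic :: "('o, 'm) cat \<Rightarrow> ('o \<Rightarrow> 'o \<Rightarrow> 'm) \<Rightarrow> 'o set \<Rightarrow> 'm \<Rightarrow> bool" where
  "null_monic A zero S f \<longleftrightarrow> f \<in> Mor A \<and>
     (\<forall>T\<in>S. \<forall>u\<in>Hom A T (Dom A f). f \<cdot>\<^bsub>A\<^esub> u = zero T (Cod A f) \<longrightarrow> u = zero T (Dom A f))"

definition null_epic :: "('o, 'm) cat \<Rightarrow> ('o \<Rightarrow> 'o \<Rightarrow> 'm) \<Rightarrow> 'o set \<Rightarrow> 'm \<Rightarrow> bool" where
  "null_epic A zero S f \<longleftrightarrow> f \<in> Mor A \<and>
     (\<forall>T\<in>S. \<forall>u\<in>Hom A (Cod A f) T. u \<cdot>\<^bsub>A\<^esub> f = zero (Dom A f) T \<longrightarrow> u = zero (Cod A f) T)"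

text \<open>The zero family is an explicit parameter of both predicates because duality swaps its
  arguments; with it the two notions are exchanged by a rewrite rule.\<close>

lemma null_monic_opc [simp]: "null_monic (opc A) (\<lambda>X Y. zero Y X) S f = null_epic A zero S f"
  by (simp add: null_monic_def null_epic_def)

lemma null_epic_opc [simp]: "null_epic (opc A) (\<lambda>X Y. zero Y X) S f = null_monic A zero S f"
  by (simp add: null_monic_def null_epic_def)

lemma two_out_of_three_opc [simp]: "two_out_of_three (opc A) S = two_out_of_three A S"
  unfolding two_out_of_three_def by auto

lemma retract_of_opc [simp]: "retract_of (opc A) f g = retract_of A f g"
  unfolding retract_of_def by (auto simp: eq_commute)

lemma retract_closed_opc [simp]: "retract_closed (opc A) S = retract_closed A S"
  unfolding retract_closed_def by simp

lemma comm_square_opc [simp]: "comm_square (opc A) i p a b = comm_square A p i b a"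
  unfolding comm_square_def by auto

lemma is_lifting_opc [simp]: "is_lifting (opc A) i p a b s = is_lifting A p i b a s"
  unfolding is_lifting_def by auto

lemma factors_through_opc [simp]: "factors_through (opc A) L R f = factors_through A R L f"
  unfolding factors_through_def by simp metis

lemma cofibrant_objects_opc [simp]: "cofibrant_objects (opc A) S = fibrant_objects A S"
  unfolding cofibrant_objects_def fibrant_objects_def by auto

lemma fibrant_objects_opc [simp]: "fibrant_objects (opc A) S = cofibrant_objects A S"
  unfolding cofibrant_objects_def fibrant_objects_def by auto

context category
begin

lemma iso_mor_inverse:
  assumes "f \<in> Hom A X Y" "iso_mor A f"
  obtains g where "g \<in> Hom A Y X" "iso_mor A g" "g \<cdot> f = Id A X" "f \<cdot> g = Id A Y"
proof -
  obtain g where g: "g \<in> Hom A Y X" "g \<cdot> f = Id A X" "f \<cdot> g = Id A Y"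
    using assms iso_mor_iff by blast
  then have "iso_mor A g" using iso_mor_iff[OF g(1)] assms(1) by blast
  then show ?thesis using that g by blast
qed

lemma iso_obj_sym: "iso_obj A X Y \<Longrightarrow> iso_obj A Y X"
  unfolding iso_obj_def using iso_mor_inverse by metis

lemma iso_closed_opc: "iso_closed (opc A) S = iso_closed A S"
proof -
  have "iso_obj (opc A) X Y = iso_obj A Y X" for X Y
    unfolding iso_obj_def by simp
  then show ?thesis
    unfolding iso_closed_def using iso_obj_sym by (metis opc_simps(1))
qed

lemma torsion_pair_opc: "torsion_pair (opc A) F T = torsion_pair A T F"
  unfolding torsion_pair_def iso_closed_opc by simp blast

lemma iso_mor_monic: "iso_mor A f \<Longrightarrow> monic A f"
proof -
  assume i: "iso_mor A f"
  then have f: "f \<in> Hom A (Dom A f) (Cod A f)" by (simp add: iso_mor_def Mor_Hom)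
  obtain g where g: "g \<in> Hom A (Cod A f) (Dom A f)" "g \<cdot> f = Id A (Dom A f)"
    using i unfolding iso_mor_def by blast
  have "u = g \<cdot> (f \<cdot> u)" if "u \<in> Hom A T (Dom A f)" for u T
    using comp_assoc[OF that f g(1)] g(2) comp_Id[OF that] by simp
  then show ?thesis
    unfolding monic_def using f by (metis Hom_Mor Mor_Hom)
qed

end

lemma (in category) iso_mor_epic: "iso_mor A f \<Longrightarrow> epic A f"
  using category.iso_mor_monic[OF category_opc, of f] by simp

section \<open>Torsion pairs through test objects\<close>

context abelian
begin

lemma null_monicI:
  assumes "f \<in> Hom A X Y"
    "\<And>T u. \<lbrakk>T \<in> S; u \<in> Hom A T X; f \<cdot> u = zero T Y\<rbrakk> \<Longrightarrow> u = zero T X"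
  shows "null_monic A zero S f"
  using assms unfolding null_monic_def by (auto simp: Hom_def)

lemma null_monicD:
  assumes "null_monic A zero S f" "f \<in> Hom A X Y" "T \<in> S" "u \<in> Hom A T X" "f \<cdot> u = zero T Y"
  shows "u = zero T X"
proof -
  have "Dom A f = X" "Cod A f = Y" using assms(2) by (simp_all add: Hom_def)
  then show ?thesis using assms unfolding null_monic_def by blast
qed

lemma null_epicI:
  assumes "f \<in> Hom A X Y"
    "\<And>T u. \<lbrakk>T \<in> S; u \<in> Hom A Y T; u \<cdot> f = zero X T\<rbrakk> \<Longrightarrow> u = zero Y T"
  shows "null_epic A zero S f"
  using assms unfolding null_epic_def by (auto simp: Hom_def)

lemma null_epicD:
  assumes "null_epic A zero S f" "f \<in> Hom A X Y" "T \<in> S" "u \<in> Hom A Y T" "u \<cdot> f = zero X T"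
  shows "u = zero Y T"
proof -
  have "Dom A f = X" "Cod A f = Y" using assms(2) by (simp_all add: Hom_def)
  then show ?thesis using assms unfolding null_epic_def by blast
qed

lemma monic_null_monic: "monic A f \<Longrightarrow> null_monic A zero S f"
  using null_monicI[OF Mor_Hom] monic_null[OF _ Mor_Hom] unfolding monic_def by metis

lemma epic_null_epic: "epic A f \<Longrightarrow> null_epic A zero S f"
  using null_epicI[OF Mor_Hom] epic_null[OF _ Mor_Hom] unfolding epic_def by metis

lemma null_monic_comp:
  assumes f: "f \<in> Hom A X Y" "null_monic A zero S f" and g: "g \<in> Hom A Y Z" "null_monic A zero S g"
  shows "null_monic A zero S (g \<cdot> f)"
proof (rule null_monicI[OF comp_Hom[OF f(1) g(1)]])
  fix T u assume u: "T \<in> S" "u \<in> Hom A T X" "(g \<cdot> f) \<cdot> u = zero T Z"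
  then have "g \<cdot> (f \<cdot> u) = zero T Z" using comp_assoc[OF u(2) f(1) g(1)] by simp
  then have "f \<cdot> u = zero T Y" using null_monicD[OF g(2,1) u(1) comp_Hom[OF u(2) f(1)]] by simp
  then show "u = zero T X" using null_monicD[OF f(2,1) u(1,2)] by simp
qed

lemma null_monic_right:
  assumes f: "f \<in> Hom A X Y" and g: "g \<in> Hom A Y Z" and gf: "null_monic A zero S (g \<cdot> f)"
  shows "null_monic A zero S f"
proof (rule null_monicI[OF f])
  fix T u assume u: "T \<in> S" "u \<in> Hom A T X" "f \<cdot> u = zero T Y"
  then have "(g \<cdot> f) \<cdot> u = zero T Z"
    using comp_assoc[OF u(2) f(1) g(1)] comp_zero(1)[OF g] Hom_Obj[OF u(2)] by simp
  then show "u = zero T X" using null_monicD[OF gf comp_Hom[OF f g] u(1,2)] by simp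
qed

lemma null_epic_comp:
  assumes "f \<in> Hom A X Y" "null_epic A zero S f" "g \<in> Hom A Y Z" "null_epic A zero S g"
  shows "null_epic A zero S (g \<cdot> f)"
  using abelian.null_monic_comp[OF abelian_opc, of g Z Y S f X] assms by simp

lemma null_epic_left:
  assumes "f \<in> Hom A X Y" "g \<in> Hom A Y Z" "null_epic A zero S (g \<cdot> f)"
  shows "null_epic A zero S g"
  using abelian.null_monic_right[OF abelian_opc, of g Z Y f X S] assms by simp

text \<open>A test morphism \<open>u\<close> killed by \<open>f\<close> gives
  \<open>s \<cdot> u\<close> killed by \<open>g\<close>, and \<open>s'\<close> recovers
  \<open>u\<close> from \<open>s \<cdot> u\<close>.\<close>

lemma retract_closed_null_monic: "retract_closed A {f. null_monic A zero S f}"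
  unfolding retract_closed_def
proof (intro allI impI, elim conjE)
  fix f g assume r: "retract_of A f g" and g: "g \<in> {f. null_monic A zero S f}"
  define X Y X' Y' where d: "X = Dom A f" "Y = Cod A f" "X' = Dom A g" "Y' = Cod A g"
  have fg: "f \<in> Hom A X Y" "g \<in> Hom A X' Y'" using r unfolding retract_of_def d Hom_def by auto
  obtain s t s' where s: "s \<in> Hom A X X'" "t \<in> Hom A Y Y'" "s' \<in> Hom A X' X" "g \<cdot> s = t \<cdot> f"
    "s' \<cdot> s = Id A X"
    using r unfolding retract_of_def d by blast
  have "null_monic A zero S f"
  proof (rule null_monicI[OF fg(1)])
    fix T u assume u: "T \<in> S" "u \<in> Hom A T X" "f \<cdot> u = zero T Y"
    have T: "T \<in> Obj A" using Hom_Obj[OF u(2)] by simp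
    have "g \<cdot> (s \<cdot> u) = t \<cdot> (f \<cdot> u)"
      using comp_assoc[OF u(2) s(1) fg(2)] s(4) comp_assoc[OF u(2) fg(1) s(2)] by simp
    then have "g \<cdot> (s \<cdot> u) = zero T Y'" using u(3) comp_zero(1)[OF s(2) T] by simp
    then have "s \<cdot> u = zero T X'"
      using null_monicD[OF _ fg(2) u(1) comp_Hom[OF u(2) s(1)]] g by simp
    then show "u = zero T X"
      using comp_assoc[OF u(2) s(1) s(3)] s(5) comp_zero(1)[OF s(3) T] comp_Id[OF u(2)] by simp
  qed
  then show "f \<in> {f. null_monic A zero S f}" by simp
qed

lemma retract_closed_null_epic: "retract_closed A {f. null_epic A zero S f}"
  using abelian.retract_closed_null_monic[OF abelian_opc, of S] by simp

lemma torsion_null: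
  "\<lbrakk>torsion_pair A T F; X \<in> T; Y \<in> F; f \<in> Hom A X Y\<rbrakk> \<Longrightarrow> f = zero X Y"
  unfolding torsion_pair_def using zero_mor_iff by metis

lemma torsion_Obj: "torsion_pair A T F \<Longrightarrow> X \<in> T \<union> F \<Longrightarrow> X \<in> Obj A"
  unfolding torsion_pair_def iso_closed_def by blast

lemma torsion_seq:
  assumes "torsion_pair A T F" "X \<in> Obj A"
  obtains T' F' i p where "T' \<in> T" "F' \<in> F" "i \<in> Hom A T' X" "p \<in> Hom A X F'"
    "is_kernel A p i" "is_cokernel A i p"
  using assms unfolding torsion_pair_def short_exact_def by metis

text \<open>Each class of a torsion pair is the orthogonal of the other. If all morphisms from
  \<open>X\<close> to \<open>F\<close> vanish, so does the projection to the torsion-free quotient;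
  the identity then factors through the torsion part, whose inclusion becomes an
  isomorphism.\<close>

lemma in_torsion_iff:
  assumes tp: "torsion_pair A T F"
  shows "X \<in> T \<longleftrightarrow> X \<in> Obj A \<and> (\<forall>Y\<in>F. \<forall>u\<in>Hom A X Y. u = zero X Y)"
proof
  assume "X \<in> T"
  then show "X \<in> Obj A \<and> (\<forall>Y\<in>F. \<forall>u\<in>Hom A X Y. u = zero X Y)"
    using torsion_null[OF tp] torsion_Obj[OF tp] by blast
next
  assume X: "X \<in> Obj A \<and> (\<forall>Y\<in>F. \<forall>u\<in>Hom A X Y. u = zero X Y)"
  obtain T' F' i p where s: "T' \<in> T" "F' \<in> F" "i \<in> Hom A T' X" "p \<in> Hom A X F'"
    "is_kernel A p i" "is_cokernel A i p" using torsion_seq[OF tp] X by blast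
  have p: "p = zero X F'" using X s by blast
  have "p \<cdot> Id A X = zero X F'" using comp_Id(1)[OF s(4)] p by simp
  then obtain j where j: "j \<in> Hom A X T'" "i \<cdot> j = Id A X"
    using is_kernelD(3)[OF s(5,4,3) Id_Hom] X by blast
  have "epic A i"
  proof (rule epicI_null[OF s(3)])
    fix S u assume u: "u \<in> Hom A X S" "u \<cdot> i = zero T' S"
    have "u = (u \<cdot> i) \<cdot> j" using comp_assoc[OF j(1) s(3) u(1)] j(2) comp_Id[OF u(1)] by simp
    then show "u = zero X S" using u(2) comp_zero(2)[OF j(1)] Hom_Obj[OF u(1)] by simp
  qed
  then have "iso_mor A i" using monic_epic_iso is_kernelD(4)[OF s(5,4)] by blast
  then have "iso_obj A T' X" unfolding iso_obj_def using s(3) by blast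
  then show "X \<in> T" using tp s(1) X unfolding torsion_pair_def iso_closed_def by blast
qed

lemma in_torsion_free_iff:
  assumes tp: "torsion_pair A T F"
  shows "X \<in> F \<longleftrightarrow> X \<in> Obj A \<and> (\<forall>Y\<in>T. \<forall>u\<in>Hom A Y X. u = zero Y X)"
  using abelian.in_torsion_iff[OF abelian_opc, of F T X] tp by (simp add: torsion_pair_opc)

text \<open>Morphisms from \<open>S\<close> that \<open>f\<close> kills are the morphisms from
  \<open>S\<close> to the kernel, and the kernel lies in \<open>F\<close> exactly when all of these
  vanish for \<open>S\<close> in \<open>T\<close>.\<close>

lemma Ker_in_iff:
  assumes tp: "torsion_pair A T F"
  shows "f \<in> Ker_in A F \<longleftrightarrow> null_monic A zero T f"
proof
  assume f: "f \<in> Ker_in A F"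
  define X Y where "X = Dom A f" "Y = Cod A f"
  then have fH: "f \<in> Hom A X Y" using f unfolding Ker_in_def Hom_def by simp
  obtain k where k: "is_kernel A f k" "Dom A k \<in> F" using f unfolding Ker_in_def by blast
  then obtain K where K: "k \<in> Hom A K X" "K \<in> F"
    using is_kernelD(1)[OF k(1) fH] by (auto simp: Hom_def)
  show "null_monic A zero T f"
  proof (rule null_monicI[OF fH])
    fix S u assume u: "S \<in> T" "u \<in> Hom A S X" "f \<cdot> u = zero S Y"
    then obtain v where v: "v \<in> Hom A S K" "k \<cdot> v = u"
      using is_kernelD(3)[OF k(1) fH K(1)] by blast
    then have "v = zero S K" using torsion_null[OF tp u(1) K(2)] by blast
    then show "u = zero S X" using v(2) comp_zero(1)[OF K(1)] Hom_Obj[OF u(2)] by simp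
  qed
next
  assume f: "null_monic A zero T f"
  define X Y where "X = Dom A f" "Y = Cod A f"
  then have fH: "f \<in> Hom A X Y" using f unfolding null_monic_def Hom_def by simp
  obtain K k where k: "K \<in> Obj A" "k \<in> Hom A K X" "is_kernel A f k" using obtain_kernel[OF fH] .
  have "v = zero S K" if v: "S \<in> T" "v \<in> Hom A S K" for S v
  proof -
    have S: "S \<in> Obj A" using Hom_Obj[OF v(2)] by simp
    have "f \<cdot> (k \<cdot> v) = zero S Y"
      using comp_assoc[OF v(2) k(2) fH] is_kernelD(2)[OF k(3) fH k(2)] comp_zero(2)[OF v(2)]
        Hom_Obj[OF fH] by simp
    then have "k \<cdot> v = zero S X" using null_monicD[OF f fH v(1) comp_Hom[OF v(2) k(2)]] by simp
    then show ?thesis using monic_null[OF is_kernelD(4)[OF k(3) fH] k(2) v(2)] by simp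
  qed
  then have "K \<in> F" using in_torsion_free_iff[OF tp] k(1) by blast
  moreover have "Dom A k = K" using k(2) by (simp add: Hom_def)
  ultimately show "f \<in> Ker_in A F" unfolding Ker_in_def using k(3) fH by (auto simp: Hom_def)
qed

lemma Coker_in_iff:
  "torsion_pair A T F \<Longrightarrow> f \<in> Coker_in A T \<longleftrightarrow> null_epic A zero F f"
  using abelian.Ker_in_iff[OF abelian_opc, of F T f] by (simp add: torsion_pair_opc)

end

section \<open>The model structure of a TTF triple\<close>

locale ttf = abelian +
  fixes C W F
  assumes CW: "torsion_pair A C W" and WF: "torsion_pair A W F"
begin

lemma ttf_opc: "ttf (opc A) add (\<lambda>X Y. zero Y X) F W C"
  using abelian_opc CW WF by (simp add: ttf_def ttf_axioms_def torsion_pair_opc)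

text \<open>The middle class is used in both of its roles: as the torsion-free class of
  \<open>(C, W)\<close> it is tested by morphisms from \<open>C\<close>, which governs kernels, and
  as the torsion class of \<open>(W, F)\<close> by morphisms into \<open>F\<close>, which governs
  cokernels. The conjunction is self-dual under exchanging \<open>C\<close> and
  \<open>F\<close>.\<close>

definition weq where
  "weq f \<longleftrightarrow> null_monic A zero C f \<and> null_epic A zero F f"

lemma weq_opc: "ttf.weq (opc A) (\<lambda>X Y. zero Y X) F C f = weq f"
  using ttf.weq_def[OF ttf_opc] weq_def by auto

lemma Weq_iff: "f \<in> Ker_in A W \<inter> Coker_in A W \<longleftrightarrow> weq f"
  using Ker_in_iff[OF CW] Coker_in_iff[OF WF] weq_def by auto

lemma CoFib_iff: "f \<in> Coker_in A C \<longleftrightarrow> null_epic A zero W f"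
  using Coker_in_iff[OF CW] .

lemma Fib_iff: "f \<in> Ker_in A F \<longleftrightarrow> null_monic A zero W f"
  using Ker_in_iff[OF WF] .

lemma weq_comp:
  "\<lbrakk>f \<in> Hom A X Y; g \<in> Hom A Y Z; weq f; weq g\<rbrakk> \<Longrightarrow> weq (g \<cdot> f)"
  unfolding weq_def using null_monic_comp null_epic_comp by blast

text \<open>
  A map \<open>u\<close> from an object of \<open>C\<close> killed by \<open>g\<close> factors through the image of \<open>f\<close>, and so lifts
  to \<open>X\<close> on a cover; on the \<open>C\<close>-part of the cover the lift is killed by \<open>g \<cdot> f\<close>, so \<open>u\<close>
  restricted to the cover factors through an object of \<open>W\<close>.
\<close>

lemma null_monic_left:
  assumes f: "f \<in> Hom A X Y" and g: "g \<in> Hom A Y Z" and wf: "weq f" and wgf: "weq (g \<cdot> f)"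
  shows "null_monic A zero C g"
proof (rule null_monicI[OF g])
  fix T u assume T: "T \<in> C" and u: "u \<in> Hom A T Y" and gu: "g \<cdot> u = zero T Z"
  have O: "X \<in> Obj A" "Y \<in> Obj A" "Z \<in> Obj A" "T \<in> Obj A"
    using Hom_Obj[OF f] Hom_Obj[OF g] Hom_Obj[OF u] by auto
  have "f \<in> Coker_in A W" using wf Weq_iff by blast
  then obtain q where q: "is_cokernel A f q" "Cod A q \<in> W" unfolding Coker_in_def by blast
  then obtain Q where qH: "q \<in> Hom A Y Q" "Q \<in> W"
    using is_cokernelD(1)[OF q(1) f] by (auto simp: Hom_def)
  \<comment> \<open>The cokernel of \<open>f\<close> lies in \<open>W\<close>, so no nonzero
    morphism from \<open>T\<close> reaches it, and \<open>u\<close> lands in the image of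
    \<open>f\<close>.\<close>
  have "q \<cdot> u = zero T Q" using torsion_null[OF CW T qH(2) comp_Hom[OF u qH(1)]] .
  obtain I n where n: "I \<in> Obj A" "n \<in> Hom A I Y" "is_kernel A q n" using obtain_kernel[OF qH(1)] .
  obtain e' where e': "e' \<in> Hom A X I" "epic A e'" "n \<cdot> e' = f"
    using image_factorization[OF f qH(1) q(1) n(2,3)] .
  obtain u' where u': "u' \<in> Hom A T I" "n \<cdot> u' = u"
    using is_kernelD(3)[OF n(3) qH(1) n(2) u] \<open>q \<cdot> u = zero T Q\<close> by blast
  obtain P e v where P: "P \<in> Obj A" "e \<in> Hom A P T" "epic A e" "v \<in> Hom A P X" "e' \<cdot> v = u' \<cdot> e"
    using epic_pullback[OF e'(1,2) u'(1)] .
  have fv: "f \<cdot> v = u \<cdot> e"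
    using comp_assoc[OF P(4) e'(1) n(2)] comp_assoc[OF P(2) u'(1) n(2)] e'(3) u'(2) P(5) by simp
  obtain D V m r where D: "D \<in> C" "V \<in> W" "m \<in> Hom A D P" "r \<in> Hom A P V" "is_cokernel A m r"
    using torsion_seq[OF CW P(1)] by metis
  have DO: "D \<in> Obj A" using torsion_Obj[OF CW] D by blast
  have "(g \<cdot> f) \<cdot> v = g \<cdot> (u \<cdot> e)" using comp_assoc[OF P(4) f g] fv by simp
  also have "\<dots> = zero P Z" using comp_assoc[OF P(2) u g] gu comp_zero(2)[OF P(2) O(3)] by simp
  finally have "(g \<cdot> f) \<cdot> (v \<cdot> m) = zero D Z"
    using comp_assoc[OF D(3) P(4) comp_Hom[OF f g]] comp_zero(2)[OF D(3) O(3)] by simp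
  then have "v \<cdot> m = zero D X"
    using null_monicD[OF _ comp_Hom[OF f g] D(1) comp_Hom[OF D(3) P(4)]] wgf weq_def by blast
  then have "(u \<cdot> e) \<cdot> m = zero D Y"
    using comp_assoc[OF D(3) P(4) f] fv comp_zero(1)[OF f DO] by simp
  then obtain t where t: "t \<in> Hom A V Y" "t \<cdot> r = u \<cdot> e"
    using is_cokernelD(3)[OF D(5,3,4) comp_Hom[OF P(2) u]] by blast
  \<comment> \<open>The projection \<open>\<rho>\<close> of \<open>Y\<close> to its
    \<open>F\<close>-quotient vanishes on the object \<open>V\<close> of \<open>W\<close>, hence on
    the cover, and \<open>e\<close> cancels. So \<open>u\<close> itself lands in the
    \<open>W\<close>-part \<open>V'\<close> of \<open>Y\<close>, where a morphism from
    \<open>C\<close> must be zero.\<close>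
  obtain V' G j \<rho> where V: "V' \<in> W" "G \<in> F" "j \<in> Hom A V' Y" "\<rho> \<in> Hom A Y G" "is_kernel A \<rho> j"
    using torsion_seq[OF WF O(2)] by metis
  have GO: "G \<in> Obj A" using torsion_Obj[OF WF] V by blast
  have "\<rho> \<cdot> t = zero V G" using torsion_null[OF WF D(2) V(2) comp_Hom[OF t(1) V(4)]] .
  then have "\<rho> \<cdot> (u \<cdot> e) = zero P G"
    using comp_assoc[OF D(4) t(1) V(4)] t(2) comp_zero(2)[OF D(4) GO] by simp
  then have "(\<rho> \<cdot> u) \<cdot> e = zero P G" using comp_assoc[OF P(2) u V(4)] by simp
  then have "\<rho> \<cdot> u = zero T G" using epic_null[OF P(3,2) comp_Hom[OF u V(4)]] by simp
  then obtain w where w: "w \<in> Hom A T V'" "j \<cdot> w = u"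
    using is_kernelD(3)[OF V(5,4,3) u] by blast
  have "w = zero T V'" using torsion_null[OF CW T V(1) w(1)] .
  then show "u = zero T Y" using w(2) comp_zero(1)[OF V(3) O(4)] by simp
qed

text \<open>Only the condition tested from \<open>C\<close> needs the chase; injectivity of
  \<open>Hom(-, x)\<close> passes formally from a composite to its last factor.\<close>

lemma weq_cancel_right:
  assumes "f \<in> Hom A X Y" "g \<in> Hom A Y Z" "weq f" "weq (g \<cdot> f)"
  shows "weq g"
  using null_monic_left[OF assms] null_epic_left[OF assms(1,2)] assms(4) unfolding weq_def by blast

lemma weq_cancel_left:
  assumes "f \<in> Hom A X Y" "g \<in> Hom A Y Z" "weq g" "weq (g \<cdot> f)"
  shows "weq f"
  using ttf.weq_cancel_right[OF ttf_opc, of g Z Y f X] assms by (simp add: weq_opc)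

lemma two_out_of_three_weq: "two_out_of_three A (Ker_in A W \<inter> Coker_in A W)"
  unfolding two_out_of_three_def Weq_iff
proof (intro ballI impI)
  fix f g assume fg: "f \<in> Mor A" "g \<in> Mor A" "Cod A f = Dom A g"
  have f: "f \<in> Hom A (Dom A f) (Cod A f)" and g: "g \<in> Hom A (Cod A f) (Cod A g)"
    using fg by (simp_all add: Hom_def)
  show "(weq f \<and> weq g \<longrightarrow> weq (g \<cdot> f)) \<and> (weq f \<and> weq (g \<cdot> f) \<longrightarrow> weq g) \<and>
    (weq g \<and> weq (g \<cdot> f) \<longrightarrow> weq f)"
    using weq_comp[OF f g] weq_cancel_right[OF f g] weq_cancel_left[OF f g] by blast
qed

text \<open>The cokernel projection is itself a test morphism into \<open>W\<close> that kills with
  \<open>i\<close>, so a cofibration forces it to vanish.\<close>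

lemma TCoFib_epic:
  assumes i: "i \<in> Coker_in A C" "i \<in> Coker_in A W"
  shows "epic A i"
proof -
  define X Y where "X = Dom A i" "Y = Cod A i"
  then have iH: "i \<in> Hom A X Y" using i unfolding Coker_in_def Hom_def by simp
  obtain q where q: "is_cokernel A i q" "Cod A q \<in> W" using i(2) unfolding Coker_in_def by blast
  then obtain Q where qH: "q \<in> Hom A Y Q" "Q \<in> W"
    using is_cokernelD(1)[OF q(1) iH] by (auto simp: Hom_def)
  have q0: "q = zero Y Q"
    using null_epicD[OF _ iH qH(2,1)] is_cokernelD(2)[OF q(1) iH qH(1)] i(1) CoFib_iff by blast
  show ?thesis
  proof (rule epicI_null[OF iH])
    fix T u assume u: "u \<in> Hom A Y T" "u \<cdot> i = zero X T"
    then obtain v where v: "v \<in> Hom A Q T" "v \<cdot> q = u"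
      using is_cokernelD(3)[OF q(1) iH qH(1)] by blast
    then show "u = zero Y T" using q0 comp_zero(1)[OF v(1)] Hom_Obj[OF u(1)] by simp
  qed
qed

text \<open>On the kernel of \<open>i\<close>, which lies in \<open>W\<close>, the morphism
  \<open>a\<close> is killed by the fibration \<open>p\<close> and therefore vanishes. Hence
  \<open>a\<close> descends along \<open>i\<close>, the cokernel of its kernel; the second triangle
  and uniqueness follow because \<open>i\<close> is epic.\<close>

lemma lifting_TCoFib_Fib:
  assumes sq: "comm_square A i p a b"
    and i: "i \<in> Coker_in A C \<inter> (Ker_in A W \<inter> Coker_in A W)" and p: "p \<in> Ker_in A F"
  shows "\<exists>s. is_lifting A i p a b s"
    "\<lbrakk>is_lifting A i p a b s; is_lifting A i p a b s'\<rbrakk> \<Longrightarrow> s = s'"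
proof -
  define X Y D E where d: "X = Dom A i" "Y = Cod A i" "D = Dom A p" "E = Cod A p"
  have H: "i \<in> Hom A X Y" "p \<in> Hom A D E" "a \<in> Hom A X D" "b \<in> Hom A Y E" and e: "p \<cdot> a = b \<cdot> i"
    using sq unfolding comm_square_def d by (auto simp: Mor_Hom)
  have ei: "epic A i" using TCoFib_epic i by blast
  obtain k where k: "is_kernel A i k" "Dom A k \<in> W" using i unfolding Ker_in_def by blast
  then obtain K where K: "k \<in> Hom A K X" "K \<in> W"
    using is_kernelD(1)[OF k(1) H(1)] by (auto simp: Hom_def)
  have KO: "K \<in> Obj A" "E \<in> Obj A" using Hom_Obj[OF K(1)] Hom_Obj[OF H(2)] by auto
  have "p \<cdot> (a \<cdot> k) = b \<cdot> (i \<cdot> k)"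
    using comp_assoc[OF K(1) H(3,2)] e comp_assoc[OF K(1) H(1,4)] by simp
  also have "\<dots> = zero K E" using is_kernelD(2)[OF k(1) H(1) K(1)] comp_zero(1)[OF H(4) KO(1)] by simp
  finally have "a \<cdot> k = zero K D"
    using null_monicD[OF _ H(2) K(2) comp_Hom[OF K(1) H(3)]] p Fib_iff by blast
  then obtain l where l: "l \<in> Hom A Y D" "l \<cdot> i = a"
    using is_cokernelD(3)[OF epic_cokernel_of_kernel[OF ei k(1)] K(1) H(1,3)] by blast
  have "(p \<cdot> l) \<cdot> i = b \<cdot> i" using comp_assoc[OF H(1) l(1) H(2)] l(2) e by simp
  then have "p \<cdot> l = b" using epicD[OF ei H(1) comp_Hom[OF l(1) H(2)] H(4)] by simp
  then show "\<exists>s. is_lifting A i p a b s" using l unfolding is_lifting_def d by blast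
  show "s = s'" if "is_lifting A i p a b s" "is_lifting A i p a b s'"
    using that epicD[OF ei H(1), of s D s'] unfolding is_lifting_def d by simp
qed

lemma lifting_CoFib_TFib:
  assumes "comm_square A i p a b"
    and "i \<in> Coker_in A C" and "p \<in> Ker_in A F \<inter> (Ker_in A W \<inter> Coker_in A W)"
  shows "\<exists>s. is_lifting A i p a b s"
    "\<lbrakk>is_lifting A i p a b s; is_lifting A i p a b s'\<rbrakk> \<Longrightarrow> s = s'"
  using ttf.lifting_TCoFib_Fib(1)[OF ttf_opc, of p i b a]
    ttf.lifting_TCoFib_Fib(2)[OF ttf_opc, of p i b a s s'] assms by simp_all

lemma factors_TCoFib_Fib:
  assumes "f \<in> Mor A"
  shows "factors_through A (Coker_in A C \<inter> (Ker_in A W \<inter> Coker_in A W)) (Ker_in A F) f"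
proof -
  define X Y where d: "X = Dom A f" "Y = Cod A f"
  have f: "f \<in> Hom A X Y" using assms d by (simp add: Hom_def)
  have O: "X \<in> Obj A" "Y \<in> Obj A" using Hom_Obj[OF f] .
  obtain K k where k: "K \<in> Obj A" "k \<in> Hom A K X" "is_kernel A f k" using obtain_kernel[OF f] .
  obtain T G i p where s: "T \<in> W" "G \<in> F" "i \<in> Hom A T K" "p \<in> Hom A K G" "is_kernel A p i"
    "is_cokernel A i p" using torsion_seq[OF WF k(1)] .
  have TO: "T \<in> Obj A" using Hom_Obj[OF s(3)] by simp
  have km: "monic A k" using is_kernelD(4)[OF k(3) f] .
  have im: "monic A i" using is_kernelD(4)[OF s(5,4)] .
  define t where "t = k \<cdot> i"
  have t: "t \<in> Hom A T X" using t_def comp_Hom[OF s(3) k(2)] by simp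
  have tm: "monic A t"
  proof (rule monicI_null[OF t])
    fix S u assume u: "u \<in> Hom A S T" "t \<cdot> u = zero S X"
    have "k \<cdot> (i \<cdot> u) = zero S X" using comp_assoc[OF u(1) s(3) k(2)] u(2) t_def by simp
    then have "i \<cdot> u = zero S K" using monic_null[OF km k(2) comp_Hom[OF u(1) s(3)]] by simp
    then show "u = zero S T" using monic_null[OF im s(3) u(1)] by simp
  qed
  obtain Q c where c: "Q \<in> Obj A" "c \<in> Hom A X Q" "is_cokernel A t c" using obtain_cokernel[OF t] .
  have ct: "is_kernel A c t" using monic_kernel_of_cokernel[OF tm c(3)] .
  have ce: "epic A c" using is_cokernelD(4)[OF c(3) t] .
  have "f \<cdot> t = zero T Y"
    using comp_assoc[OF s(3) k(2) f] is_kernelD(2)[OF k(3) f k(2)] comp_zero(2)[OF s(3) O(2)] t_def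
    by simp
  then obtain g where g: "g \<in> Hom A Q Y" "g \<cdot> c = f" using is_cokernelD(3)[OF c(3) t c(2) f] by blast
  have "c \<in> Ker_in A W"
    unfolding Ker_in_def using ct s(1) t c(2) by (auto simp: Hom_def)
  moreover have "c \<in> Coker_in A C" "c \<in> Coker_in A W"
    using CoFib_iff epic_null_epic[OF ce] Coker_in_iff[OF WF] by auto
  \<comment> \<open>A test morphism \<open>u\<close> from \<open>W\<close> killed by
    \<open>g\<close> lifts along \<open>c\<close> to \<open>v\<close> on a cover \<open>P\<close>,
    and \<open>f\<close> kills \<open>v\<close>, so \<open>v\<close> lands in the kernel
    \<open>K\<close>. Once \<open>P\<close> is known to lie in \<open>W\<close>, \<open>v\<close>
    even lands in the \<open>W\<close>-part \<open>T\<close>, which \<open>c\<close> kills; thus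
    \<open>u \<cdot> e\<close> and then \<open>u\<close> vanish.\<close>
  moreover have "null_monic A zero W g"
  proof (rule null_monicI[OF g(1)])
    fix V u assume V: "V \<in> W" and u: "u \<in> Hom A V Q" "g \<cdot> u = zero V Y"
    obtain P e v where P: "P \<in> Obj A" "e \<in> Hom A P V" "epic A e" "v \<in> Hom A P X" "c \<cdot> v = u \<cdot> e"
      and inj: "\<forall>S. \<forall>x\<in>Hom A S P. \<forall>y\<in>Hom A S P. e \<cdot> x = e \<cdot> y \<and> v \<cdot> x = v \<cdot> y \<longrightarrow> x = y"
      using epic_pullback[OF c(2) ce u(1)] .
    \<comment> \<open>The cover is an extension of an object of \<open>W\<close> by
      \<open>T\<close>. Membership in \<open>W\<close> is tested from \<open>C\<close>:
      \<open>e \<cdot> x\<close> ends in \<open>W\<close>, and \<open>v \<cdot> x\<close> then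
      factors through \<open>T\<close> in \<open>W\<close>, so both components of \<open>x\<close>
      are zero.\<close>
    have "x = zero S P" if S: "S \<in> C" and x: "x \<in> Hom A S P" for S x
    proof -
      have SO: "S \<in> Obj A" using Hom_Obj[OF x] by simp
      have ex: "e \<cdot> x = zero S V" using torsion_null[OF CW S V comp_Hom[OF x P(2)]] .
      have "c \<cdot> (v \<cdot> x) = u \<cdot> (e \<cdot> x)"
        using comp_assoc[OF x P(4) c(2)] P(5) comp_assoc[OF x P(2) u(1)] by simp
      then have "c \<cdot> (v \<cdot> x) = zero S Q" using ex comp_zero(1)[OF u(1) SO] by simp
      then obtain b where b: "b \<in> Hom A S T" "t \<cdot> b = v \<cdot> x"
        using is_kernelD(3)[OF ct c(2) t comp_Hom[OF x P(4)]] by blast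
      have "b = zero S T" using torsion_null[OF CW S s(1) b(1)] .
      then have "v \<cdot> x = zero S X" using b(2) comp_zero(1)[OF t SO] by simp
      then show ?thesis
        using inj x zero_Hom[OF SO P(1)] ex comp_zero(1)[OF P(2) SO] comp_zero(1)[OF P(4) SO] by metis
    qed
    then have PW: "P \<in> W" using in_torsion_free_iff[OF CW] P(1) by blast
    have "f \<cdot> v = g \<cdot> (u \<cdot> e)" using comp_assoc[OF P(4) c(2) g(1)] g(2) P(5) by simp
    also have "\<dots> = zero P Y" using comp_assoc[OF P(2) u(1) g(1)] u(2) comp_zero(2)[OF P(2) O(2)] by simp
    finally obtain v' where v': "v' \<in> Hom A P K" "k \<cdot> v' = v"
      using is_kernelD(3)[OF k(3) f k(2) P(4)] by blast
    have "p \<cdot> v' = zero P G" using torsion_null[OF WF PW s(2) comp_Hom[OF v'(1) s(4)]] .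
    then obtain b where b: "b \<in> Hom A P T" "i \<cdot> b = v'"
      using is_kernelD(3)[OF s(5,4,3) v'(1)] by blast
    have "v = t \<cdot> b" using comp_assoc[OF b(1) s(3) k(2)] b(2) v'(2) t_def by simp
    then have "c \<cdot> v = zero P Q"
      using comp_assoc[OF b(1) t c(2)] is_cokernelD(2)[OF c(3) t c(2)] comp_zero(2)[OF b(1) c(1)] by simp
    then have "u \<cdot> e = zero P Q" using P(5) by simp
    then show "u = zero V Q" using epic_null[OF P(3,2) u(1)] by simp
  qed
  then have "g \<in> Ker_in A F" using Fib_iff by blast
  moreover have "Cod A c = Dom A g" using c(2) g(1) by (simp add: Hom_def)
  ultimately show ?thesis unfolding factors_through_def using g(2) by blast
qed

lemma factors_CoFib_TFib:
  "f \<in> Mor A \<Longrightarrow> factors_through A (Coker_in A C) (Ker_in A F \<inter> (Ker_in A W \<inter> Coker_in A W)) f"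
  using ttf.factors_TCoFib_Fib[OF ttf_opc, of f] by (simp add: Int_commute)

theorem orthogonal_model_structure_TTF:
  "orthogonal_model_structure A (Coker_in A C) (Ker_in A F) (Ker_in A W \<inter> Coker_in A W)"
proof -
  have "Ker_in A W \<inter> Coker_in A W = {f. null_monic A zero C f} \<inter> {f. null_epic A zero F f}"
    using Weq_iff weq_def by blast
  moreover have "retract_closed A ({f. null_monic A zero C f} \<inter> {f. null_epic A zero F f})"
    using retract_closed_null_monic[of C] retract_closed_null_epic[of F]
    unfolding retract_closed_def by blast
  moreover have "Coker_in A C = {f. null_epic A zero W f}" "Ker_in A F = {f. null_monic A zero W f}"
    using CoFib_iff Fib_iff by blast+
  ultimately have *: "retract_closed A (Coker_in A C)" "retract_closed A (Ker_in A F)"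
    "retract_closed A (Ker_in A W \<inter> Coker_in A W)"
    using retract_closed_null_epic[of W] retract_closed_null_monic[of W] by auto
  have m: "Coker_in A C \<subseteq> Mor A" "Ker_in A F \<subseteq> Mor A" "Ker_in A W \<inter> Coker_in A W \<subseteq> Mor A"
    by (auto simp: Ker_in_def Coker_in_def)
  show ?thesis
    using m two_out_of_three_weq * lifting_TCoFib_Fib lifting_CoFib_TFib factors_TCoFib_Fib
      factors_CoFib_TFib
    by unfold_locales metis+
qed

text \<open>Every composite with a morphism out of a zero object is zero, so the cofibration
  condition on \<open>0 -> X\<close> says that all morphisms from \<open>X\<close> to
  \<open>W\<close> vanish, which characterizes \<open>C\<close>.\<close>

lemma cofibrant_objects_TTF: "cofibrant_objects A (Coker_in A C) = C"
proof -
  have "null_epic A zero W f \<longleftrightarrow> X \<in> C" if f: "f \<in> Hom A Z X" and Z: "zero_object A Z" for f X Z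
  proof -
    have "u \<cdot> f = zero Z T" if "u \<in> Hom A X T" for u T
      using zero_object_Hom(1)[OF Z comp_Hom[OF f that]] .
    then show ?thesis
      using null_epicI[OF f, of W] null_epicD[OF _ f] in_torsion_iff[OF CW, of X] Hom_Obj[OF f] by metis
  qed
  moreover have "\<exists>Z f. zero_object A Z \<and> f \<in> Hom A Z X" if "X \<in> Obj A" for X
    using that ex_zero_object zero_Hom zero_object_Obj by blast
  ultimately show ?thesis
    unfolding cofibrant_objects_def CoFib_iff using torsion_Obj[OF CW] by blast
qed

lemma fibrant_objects_TTF: "fibrant_objects A (Ker_in A F) = F"
  using ttf.cofibrant_objects_TTF[OF ttf_opc] by simp

lemma trivial_objects_TTF: "trivial_objects A (Ker_in A W \<inter> Coker_in A W) = W"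
proof -
  have "weq f \<longleftrightarrow> X \<in> W" if f: "f \<in> Hom A Z X" and Z: "zero_object A Z" for f X Z
  proof -
    have "u \<cdot> f = zero Z T" if "u \<in> Hom A X T" for u T
      using zero_object_Hom(1)[OF Z comp_Hom[OF f that]] .
    then have "null_epic A zero F f \<longleftrightarrow> X \<in> W"
      using null_epicI[OF f, of F] null_epicD[OF _ f] in_torsion_iff[OF WF, of X] Hom_Obj[OF f] by metis
    moreover have "null_monic A zero C f"
      using null_monicI[OF f] zero_object_Hom(2)[OF Z] by blast
    ultimately show ?thesis unfolding weq_def by blast
  qed
  moreover have "\<exists>Z f. zero_object A Z \<and> f \<in> Hom A Z X" if "X \<in> Obj A" for X
    using that ex_zero_object zero_Hom zero_object_Obj by blast
  ultimately show ?thesis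
    unfolding trivial_objects_def Weq_iff using torsion_Obj[OF CW] by blast
qed

end

section \<open>The TTF triple of a TTF model structure\<close>

context category
begin

text \<open>Turns a lifting property back into membership in a class: the lift \<open>s\<close>
  embeds \<open>Y\<close> into the middle object \<open>Z\<close>, so \<open>f\<close> is a retract
  of its left factor \<open>j\<close>, with identities on the common domain.\<close>

lemma retract_argument:
  assumes "j \<in> Hom A X Z" "q \<in> Hom A Z Y" "f \<in> Hom A X Y" "f = q \<cdot> j" "is_lifting A f q j (Id A Y) s"
  shows "retract_of A f j"
proof -
  have O: "X \<in> Obj A" "Y \<in> Obj A" using Hom_Obj[OF assms(3)] .
  have d: "Dom A f = X" "Cod A f = Y" "Dom A j = X" "Cod A j = Z" "Dom A q = Z" "Cod A q = Y"
    using assms by (auto simp: Hom_def)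
  have s: "s \<in> Hom A Y Z" "s \<cdot> f = j" "q \<cdot> s = Id A Y"
    using assms(5) d unfolding is_lifting_def by auto
  show ?thesis
    unfolding retract_of_def d
  proof (intro conjI bexI)
    show "f \<in> Mor A" "j \<in> Mor A" using assms Hom_Mor by blast+
    show "Id A X \<in> Hom A X X" using Id_Hom[OF O(1)] .
    show "Id A X \<in> Hom A X X" using Id_Hom[OF O(1)] .
    show "j \<cdot> Id A X = s \<cdot> f" using comp_Id(1)[OF assms(1)] s by simp
    show "f \<cdot> Id A X = q \<cdot> j" using comp_Id(1)[OF assms(3)] assms(4) by simp
    show "Id A X \<cdot> Id A X = Id A X" using comp_Id[OF Id_Hom[OF O(1)]] by simp
  qed (use s assms in auto)
qed

lemma factors_throughE:
  assumes "factors_through A L R f" "f \<in> Hom A X Y" "L \<subseteq> Mor A" "R \<subseteq> Mor A"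
  obtains Z i p where "i \<in> L" "p \<in> R" "i \<in> Hom A X Z" "p \<in> Hom A Z Y" "f = p \<cdot> i"
proof -
  obtain i p where *: "i \<in> L" "p \<in> R" "Cod A i = Dom A p" "f = p \<cdot> i"
    using assms(1) unfolding factors_through_def by blast
  then have "i \<in> Mor A" "p \<in> Mor A" using assms by auto
  then have "i \<in> Hom A X (Cod A i)" "p \<in> Hom A (Cod A i) Y"
    using assms(2) * unfolding Hom_def by auto
  then show ?thesis using that * by blast
qed

lemma comm_squareI:
  "\<lbrakk>i \<in> Hom A X Y; p \<in> Hom A D E; a \<in> Hom A X D; b \<in> Hom A Y E; p \<cdot> a = b \<cdot> i\<rbrakk>
    \<Longrightarrow> comm_square A i p a b"
  unfolding comm_square_def by (auto simp: Hom_def)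

lemma is_liftingD:
  assumes "is_lifting A i p a b s" "i \<in> Hom A X Y" "p \<in> Hom A D E"
  shows "s \<in> Hom A Y D" "s \<cdot> i = a" "p \<cdot> s = b"
  using assms unfolding is_lifting_def by (auto simp: Hom_def)

lemma model_structure_opc:
  assumes "model_structure A CoFib Fib Weq"
  shows "model_structure (opc A) Fib CoFib Weq"
proof -
  interpret M: model_structure A CoFib Fib Weq by fact
  show ?thesis
    by (intro model_structure.intro)
      (auto simp: M.classes M.CM1 M.CM2 M.CM4 intro: M.CM3)
qed

lemma orthogonal_model_structure_opc:
  assumes "orthogonal_model_structure A CoFib Fib Weq"
  shows "orthogonal_model_structure (opc A) Fib CoFib Weq"
proof -
  interpret M: orthogonal_model_structure A CoFib Fib Weq by fact
  show ?thesis
    by (intro orthogonal_model_structure.intro orthogonal_model_structure_axioms.intro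
        model_structure_opc M.model_structure_axioms)
      (simp, blast intro: M.lifting_unique)
qed

text \<open>Factor \<open>i\<close> by the second structure. As a trivial cofibration of the first,
  \<open>i\<close> lifts against the right factor, a fibration of both, and so is a retract of the
  left one.\<close>

lemma TCoFib_determined:
  assumes "model_structure A CoFib Fib Weq" "model_structure A CoFib Fib Weq'"
  shows "CoFib \<inter> Weq \<subseteq> Weq'"
proof
  interpret M: model_structure A CoFib Fib Weq by fact
  interpret M': model_structure A CoFib Fib Weq' by fact
  fix i assume i: "i \<in> CoFib \<inter> Weq"
  define X Y where "X = Dom A i" "Y = Cod A i"
  then have iH: "i \<in> Hom A X Y" using i M.classes Mor_Hom by auto
  obtain Z j q where j: "j \<in> CoFib \<inter> Weq'" "q \<in> Fib" "j \<in> Hom A X Z" "q \<in> Hom A Z Y" "i = q \<cdot> j"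
    using factors_throughE[OF M'.CM4(1)[OF Hom_Mor[OF iH]] iH] M.classes M'.classes by blast
  have "comm_square A i q j (Id A Y)"
    using comm_squareI[OF iH j(4,3) Id_Hom] Hom_Obj[OF iH] comp_Id[OF iH] j(5) by simp
  then obtain s where "is_lifting A i q j (Id A Y) s" using M.CM3 i j(2) by blast
  then have "retract_of A i j" using retract_argument[OF j(3,4) iH j(5)] by blast
  then show "i \<in> Weq'" using M'.CM2(3) j(1) unfolding retract_closed_def by blast
qed

text \<open>By two-out-of-three, a weak equivalence is a trivial cofibration followed by a trivial
  fibration, and both kinds are determined by \<open>CoFib\<close> and \<open>Fib\<close>.\<close>

lemma Weq_determined:
  assumes "model_structure A CoFib Fib Weq" "model_structure A CoFib Fib Weq'"
  shows "Weq \<subseteq> Weq'"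
proof
  interpret M: model_structure A CoFib Fib Weq by fact
  interpret M': model_structure A CoFib Fib Weq' by fact
  fix f assume f: "f \<in> Weq"
  then have fM: "f \<in> Mor A" using M.classes by blast
  obtain Z i p where *: "i \<in> CoFib \<inter> Weq" "p \<in> Fib" "i \<in> Hom A (Dom A f) Z" "p \<in> Hom A Z (Cod A f)"
    "f = p \<cdot> i"
    using factors_throughE[OF M.CM4(1)[OF fM] Mor_Hom[OF fM]] M.classes by blast
  have c: "i \<in> Mor A" "p \<in> Mor A" "Cod A i = Dom A p" using * by (auto simp: Hom_def)
  then have "p \<in> Fib \<inter> Weq" using M.CM1 f * unfolding two_out_of_three_def by blast
  moreover have "Fib \<inter> Weq \<subseteq> Weq'"
    using category.TCoFib_determined[OF category_opc model_structure_opc model_structure_opc] assms by blast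
  ultimately have "i \<in> Weq'" "p \<in> Weq'" using TCoFib_determined[OF assms] * by auto
  then show "f \<in> Weq'" using M'.CM1 c * unfolding two_out_of_three_def by blast
qed

end

section \<open>Objects of a TTF model structure\<close>

locale ttf_model = abelian + orthogonal_model_structure A CoFib Fib Weq for CoFib Fib Weq +
  assumes CoFib_eq: "CoFib = Coker_in A (cofibrant_objects A CoFib)"
    and Fib_eq: "Fib = Ker_in A (fibrant_objects A Fib)"
begin

abbreviation "cof \<equiv> cofibrant_objects A CoFib"
abbreviation "triv \<equiv> trivial_objects A Weq"
abbreviation "fibr \<equiv> fibrant_objects A Fib"

lemma ttf_model_opc: "ttf_model (opc A) add (\<lambda>X Y. zero Y X) Fib CoFib Weq"
proof (intro ttf_model.intro ttf_model_axioms.intro abelian_opc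
    orthogonal_model_structure_opc[OF orthogonal_model_structure_axioms])
  show "Fib = Coker_in (opc A) (cofibrant_objects (opc A) Fib)"
    unfolding Coker_in_opc cofibrant_objects_opc by (rule Fib_eq)
  show "CoFib = Ker_in (opc A) (fibrant_objects (opc A) CoFib)"
    unfolding Ker_in_opc fibrant_objects_opc by (rule CoFib_eq)
qed

text \<open>\<open>CoFib\<close> occurs on both sides of \<open>CoFib_eq\<close>, so rewriting with
  it would not stop; this pointwise form can be used safely.\<close>

lemma CoFib_Coker_in: "f \<in> CoFib \<longleftrightarrow> f \<in> Coker_in A cof"
  by (rule arg_cong[OF CoFib_eq, of "\<lambda>S. f \<in> S"])

lemma Weq_comp:
  "\<lbrakk>f \<in> Hom A X Y; g \<in> Hom A Y Z; f \<in> Weq; g \<in> Weq\<rbrakk> \<Longrightarrow> g \<cdot> f \<in> Weq"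
  "\<lbrakk>f \<in> Hom A X Y; g \<in> Hom A Y Z; f \<in> Weq; g \<cdot> f \<in> Weq\<rbrakk> \<Longrightarrow> g \<in> Weq"
  "\<lbrakk>f \<in> Hom A X Y; g \<in> Hom A Y Z; g \<in> Weq; g \<cdot> f \<in> Weq\<rbrakk> \<Longrightarrow> f \<in> Weq"
  using CM1 unfolding two_out_of_three_def by (auto simp: Hom_def)

lemma factor_TCoFib_Fib:
  assumes f: "f \<in> Hom A X Y"
  obtains Z i p where "i \<in> CoFib \<inter> Weq" "p \<in> Fib" "i \<in> Hom A X Z" "p \<in> Hom A Z Y" "f = p \<cdot> i"
proof -
  have "CoFib \<inter> Weq \<subseteq> Mor A" using classes by blast
  from factors_throughE[OF CM4(1)[OF Hom_Mor[OF f]] f this classes(2)] that show ?thesis .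
qed

lemma factor_CoFib_TFib:
  assumes f: "f \<in> Hom A X Y"
  obtains Z i p where "i \<in> CoFib" "p \<in> Fib \<inter> Weq" "i \<in> Hom A X Z" "p \<in> Hom A Z Y" "f = p \<cdot> i"
proof -
  have "Fib \<inter> Weq \<subseteq> Mor A" using classes by blast
  from factors_throughE[OF CM4(2)[OF Hom_Mor[OF f]] f classes(1) this] that show ?thesis .
qed

text \<open>Identities are not mentioned in the axioms. In a factorization of \<open>Id A X\<close>
  the left factor is its own lift, which makes the identity a retract of it.\<close>

lemma Id_in_classes:
  assumes X: "X \<in> Obj A"
  shows "Id A X \<in> CoFib" "Id A X \<in> Weq"
proof -
  have I: "Id A X \<in> Hom A X X" using Id_Hom[OF X] .
  obtain Z i p where *: "i \<in> CoFib \<inter> Weq" "p \<in> Fib" "i \<in> Hom A X Z" "p \<in> Hom A Z X" "Id A X = p \<cdot> i"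
    using factor_TCoFib_Fib[OF I] .
  have "is_lifting A (Id A X) p i (Id A X) i"
    using * X comp_Id[OF *(3)] unfolding is_lifting_def by (auto simp: Hom_def)
  then have "retract_of A (Id A X) i" using retract_argument[OF *(3,4) I *(5)] by blast
  then show "Id A X \<in> CoFib" "Id A X \<in> Weq" using CM2 *(1) unfolding retract_closed_def by blast+
qed

text \<open>The inverse is a lift that presents \<open>f\<close> as a retract of an
  identity.\<close>

lemma iso_Weq:
  assumes "f \<in> Hom A X Y" "iso_mor A f"
  shows "f \<in> Weq"
proof -
  have O: "X \<in> Obj A" "Y \<in> Obj A" using Hom_Obj[OF assms(1)] .
  obtain g where g: "g \<in> Hom A Y X" "g \<cdot> f = Id A X" "f \<cdot> g = Id A Y"
    using iso_mor_inverse[OF assms] by blast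
  have "is_lifting A f f (Id A X) (Id A Y) g"
    using g assms(1) unfolding is_lifting_def by (auto simp: Hom_def)
  then have "retract_of A f (Id A X)"
    using retract_argument[OF Id_Hom[OF O(1)] assms(1) assms(1)] comp_Id[OF assms(1)] by simp
  then show ?thesis using CM2(3) Id_in_classes(2)[OF O(1)] unfolding retract_closed_def by blast
qed

lemma zero_object_iso:
  assumes "zero_object A Z" "zero_object A Z'"
  shows "iso_mor A (zero Z Z')"
proof -
  have O: "Z \<in> Obj A" "Z' \<in> Obj A" using assms zero_object_Obj by auto
  then have "zero Z' Z \<cdot> zero Z Z' = Id A Z" "zero Z Z' \<cdot> zero Z' Z = Id A Z'"
    using zero_object_iff assms comp_zero(1)[OF zero_Hom] by metis+
  then show ?thesis using iso_mor_iff[OF zero_Hom] zero_Hom O by blast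
qed

text \<open>Zero objects differ by isomorphisms, which are weak equivalences, so one fixed zero
  object suffices to test triviality.\<close>

lemma trivial_iff:
  assumes Z: "zero_object A Z"
  shows "X \<in> triv \<longleftrightarrow> X \<in> Obj A \<and> zero Z X \<in> Weq"
proof
  assume "X \<in> triv"
  then obtain Z' f where *: "X \<in> Obj A" "zero_object A Z'" "f \<in> Hom A Z' X" "f \<in> Weq"
    unfolding trivial_objects_def by blast
  have z: "zero Z Z' \<in> Hom A Z Z'" using zero_Hom zero_object_Obj Z * by blast
  have "zero Z X = f \<cdot> zero Z Z'" using comp_zero(1)[OF *(3)] zero_object_Obj[OF Z] by simp
  then show "X \<in> Obj A \<and> zero Z X \<in> Weq"
    using * Weq_comp(1)[OF z *(3)] iso_Weq[OF z zero_object_iso[OF Z *(2)]] by simp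
next
  assume "X \<in> Obj A \<and> zero Z X \<in> Weq"
  then show "X \<in> triv" unfolding trivial_objects_def using Z zero_Hom zero_object_Obj by blast
qed

text \<open>The composite \<open>0 -> X -> 0\<close> is an identity, so two-out-of-three applies.
  This makes triviality a self-dual notion.\<close>

lemma zero_Weq_iff:
  assumes Z: "zero_object A Z" and X: "X \<in> Obj A"
  shows "zero Z X \<in> Weq \<longleftrightarrow> zero X Z \<in> Weq"
proof -
  have ZO: "Z \<in> Obj A" using zero_object_Obj[OF Z] .
  have "zero X Z \<cdot> zero Z X = Id A Z"
    using comp_zero(1)[OF zero_Hom[OF X ZO] ZO] Z zero_object_iff by simp
  then have "zero X Z \<cdot> zero Z X \<in> Weq" using Id_in_classes ZO by simp
  then show ?thesis
    using Weq_comp(2,3)[OF zero_Hom[OF ZO X] zero_Hom[OF X ZO]] by blast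
qed

lemma trivial_objects_opc: "trivial_objects (opc A) Weq = triv"
proof -
  obtain Z where Z: "zero_object A Z" using ex_zero_object by blast
  interpret D: ttf_model "opc A" add "\<lambda>X Y. zero Y X" Fib CoFib Weq by (rule ttf_model_opc)
  show ?thesis
    using D.trivial_iff[of Z] trivial_iff[OF Z] zero_Weq_iff[OF Z] Z by auto
qed

text \<open>With this choice of cokernel, the condition defining \<open>CoFib\<close> for
  \<open>0 -> X\<close> can be read off from any object isomorphic to \<open>X\<close>. It yields
  independence of the zero object and closure of \<open>cof\<close> under isomorphism.\<close>

lemma iso_cokernel_zero:
  assumes f: "f \<in> Hom A X Y" "iso_mor A f" and Z: "Z \<in> Obj A"
  shows "is_cokernel A (zero Z X) f"
proof (rule is_cokernelI[OF zero_Hom f(1)])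
  show "epic A f" using iso_mor_epic f by blast
  obtain g where g: "g \<in> Hom A Y X" "g \<cdot> f = Id A X" using iso_mor_inverse[OF f] by blast
  fix T h assume h: "h \<in> Hom A X T"
  then have "(h \<cdot> g) \<cdot> f = h" using comp_assoc[OF f(1) g(1) h] g comp_Id[OF h] by simp
  then show "\<exists>u\<in>Hom A Y T. u \<cdot> f = h" using comp_Hom[OF g(1) h] by blast
qed (use Z Hom_Obj[OF f(1)] comp_zero(1)[OF f(1)] in auto)

lemma cofibrant_iff:
  assumes Z: "zero_object A Z"
  shows "X \<in> cof \<longleftrightarrow> X \<in> Obj A \<and> zero Z X \<in> CoFib"
proof
  assume X: "X \<in> cof"
  then have XO: "X \<in> Obj A" unfolding cofibrant_objects_def by simp
  have "is_cokernel A (zero Z X) (Id A X)"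
    using iso_cokernel_zero[OF Id_Hom[OF XO] iso_mor_Id[OF XO]] zero_object_Obj[OF Z] .
  then have "zero Z X \<in> Coker_in A cof"
    unfolding Coker_in_def using X XO Hom_Mor[OF zero_Hom[OF zero_object_Obj[OF Z] XO]] by auto
  then show "X \<in> Obj A \<and> zero Z X \<in> CoFib" using XO CoFib_Coker_in by blast
next
  assume "X \<in> Obj A \<and> zero Z X \<in> CoFib"
  then show "X \<in> cof" unfolding cofibrant_objects_def using Z zero_Hom zero_object_Obj by blast
qed

lemma zero_object_cofibrant: "zero_object A Z \<Longrightarrow> Z \<in> cof"
  using cofibrant_iff[of Z Z] Id_in_classes(1)[of Z] zero_object_iff by metis

text \<open>The cokernel of an epimorphism is a zero object, and zero objects are cofibrant because
  identities are cofibrations.\<close>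

lemma epic_CoFib:
  assumes "epic A f"
  shows "f \<in> CoFib"
proof -
  obtain X Y where f: "f \<in> Hom A X Y" using assms Mor_Hom unfolding epic_def by blast
  have O: "X \<in> Obj A" "Y \<in> Obj A" using Hom_Obj[OF f] .
  obtain Z where Z: "zero_object A Z" using ex_zero_object by blast
  have ZO: "Z \<in> Obj A" using zero_object_Obj[OF Z] .
  have q: "zero Y Z \<in> Hom A Y Z" using zero_Hom O ZO by blast
  have "is_cokernel A f (zero Y Z)"
  proof (rule is_cokernelI[OF f q])
    show "zero Y Z \<cdot> f = zero X Z" using comp_zero(2)[OF f ZO] .
    show "epic A (zero Y Z)"
      by (rule epicI_null[OF q]) (use zero_object_Hom(1)[OF Z] in blast)
    fix T g assume g: "g \<in> Hom A Y T" "g \<cdot> f = zero X T"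
    then have "g = zero Y T" using epic_null[OF assms f] by blast
    moreover have "T \<in> Obj A" using Hom_Obj[OF g(1)] by simp
    ultimately show "\<exists>u\<in>Hom A Z T. u \<cdot> zero Y Z = g"
      using comp_zero(1)[OF zero_Hom] zero_Hom ZO O by metis
  qed
  then have "f \<in> Coker_in A cof"
    unfolding Coker_in_def using zero_object_cofibrant[OF Z] Hom_Mor[OF f] q by (auto simp: Hom_def)
  then show ?thesis using CoFib_Coker_in by blast
qed

lemma monic_Fib: "monic A f \<Longrightarrow> f \<in> Fib"
  using ttf_model.epic_CoFib[OF ttf_model_opc, of f] by simp

text \<open>If \<open>p\<close> kills \<open>u\<close>, the square from \<open>T -> 0\<close> to
  \<open>p\<close> commutes. Its left side is epic, hence a cofibration, and the lift factors
  \<open>u\<close> through a zero object.\<close>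

lemma TFib_monic:
  assumes p: "p \<in> Fib \<inter> Weq" "p \<in> Hom A Q X"
  shows "monic A p"
proof (rule monicI_null[OF p(2)])
  fix T u assume u: "u \<in> Hom A T Q" "p \<cdot> u = zero T X"
  obtain Z where Z: "zero_object A Z" using ex_zero_object by blast
  have O: "Z \<in> Obj A" "T \<in> Obj A" "Q \<in> Obj A" "X \<in> Obj A"
    using zero_object_Obj[OF Z] Hom_Obj[OF u(1)] Hom_Obj[OF p(2)] by auto
  have i: "zero T Z \<in> Hom A T Z" and b: "zero Z X \<in> Hom A Z X" using zero_Hom O by auto
  have "epic A (zero T Z)"
    by (rule epicI_null[OF i]) (use zero_object_Hom(1)[OF Z] in blast)
  then have iC: "zero T Z \<in> CoFib" using epic_CoFib by blast
  have "p \<cdot> u = zero Z X \<cdot> zero T Z" using u(2) comp_zero(1)[OF b O(2)] by simp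
  then have "comm_square A (zero T Z) p u (zero Z X)" using comm_squareI[OF i p(2) u(1) b] by blast
  then obtain s where s: "is_lifting A (zero T Z) p u (zero Z X) s" using CM3 iC p(1) by blast
  then show "u = zero T Q" using is_liftingD[OF s i p(2)] comp_zero(1)[of s Z Q T] O by simp
qed

text \<open>\<open>0 -> Q\<close> is a trivial cofibration and, being monic, also a fibration;
  lifting it against itself factors the identity of \<open>Q\<close> through a zero object.\<close>

lemma cofibrant_trivial_zero:
  assumes "Q \<in> cof" "Q \<in> triv"
  shows "zero_object A Q"
proof -
  obtain Z where Z: "zero_object A Z" using ex_zero_object by blast
  have O: "Z \<in> Obj A" "Q \<in> Obj A" using zero_object_Obj[OF Z] assms cofibrant_iff[OF Z] by auto
  let ?i = "zero Z Q"
  have i: "?i \<in> Hom A Z Q" using zero_Hom O by blast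
  have iT: "?i \<in> CoFib \<inter> Weq" using assms cofibrant_iff[OF Z] trivial_iff[OF Z] by blast
  have "monic A ?i" by (rule monicI_null[OF i]) (use zero_object_Hom(2)[OF Z] in blast)
  then have iF: "?i \<in> Fib" using monic_Fib by blast
  have "comm_square A ?i ?i (Id A Z) (Id A Q)"
    using comm_squareI[OF i i Id_Hom Id_Hom] O comp_Id[OF i] by simp
  then obtain s where s: "is_lifting A ?i ?i (Id A Z) (Id A Q) s" using CM3 iT iF by blast
  then have "Id A Q = zero Q Q" using is_liftingD[OF s i i] comp_zero(2)[of s Q Z Q] O by simp
  then show ?thesis using zero_objectI O by blast
qed

lemma cofibrant_replacement:
  assumes X: "X \<in> Obj A"
  obtains Q p where "Q \<in> cof" "p \<in> Fib \<inter> Weq" "p \<in> Hom A Q X" "monic A p"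
proof -
  obtain Z where Z: "zero_object A Z" using ex_zero_object by blast
  have z: "zero Z X \<in> Hom A Z X" using zero_Hom X zero_object_Obj[OF Z] by blast
  obtain Q i p where *: "i \<in> CoFib" "p \<in> Fib \<inter> Weq" "i \<in> Hom A Z Q" "p \<in> Hom A Q X" "zero Z X = p \<cdot> i"
    using factor_CoFib_TFib[OF z] .
  have "i = zero Z Q" using zero_object_Hom(1)[OF Z *(3)] .
  then have "Q \<in> cof" using cofibrant_iff[OF Z] * Hom_Obj[OF *(3)] by simp
  then show ?thesis using that * TFib_monic by blast
qed

text \<open>By two-out-of-three the cofibrant replacement of a trivial object is trivial, hence
  zero. So \<open>0 -> X\<close> is a trivial fibration, against which cofibrant objects can be
  lifted.\<close>

lemma trivial_TFib:
  assumes X: "X \<in> triv"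
  obtains Q p where "zero_object A Q" "p \<in> Fib \<inter> Weq" "p \<in> Hom A Q X"
proof -
  obtain Z where Z: "zero_object A Z" using ex_zero_object by blast
  have XO: "X \<in> Obj A" "zero Z X \<in> Weq" using X trivial_iff[OF Z] by auto
  obtain Q p where *: "Q \<in> cof" "p \<in> Fib \<inter> Weq" "p \<in> Hom A Q X" using cofibrant_replacement[OF XO(1)] .
  have O: "Z \<in> Obj A" "Q \<in> Obj A" using zero_object_Obj[OF Z] Hom_Obj[OF *(3)] by auto
  have "p \<cdot> zero Z Q \<in> Weq" using comp_zero(1)[OF *(3) O(1)] XO by simp
  then have "Q \<in> triv" using Weq_comp(3)[OF zero_Hom[OF O] *(3)] * trivial_iff[OF Z] O by blast
  then show ?thesis using that * cofibrant_trivial_zero by blast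
qed

text \<open>Lifting \<open>f\<close> along the trivial fibration \<open>0 -> Y\<close> factors it
  through a zero object.\<close>

lemma cofibrant_trivial_null:
  assumes X: "X \<in> cof" and Y: "Y \<in> triv" and f: "f \<in> Hom A X Y"
  shows "f = zero X Y"
proof -
  obtain Q p where Q: "zero_object A Q" and p: "p \<in> Fib \<inter> Weq" "p \<in> Hom A Q Y"
    using trivial_TFib[OF Y] .
  have O: "Q \<in> Obj A" "X \<in> Obj A" using Hom_Obj[OF p(2)] Hom_Obj[OF f] by auto
  have i: "zero Q X \<in> CoFib" "zero Q X \<in> Hom A Q X" using cofibrant_iff[OF Q] X zero_Hom O by auto
  have "p \<cdot> Id A Q = f \<cdot> zero Q X"
    using zero_object_Hom(1)[OF Q p(2)] comp_Id[OF p(2)] comp_zero(1)[OF f O(1)] by simp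
  then have "comm_square A (zero Q X) p (Id A Q) f"
    using comm_squareI[OF i(2) p(2) Id_Hom f] O by blast
  then obtain s where s: "is_lifting A (zero Q X) p (Id A Q) f s" using CM3 i p by blast
  note s = is_liftingD[OF s i(2) p(2)]
  have "s = zero X Q" using zero_object_Hom(2)[OF Q s(1)] .
  then show ?thesis using s(3) comp_zero(1)[OF p(2) O(2)] by simp
qed

text \<open>Lift \<open>f\<close> and then \<open>g\<close> against the trivial fibration of a
  factorization of \<open>g \<cdot> f\<close>; the retract argument concludes.\<close>

lemma CoFib_comp:
  assumes f: "f \<in> CoFib" "f \<in> Hom A X Y" and g: "g \<in> CoFib" "g \<in> Hom A Y Z"
  shows "g \<cdot> f \<in> CoFib"
proof -
  have gf: "g \<cdot> f \<in> Hom A X Z" using comp_Hom[OF f(2) g(2)] .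
  obtain V j q where j: "j \<in> CoFib" "q \<in> Fib \<inter> Weq" "j \<in> Hom A X V" "q \<in> Hom A V Z" "g \<cdot> f = q \<cdot> j"
    using factor_CoFib_TFib[OF gf] .
  have "comm_square A f q j g" using comm_squareI[OF f(2) j(4) j(3) g(2)] j(5) by simp
  then obtain s where s: "is_lifting A f q j g s" using CM3 f(1) j(2) by blast
  note s' = is_liftingD[OF s f(2) j(4)]
  have "comm_square A g q s (Id A Z)"
    using comm_squareI[OF g(2) j(4) s'(1) Id_Hom] s'(3) comp_Id[OF g(2)] Hom_Obj[OF g(2)] by simp
  then obtain t where t: "is_lifting A g q s (Id A Z) t" using CM3 g(1) j(2) by blast
  note t' = is_liftingD[OF t g(2) j(4)]
  have "is_lifting A (g \<cdot> f) q j (Id A Z) t"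
    using t' s' comp_assoc[OF f(2) g(2) t'(1)] gf j(4) unfolding is_lifting_def by (auto simp: Hom_def)
  then have "retract_of A (g \<cdot> f) j" using retract_argument[OF j(3,4) gf j(5)] by blast
  then show ?thesis using CM2(1) j(1) unfolding retract_closed_def by blast
qed

text \<open>\<open>0 -> P\<close> is the composite of \<open>0 -> Q\<close> and \<open>j\<close>,
  and \<open>j\<close> is a cofibration because its cokernel is cofibrant.\<close>

lemma cofibrant_ext:
  assumes j: "j \<in> Hom A Q P" and e: "is_cokernel A j e" "e \<in> Hom A P R" and QR: "Q \<in> cof" "R \<in> cof"
  shows "P \<in> cof"
proof -
  obtain Z where Z: "zero_object A Z" using ex_zero_object by blast
  have O: "Z \<in> Obj A" "Q \<in> Obj A" "P \<in> Obj A" using zero_object_Obj[OF Z] Hom_Obj[OF j] by auto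
  have "j \<in> Coker_in A cof"
    unfolding Coker_in_def using e QR Hom_Mor[OF j] by (auto simp: Hom_def)
  then have jC: "j \<in> CoFib" using CoFib_Coker_in by blast
  have "zero Z Q \<in> CoFib" using cofibrant_iff[OF Z] QR by blast
  then have "j \<cdot> zero Z Q \<in> CoFib" using CoFib_comp[OF _ zero_Hom[OF O(1,2)] jC j] by blast
  then show ?thesis using cofibrant_iff[OF Z] comp_zero(1)[OF j O(1)] O by simp
qed

text \<open>
  Let \<open>Q'\<close> be the cofibrant replacement of the cokernel of the cofibrant replacement
  \<open>p : Q \<rightarrow> X\<close>. The preimage \<open>P\<close> of \<open>Q'\<close> in \<open>X\<close> is an extension of \<open>Q'\<close> by \<open>Q\<close>, hence cofibrant,
  so \<open>P \<rightarrow> X\<close> factors through \<open>Q\<close> and \<open>Q'\<close> vanishes.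
\<close>

lemma trivial_cokernel:
  assumes Q: "Q \<in> cof" and p: "p \<in> Fib \<inter> Weq" "p \<in> Hom A Q X" and c: "is_cokernel A p c" "c \<in> Hom A X R"
  shows "R \<in> triv"
proof -
  have R: "R \<in> Obj A" using Hom_Obj[OF c(2)] by simp
  have cp: "c \<cdot> p = zero Q R" using is_cokernelD(2)[OF c(1) p(2) c(2)] .
  have ce: "epic A c" using is_cokernelD(4)[OF c(1) p(2)] .
  have ck: "is_kernel A c p" using monic_kernel_of_cokernel[OF TFib_monic[OF p] c(1)] .
  obtain Q' p' where *: "Q' \<in> cof" "p' \<in> Fib \<inter> Weq" "p' \<in> Hom A Q' R" "monic A p'"
    using cofibrant_replacement[OF R] .
  obtain P e v where P: "P \<in> Obj A" "e \<in> Hom A P Q'" "epic A e" "v \<in> Hom A P X" "c \<cdot> v = p' \<cdot> e"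
    and inj: "\<forall>S. \<forall>x\<in>Hom A S P. \<forall>y\<in>Hom A S P. e \<cdot> x = e \<cdot> y \<and> v \<cdot> x = v \<cdot> y \<longrightarrow> x = y"
    and ex: "\<forall>S. \<forall>a\<in>Hom A S Q'. \<forall>b\<in>Hom A S X. c \<cdot> b = p' \<cdot> a \<longrightarrow>
      (\<exists>x\<in>Hom A S P. e \<cdot> x = a \<and> v \<cdot> x = b)"
    using epic_pullback[OF c(2) ce *(3)] .
  have O: "Q \<in> Obj A" "Q' \<in> Obj A" using Hom_Obj[OF p(2)] Hom_Obj[OF *(3)] by auto
  \<comment> \<open>The pair \<open>(0, p)\<close> induces the inclusion of the fibre of
    \<open>e\<close> over zero, which is all of \<open>Q\<close> since \<open>p\<close> is a kernel
    of \<open>c\<close>.\<close>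
  obtain j where j: "j \<in> Hom A Q P" "e \<cdot> j = zero Q Q'" "v \<cdot> j = p"
    using ex zero_Hom[OF O] p(2) cp comp_zero(1)[OF *(3) O(1)] by metis
  have "is_kernel A e j"
  proof (rule is_kernelI[OF P(2) j(1,2)])
    show "monic A j"
    proof (rule monicI_null[OF j(1)])
      fix T u assume u: "u \<in> Hom A T Q" "j \<cdot> u = zero T P"
      have "p \<cdot> u = zero T X"
        using comp_assoc[OF u(1) j(1) P(4)] j(3) u(2) comp_zero(1)[OF P(4)] Hom_Obj[OF u(1)] by simp
      then show "u = zero T Q" using monic_null[OF TFib_monic[OF p] p(2) u(1)] by simp
    qed
    fix T x assume x: "x \<in> Hom A T P" "e \<cdot> x = zero T Q'"
    have T: "T \<in> Obj A" using Hom_Obj[OF x(1)] by simp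
    have "c \<cdot> (v \<cdot> x) = p' \<cdot> (e \<cdot> x)"
      using comp_assoc[OF x(1) P(4) c(2)] P(5) comp_assoc[OF x(1) P(2) *(3)] by simp
    then have "c \<cdot> (v \<cdot> x) = zero T R" using x(2) comp_zero(1)[OF *(3) T] by simp
    then obtain y where y: "y \<in> Hom A T Q" "p \<cdot> y = v \<cdot> x"
      using is_kernelD(3)[OF ck c(2) p(2) comp_Hom[OF x(1) P(4)]] by blast
    have "e \<cdot> (j \<cdot> y) = e \<cdot> x"
      using comp_assoc[OF y(1) j(1) P(2)] j(2) comp_zero(2)[OF y(1) O(2)] x(2) by simp
    moreover have "v \<cdot> (j \<cdot> y) = v \<cdot> x" using comp_assoc[OF y(1) j(1) P(4)] j(3) y(2) by simp
    ultimately have "j \<cdot> y = x" using inj comp_Hom[OF y(1) j(1)] x(1) by blast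
    then show "\<exists>u\<in>Hom A T Q. j \<cdot> u = x" using y(1) by blast
  qed
  then have "is_cokernel A j e" using epic_cokernel_of_kernel P(3) by blast
  then have PC: "P \<in> cof" using cofibrant_ext[OF j(1) _ P(2) Q *(1)] by blast
  obtain Z where Z: "zero_object A Z" using ex_zero_object by blast
  have ZO: "Z \<in> Obj A" using zero_object_Obj[OF Z] .
  have zP: "zero Z P \<in> Hom A Z P" "zero Z P \<in> CoFib" using zero_Hom ZO P(1) PC cofibrant_iff[OF Z] by auto
  have "comm_square A (zero Z P) p (zero Z Q) v"
    using comm_squareI[OF zP(1) p(2) zero_Hom[OF ZO O(1)] P(4)] comp_zero(1)[OF p(2) ZO]
      comp_zero(1)[OF P(4) ZO] by simp
  then obtain s where s: "is_lifting A (zero Z P) p (zero Z Q) v s" using CM3 zP p(1) by blast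
  note s = is_liftingD[OF s zP(1) p(2)]
  \<comment> \<open>\<open>v\<close> factors through \<open>p\<close>, which \<open>c\<close> kills.
    Cancelling \<open>e\<close> makes the monomorphism \<open>p'\<close> zero, so \<open>Q'\<close>
    is a zero object, and the weak equivalence \<open>p'\<close> from it shows that \<open>R\<close>
    is trivial.\<close>
  have "p' \<cdot> e = zero P R"
    using P(5) s(3) comp_assoc[OF s(1) p(2) c(2)] cp comp_zero(2)[OF s(1) R] by simp
  then have "p' = zero Q' R" using epic_null[OF P(3,2) *(3)] by simp
  then have "zero_object A Q'" using zero_objectI_monic *(3,4) by blast
  then show ?thesis unfolding trivial_objects_def using * R by blast
qed

lemma torsion_pair_cof_triv: "torsion_pair A cof triv"
  unfolding torsion_pair_def
proof (intro conjI ballI)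
  obtain Z where Z: "zero_object A Z" using ex_zero_object by blast
  have ZO: "Z \<in> Obj A" using zero_object_Obj[OF Z] .
  show "iso_closed A cof"
    unfolding iso_closed_def
  proof (intro conjI ballI impI)
    show "cof \<subseteq> Obj A" using cofibrant_iff[OF Z] by blast
    fix X Y assume X: "X \<in> cof" and Y: "Y \<in> Obj A" and i: "iso_obj A X Y"
    then obtain f where f: "f \<in> Hom A Y X" "iso_mor A f" using iso_obj_sym unfolding iso_obj_def by blast
    have "is_cokernel A (zero Z Y) f" using iso_cokernel_zero[OF f ZO] .
    then have "zero Z Y \<in> Coker_in A cof"
      unfolding Coker_in_def using Hom_Mor[OF zero_Hom[OF ZO Y]] f X by (auto simp: Hom_def)
    then show "Y \<in> cof" using CoFib_Coker_in cofibrant_iff[OF Z] Y by blast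
  qed
  show "iso_closed A triv"
    unfolding iso_closed_def
  proof (intro conjI ballI impI)
    show "triv \<subseteq> Obj A" using trivial_iff[OF Z] by blast
    fix X Y assume X: "X \<in> triv" and Y: "Y \<in> Obj A" and i: "iso_obj A X Y"
    then obtain f where f: "f \<in> Hom A X Y" "iso_mor A f" unfolding iso_obj_def by blast
    have XO: "X \<in> Obj A" using Hom_Obj[OF f(1)] by simp
    have "f \<cdot> zero Z X \<in> Weq"
      using Weq_comp(1)[OF zero_Hom[OF ZO XO] f(1)] iso_Weq[OF f] trivial_iff[OF Z] X by blast
    then show "Y \<in> triv" using trivial_iff[OF Z] Y comp_zero(1)[OF f(1) ZO] by simp
  qed
  show "zero_mor A f" if "X \<in> cof" "Y \<in> triv" "f \<in> Hom A X Y" for X Y f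
    using cofibrant_trivial_null[OF that] zero_mor_iff that by blast
  show "\<exists>T'\<in>cof. \<exists>F'\<in>triv. \<exists>i\<in>Hom A T' X. \<exists>p\<in>Hom A X F'. short_exact A i p" if X: "X \<in> Obj A" for X
  proof -
    obtain Q p where *: "Q \<in> cof" "p \<in> Fib \<inter> Weq" "p \<in> Hom A Q X" "monic A p"
      using cofibrant_replacement[OF X] .
    obtain R c where c: "R \<in> Obj A" "c \<in> Hom A X R" "is_cokernel A p c" using obtain_cokernel[OF *(3)] .
    have "R \<in> triv" using trivial_cokernel[OF *(1-3) c(3,2)] .
    moreover have "short_exact A p c"
      unfolding short_exact_def using monic_kernel_of_cokernel[OF *(4) c(3)] c(3) by blast
    ultimately show ?thesis using * c by blast
  qed
qed

lemma torsion_pair_triv_fibr: "torsion_pair A triv fibr"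
  using ttf_model.torsion_pair_cof_triv[OF ttf_model_opc]
  by (simp add: torsion_pair_opc trivial_objects_opc)

lemma ttf_triple: "ttf A add zero cof triv fibr"
  using torsion_pair_cof_triv torsion_pair_triv_fibr abelian_axioms
  by (simp add: ttf_def ttf_axioms_def)

text \<open>The triple just obtained induces a model structure with the given \<open>CoFib\<close>
  and \<open>Fib\<close>, and its weak equivalences must then agree with \<open>Weq\<close>.\<close>

lemma Weq_eq: "Ker_in A triv \<inter> Coker_in A triv = Weq"
proof -
  have "model_structure A CoFib Fib (Ker_in A triv \<inter> Coker_in A triv)"
    using ttf.orthogonal_model_structure_TTF[OF ttf_triple, folded CoFib_eq Fib_eq]
    by (simp add: orthogonal_model_structure_def)
  then show ?thesis
    using Weq_determined model_structure_axioms by blast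
qed

end

lemma (in abelian) bij_TTF_to_model:
  "\<And>T. T \<in> TTF_triples A \<Longrightarrow> TTF_to_model A T \<in> TTF_model_structures A"
  "\<And>T. T \<in> TTF_triples A \<Longrightarrow> model_to_TTF A (TTF_to_model A T) = T"
  "\<And>M. M \<in> TTF_model_structures A \<Longrightarrow> model_to_TTF A M \<in> TTF_triples A"
  "\<And>M. M \<in> TTF_model_structures A \<Longrightarrow> TTF_to_model A (model_to_TTF A M) = M"
proof -
  fix T assume "T \<in> TTF_triples A"
  then obtain C W F where T: "T = (C, W, F)" "torsion_pair A C W" "torsion_pair A W F"
    unfolding TTF_triples_def by blast
  interpret ttf A add zero C W F by unfold_locales fact+
  show "TTF_to_model A T \<in> TTF_model_structures A" "model_to_TTF A (TTF_to_model A T) = T"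
    using orthogonal_model_structure_TTF cofibrant_objects_TTF fibrant_objects_TTF trivial_objects_TTF
    by (simp_all add: T TTF_model_structures_def)
next
  fix M assume "M \<in> TTF_model_structures A"
  then obtain CoFib Fib Weq where M: "M = (CoFib, Fib, Weq)"
    "orthogonal_model_structure A CoFib Fib Weq" "CoFib = Coker_in A (cofibrant_objects A CoFib)"
    "Fib = Ker_in A (fibrant_objects A Fib)"
    unfolding TTF_model_structures_def by blast
  interpret ttf_model A add zero CoFib Fib Weq
    by (intro ttf_model.intro ttf_model_axioms.intro abelian_axioms M)
  show "model_to_TTF A M \<in> TTF_triples A" "TTF_to_model A (model_to_TTF A M) = M"
    using torsion_pair_cof_triv torsion_pair_triv_fibr
    by (simp_all add: M(1) TTF_triples_def Weq_eq flip: CoFib_eq Fib_eq)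
qed

section \<open>The abelian category of objects both cofibrant and fibrant\<close>

lemma full_subcategory_simps [simp]:
  "Obj (full_subcategory A S) = S"
  "Mor (full_subcategory A S) = {f \<in> Mor A. Dom A f \<in> S \<and> Cod A f \<in> S}"
  "Dom (full_subcategory A S) = Dom A" "Cod (full_subcategory A S) = Cod A"
  "Id (full_subcategory A S) = Id A" "g \<cdot>\<^bsub>full_subcategory A S\<^esub> f = g \<cdot>\<^bsub>A\<^esub> f"
  by (simp_all add: full_subcategory_def)

lemma Hom_full_subcategory:
  "f \<in> Hom (full_subcategory A S) X Y \<longleftrightarrow> f \<in> Hom A X Y \<and> X \<in> S \<and> Y \<in> S"
  by (auto simp: Hom_def)

lemma monic_full_subcategory:
  assumes "monic A f" "Dom A f \<in> S" "Cod A f \<in> S"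
  shows "monic (full_subcategory A S) f"
  using assms unfolding monic_def by auto

lemma (in category) category_full_subcategory:
  "S \<subseteq> Obj A \<Longrightarrow> category (full_subcategory A S)"
  by unfold_locales (auto simp: Comp_assoc Comp_Id_left Comp_Id_right)

lemma (in preadditive_category) preadditive_full_subcategory:
  assumes S: "S \<subseteq> Obj A"
  shows "preadditive_category (full_subcategory A S) add zero"
proof (intro preadditive_category.intro category_full_subcategory preadditive_category_axioms.intro S)
  fix X Y assume "X \<in> Obj (full_subcategory A S)" "Y \<in> Obj (full_subcategory A S)"
  moreover from this have "Hom (full_subcategory A S) X Y = Hom A X Y"
    by (auto simp: Hom_full_subcategory)
  ultimately show "comm_group \<lparr>carrier = Hom (full_subcategory A S) X Y, monoid.mult = add, one = zero X Y\<rparr>"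
    using Hom_group S by auto
next
  fix X Y Z f f' g
  assume "f \<in> Hom (full_subcategory A S) X Y" "f' \<in> Hom (full_subcategory A S) X Y"
    "g \<in> Hom (full_subcategory A S) Y Z"
  then have "f \<in> Hom A X Y" "f' \<in> Hom A X Y" "g \<in> Hom A Y Z"
    by (simp_all add: Hom_full_subcategory)
  then show "g \<cdot>\<^bsub>full_subcategory A S\<^esub> (add f f') =
    add (g \<cdot>\<^bsub>full_subcategory A S\<^esub> f) (g \<cdot>\<^bsub>full_subcategory A S\<^esub> f')"
    using Comp_add_right Hom_Obj by simp
next
  fix X Y Z f g g'
  assume "f \<in> Hom (full_subcategory A S) X Y" "g \<in> Hom (full_subcategory A S) Y Z"
    "g' \<in> Hom (full_subcategory A S) Y Z"
  then have "f \<in> Hom A X Y" "g \<in> Hom A Y Z" "g' \<in> Hom A Y Z"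
    by (simp_all add: Hom_full_subcategory)
  then show "(add g g') \<cdot>\<^bsub>full_subcategory A S\<^esub> f =
    add (g \<cdot>\<^bsub>full_subcategory A S\<^esub> f) (g' \<cdot>\<^bsub>full_subcategory A S\<^esub> f)"
    using Comp_add_left Hom_Obj by simp
qed

text \<open>The closure assumption covers every object whose identity decomposes through
  \<open>X\<close> and \<open>Y\<close>, since the ambient category does not say which biproduct it
  provides.\<close>

lemma (in additive_category) additive_full_subcategory:
  assumes S: "S \<subseteq> Obj A" and Z: "zero_object A Z" "Z \<in> S"
    and biprod: "\<And>X Y P i j p q. \<lbrakk>X \<in> S; Y \<in> S; i \<in> Hom A X P; j \<in> Hom A Y P; p \<in> Hom A P X;
        q \<in> Hom A P Y; add (i \<cdot> p) (j \<cdot> q) = Id A P\<rbrakk> \<Longrightarrow> P \<in> S"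
  shows "additive_category (full_subcategory A S) add zero"
proof (intro additive_category.intro preadditive_full_subcategory additive_category_axioms.intro S)
  show "\<exists>Z. zero_object (full_subcategory A S) Z"
  proof (intro exI[of _ Z])
    have "Hom (full_subcategory A S) Z X = Hom A Z X" "Hom (full_subcategory A S) X Z = Hom A X Z"
      if "X \<in> S" for X
      using that Z(2) by (auto simp: Hom_full_subcategory)
    then show "zero_object (full_subcategory A S) Z"
      using Z S unfolding zero_object_def full_subcategory_simps by (simp add: subset_iff)
  qed
  fix X Y assume "X \<in> Obj (full_subcategory A S)" "Y \<in> Obj (full_subcategory A S)"
  then have XY: "X \<in> S" "Y \<in> S" by simp_all
  then obtain P i j p q where P: "i \<in> Hom A X P" "j \<in> Hom A Y P" "p \<in> Hom A P X" "q \<in> Hom A P Y"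
    "p \<cdot> i = Id A X" "q \<cdot> j = Id A Y" "p \<cdot> j = zero Y X" "q \<cdot> i = zero X Y"
    "add (i \<cdot> p) (j \<cdot> q) = Id A P"
    using ex_biproduct[of X Y] S unfolding has_biproduct_def by blast
  have PS: "P \<in> S" using biprod[OF XY P(1-4,9)] .
  show "has_biproduct (full_subcategory A S) add zero X Y"
    unfolding has_biproduct_def
    by (intro bexI[of _ P] bexI[of _ i] bexI[of _ j] bexI[of _ p] bexI[of _ q])
      (use P PS XY in \<open>simp_all add: Hom_full_subcategory\<close>)
qed

context abelian
begin

lemma torsion_free_sub:
  assumes tp: "torsion_pair A T F" and n: "n \<in> Hom A K X" "monic A n" and X: "X \<in> F"
  shows "K \<in> F"
proof -
  have "u = zero D K" if "D \<in> T" "u \<in> Hom A D K" for D u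
    using torsion_null[OF tp that(1) X comp_Hom[OF that(2) n(1)]] monic_null[OF n(2,1) that(2)] by simp
  then show ?thesis using in_torsion_free_iff[OF tp] Hom_Obj[OF n(1)] by blast
qed

lemma torsion_quotient:
  "\<lbrakk>torsion_pair A T F; q \<in> Hom A X Q; epic A q; X \<in> T\<rbrakk> \<Longrightarrow> Q \<in> T"
  using abelian.torsion_free_sub[OF abelian_opc, of F T q Q X] by (simp add: torsion_pair_opc)

lemma monic_comp:
  assumes f: "f \<in> Hom A X Y" "monic A f" and g: "g \<in> Hom A Y Z" "monic A g"
  shows "monic A (g \<cdot> f)"
proof (rule monicI_null[OF comp_Hom[OF f(1) g(1)]])
  fix T u assume u: "u \<in> Hom A T X" "(g \<cdot> f) \<cdot> u = zero T Z"
  then have "f \<cdot> u = zero T Y"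
    using monic_null[OF g(2,1) comp_Hom[OF u(1) f(1)]] comp_assoc[OF u(1) f(1) g(1)] by simp
  then show "u = zero T X" using monic_null[OF f(2,1) u(1)] by simp
qed

lemma epic_comp:
  "\<lbrakk>f \<in> Hom A X Y; epic A f; g \<in> Hom A Y Z; epic A g\<rbrakk> \<Longrightarrow> epic A (g \<cdot> f)"
  using abelian.monic_comp[OF abelian_opc, of g Z Y f X] by simp

end

section \<open>Kernels and monomorphisms in the intersection of C and F\<close>

context ttf
begin

abbreviation "bif \<equiv> full_subcategory A (C \<inter> F)"

lemma CF_Obj: "C \<inter> F \<subseteq> Obj A"
  using torsion_Obj[OF CW] by blast

lemma zero_object_CF: "zero_object A Z \<Longrightarrow> Z \<in> C \<inter> F"
  using in_torsion_iff[OF CW, of Z] in_torsion_free_iff[OF WF, of Z] zero_object_Hom zero_object_Obj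
  by blast

lemma WC_zero:
  assumes "X \<in> C" "X \<in> W"
  shows "zero_object A X"
  using zero_objectI torsion_null[OF CW assms Id_Hom] torsion_Obj[OF CW] assms by blast

lemma WF_zero:
  assumes "X \<in> W" "X \<in> F"
  shows "zero_object A X"
  using zero_objectI torsion_null[OF WF assms Id_Hom] torsion_Obj[OF WF] assms by blast

lemma additive_CF: "additive_category bif add zero"
proof -
  obtain Z where Z: "zero_object A Z" using ex_zero_object by blast
  show ?thesis
  proof (rule additive_full_subcategory[OF CF_Obj Z zero_object_CF[OF Z]])
    fix X Y P i j p q
    assume XY: "X \<in> C \<inter> F" "Y \<in> C \<inter> F" and i: "i \<in> Hom A X P" and j: "j \<in> Hom A Y P"
      and p: "p \<in> Hom A P X" and q: "q \<in> Hom A P Y" and e: "add (i \<cdot> p) (j \<cdot> q) = Id A P"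
    have P: "P \<in> Obj A" using Hom_Obj[OF i] by simp
    note ip = comp_Hom[OF p i] and jq = comp_Hom[OF q j]
    \<comment> \<open>Splitting the identity of \<open>P\<close> writes \<open>u\<close> as a sum of
      two morphisms that factor through morphisms from \<open>X\<close> or \<open>Y\<close> to
      \<open>W\<close>, which are zero.\<close>
    have "u = zero P V" if V: "V \<in> W" and u: "u \<in> Hom A P V" for V u
    proof -
      have VO: "V \<in> Obj A" using Hom_Obj[OF u] by simp
      have ui: "u \<cdot> i = zero X V" "u \<cdot> j = zero Y V"
        using torsion_null[OF CW _ V comp_Hom[OF i u]] torsion_null[OF CW _ V comp_Hom[OF j u]] XY
        by auto
      have "u = add (u \<cdot> (i \<cdot> p)) (u \<cdot> (j \<cdot> q))"
        using Comp_add_right[OF P P VO ip jq u] e comp_Id[OF u] by simp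
      then show ?thesis
        using comp_assoc[OF p i u] comp_assoc[OF q j u] ui comp_zero(2)[OF p VO]
          comp_zero(2)[OF q VO] add_zero[OF zero_Hom[OF P VO]] by simp
    qed
    then have "P \<in> C" using in_torsion_iff[OF CW] P by blast
    moreover have "u = zero V P" if V: "V \<in> W" and u: "u \<in> Hom A V P" for V u
    proof -
      have VO: "V \<in> Obj A" using Hom_Obj[OF u] by simp
      have ui: "p \<cdot> u = zero V X" "q \<cdot> u = zero V Y"
        using torsion_null[OF WF V _ comp_Hom[OF u p]] torsion_null[OF WF V _ comp_Hom[OF u q]] XY
        by auto
      have "u = add ((i \<cdot> p) \<cdot> u) ((j \<cdot> q) \<cdot> u)"
        using Comp_add_left[OF VO P P u ip jq] e comp_Id[OF u] by simp
      then show ?thesis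
        using comp_assoc[OF u p i] comp_assoc[OF u q j] ui comp_zero(1)[OF i VO]
          comp_zero(1)[OF j VO] add_zero[OF zero_Hom[OF VO P]] by simp
    qed
    then have "P \<in> F" using in_torsion_free_iff[OF WF] P by blast
    ultimately show "P \<in> C \<inter> F" by blast
  qed
qed

text \<open>The kernel in \<open>C \<inter> F\<close> is the \<open>C\<close>-part of the ambient
  kernel. It stays in \<open>F\<close> as a subobject of \<open>X\<close>, and a morphism from
  \<open>C\<close> into the ambient kernel lands in the \<open>C\<close>-part because its image in
  the \<open>W\<close>-quotient is zero.\<close>

lemma kernel_CF:
  assumes f: "f \<in> Hom A X Y" "X \<in> C \<inter> F" "Y \<in> C \<inter> F" and k: "k \<in> Hom A K X" "is_kernel A f k"
    and m: "m \<in> Hom A K' K" "r \<in> Hom A K V" "K' \<in> C" "V \<in> W" "is_kernel A r m"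
  shows "k \<cdot> m \<in> Hom A K' X" "K' \<in> C \<inter> F" "is_kernel bif f (k \<cdot> m)"
proof -
  interpret B: additive_category bif add zero by (rule additive_CF)
  show km: "k \<cdot> m \<in> Hom A K' X" using comp_Hom[OF m(1) k(1)] .
  have mono: "monic A (k \<cdot> m)"
    using monic_comp[OF m(1) is_kernelD(4)[OF m(5,2)] k(1) is_kernelD(4)[OF k(2) f(1)]] .
  show K': "K' \<in> C \<inter> F" using torsion_free_sub[OF WF km mono] m(3) f(2) by blast
  show "is_kernel bif f (k \<cdot> m)"
  proof (rule B.is_kernelI)
    show "f \<in> Hom bif X Y" "k \<cdot> m \<in> Hom bif K' X"
      using f km K' by (simp_all add: Hom_full_subcategory)
    have "f \<cdot> (k \<cdot> m) = zero K' Y"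
      using comp_assoc[OF m(1) k(1) f(1)] is_kernelD(2)[OF k(2) f(1) k(1)] comp_zero(2)[OF m(1)]
        Hom_Obj[OF f(1)] by simp
    then show "f \<cdot>\<^bsub>bif\<^esub> (k \<cdot> m) = zero K' Y" by simp
    show "monic bif (k \<cdot> m)" using monic_full_subcategory[OF mono] km K' f(2) by (auto simp: Hom_def)
    fix T g assume g: "g \<in> Hom bif T X" "f \<cdot>\<^bsub>bif\<^esub> g = zero T Y"
    then have gA: "g \<in> Hom A T X" "f \<cdot> g = zero T Y" and T: "T \<in> C \<inter> F"
      by (simp_all add: Hom_full_subcategory)
    obtain u where u: "u \<in> Hom A T K" "k \<cdot> u = g" using is_kernelD(3)[OF k(2) f(1) k(1) gA] by blast
    have "r \<cdot> u = zero T V" using torsion_null[OF CW _ m(4) comp_Hom[OF u(1) m(2)]] T by blast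
    then obtain u' where u': "u' \<in> Hom A T K'" "m \<cdot> u' = u"
      using is_kernelD(3)[OF m(5,2,1) u(1)] by blast
    then have "(k \<cdot> m) \<cdot> u' = g" using comp_assoc[OF u'(1) m(1) k(1)] u by simp
    then show "\<exists>u\<in>Hom bif T K'. (k \<cdot> m) \<cdot>\<^bsub>bif\<^esub> u = g"
      using u'(1) T K' by (auto simp: Hom_full_subcategory)
  qed
qed

lemma ex_kernel_CF:
  assumes "f \<in> Mor bif"
  shows "\<exists>k. is_kernel bif f k"
proof -
  define X Y where "X = Dom A f" "Y = Cod A f"
  then have f: "f \<in> Hom A X Y" "X \<in> C \<inter> F" "Y \<in> C \<inter> F" using assms by (simp_all add: Hom_def)
  obtain K k where k: "K \<in> Obj A" "k \<in> Hom A K X" "is_kernel A f k" using obtain_kernel[OF f(1)] .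
  obtain K' V m r where "K' \<in> C" "V \<in> W" "m \<in> Hom A K' K" "r \<in> Hom A K V" "is_kernel A r m"
    "is_cokernel A m r" using torsion_seq[OF CW k(1)] .
  then show ?thesis using kernel_CF[OF f k(2,3)] by blast
qed

text \<open>The ambient kernel has zero \<open>C\<close>-part, so it lies in \<open>W\<close>; as a
  subobject of \<open>X\<close> it also lies in \<open>F\<close>, and \<open>W\<close> meets
  \<open>F\<close> only in zero objects.\<close>

lemma monic_CF:
  assumes f: "f \<in> Hom A X Y" "X \<in> C \<inter> F" "Y \<in> C \<inter> F" and mono: "monic bif f"
  shows "monic A f"
proof -
  interpret B: additive_category bif add zero by (rule additive_CF)
  obtain K k where k: "K \<in> Obj A" "k \<in> Hom A K X" "is_kernel A f k" using obtain_kernel[OF f(1)] .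
  have km: "monic A k" using is_kernelD(4)[OF k(3) f(1)] .
  obtain K' V m r where m: "K' \<in> C" "V \<in> W" "m \<in> Hom A K' K" "r \<in> Hom A K V" "is_kernel A r m"
    "is_cokernel A m r" using torsion_seq[OF CW k(1)] .
  note B = kernel_CF[OF f k(2,3) m(3,4,1,2,5)]
  have fB: "f \<in> Hom bif X Y" and kmB: "k \<cdot> m \<in> Hom bif K' X"
    using f B by (simp_all add: Hom_full_subcategory)
  have "k \<cdot> m = zero K' X"
    using B.monic_null[OF mono fB kmB] B.is_kernelD(2)[OF B(3) fB kmB] by blast
  then have m0: "m = zero K' K" using monic_null[OF km k(2) m(3)] by simp
  have "u = zero D K" if D: "D \<in> C" and u: "u \<in> Hom A D K" for D u
  proof -
    have "r \<cdot> u = zero D V" using torsion_null[OF CW D m(2) comp_Hom[OF u m(4)]] .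
    then obtain u' where "u' \<in> Hom A D K'" "m \<cdot> u' = u" using is_kernelD(3)[OF m(5,4,3) u] by blast
    then show ?thesis using m0 comp_zero(2)[of u' D K' K] k(1) by simp
  qed
  then have "K \<in> W" using in_torsion_free_iff[OF CW] k(1) by blast
  moreover have "K \<in> F" using torsion_free_sub[OF WF k(2) km] f(2) by blast
  ultimately have K: "zero_object A K" using WF_zero by blast
  show ?thesis
  proof (rule monicI_null[OF f(1)])
    fix T u assume u: "u \<in> Hom A T X" "f \<cdot> u = zero T Y"
    then obtain u' where u': "u' \<in> Hom A T K" "k \<cdot> u' = u" using is_kernelD(3)[OF k(3) f(1) k(2)] by blast
    then have "u' = zero T K" using zero_object_Hom(2)[OF K] by blast
    then show "u = zero T X" using u'(2) comp_zero(1)[OF k(2)] Hom_Obj[OF u(1)] by simp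
  qed
qed

text \<open>The ambient cokernel need not lie in \<open>F\<close>, so it is replaced by its
  \<open>F\<close>-quotient. The kernel seen from \<open>C\<close> does not change, since the
  discarded part lies in \<open>W\<close>.\<close>

lemma monic_is_kernel_CF:
  assumes mono: "monic bif f"
  shows "\<exists>g. is_kernel bif g f"
proof -
  interpret B: additive_category bif add zero by (rule additive_CF)
  define X Y where "X = Dom A f" "Y = Cod A f"
  then have f: "f \<in> Hom A X Y" "X \<in> C \<inter> F" "Y \<in> C \<inter> F"
    using mono by (simp_all add: monic_def Hom_def)
  have fA: "monic A f" using monic_CF[OF f mono] .
  obtain Q q where q: "Q \<in> Obj A" "q \<in> Hom A Y Q" "is_cokernel A f q" using obtain_cokernel[OF f(1)] .
  have fk: "is_kernel A q f" using monic_kernel_of_cokernel[OF fA q(3)] .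
  obtain V G j \<rho> where j: "V \<in> W" "G \<in> F" "j \<in> Hom A V Q" "\<rho> \<in> Hom A Q G" "is_kernel A \<rho> j"
    "is_cokernel A j \<rho>" using torsion_seq[OF WF q(1)] .
  have rq: "\<rho> \<cdot> q \<in> Hom A Y G" using comp_Hom[OF q(2) j(4)] .
  have "epic A (\<rho> \<cdot> q)"
    using epic_comp[OF q(2) is_cokernelD(4)[OF q(3) f(1)] j(4) is_cokernelD(4)[OF j(6,3)]] .
  then have G: "G \<in> C \<inter> F" using torsion_quotient[OF CW rq] f(3) j(2) by blast
  have "is_kernel bif (\<rho> \<cdot> q) f"
  proof (rule B.is_kernelI[OF _ _ _ mono])
    show "\<rho> \<cdot> q \<in> Hom bif Y G" "f \<in> Hom bif X Y"
      using f rq G by (simp_all add: Hom_full_subcategory)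
    have "(\<rho> \<cdot> q) \<cdot> f = zero X G"
      using comp_assoc[OF f(1) q(2) j(4)] is_cokernelD(2)[OF q(3) f(1) q(2)] comp_zero(1)[OF j(4)]
        Hom_Obj[OF f(1)] by simp
    then show "(\<rho> \<cdot> q) \<cdot>\<^bsub>bif\<^esub> f = zero X G" by simp
    fix T h assume h: "h \<in> Hom bif T Y" "(\<rho> \<cdot> q) \<cdot>\<^bsub>bif\<^esub> h = zero T G"
    then have hA: "h \<in> Hom A T Y" "(\<rho> \<cdot> q) \<cdot> h = zero T G" and T: "T \<in> C \<inter> F"
      by (simp_all add: Hom_full_subcategory)
    have TO: "T \<in> Obj A" using Hom_Obj[OF hA(1)] by simp
    have "\<rho> \<cdot> (q \<cdot> h) = zero T G" using comp_assoc[OF hA(1) q(2) j(4)] hA(2) by simp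
    then obtain h' where h': "h' \<in> Hom A T V" "j \<cdot> h' = q \<cdot> h"
      using is_kernelD(3)[OF j(5,4,3) comp_Hom[OF hA(1) q(2)]] by blast
    have "h' = zero T V" using torsion_null[OF CW _ j(1) h'(1)] T by blast
    then have "q \<cdot> h = zero T Q" using h'(2) comp_zero(1)[OF j(3) TO] by simp
    then obtain u where "u \<in> Hom A T X" "f \<cdot> u = h"
      using is_kernelD(3)[OF fk q(2) f(1) hA(1)] by blast
    then show "\<exists>u\<in>Hom bif T X. f \<cdot>\<^bsub>bif\<^esub> u = h"
      using T f(2) by (auto simp: Hom_full_subcategory)
  qed
  then show ?thesis by blast
qed

theorem abelian_CF: "abelian bif add zero"
proof (intro abelian.intro additive_CF abelian_axioms.intro)
  show "\<exists>q. is_cokernel bif f q" if "f \<in> Mor bif" for f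
    using ttf.ex_kernel_CF[OF ttf_opc, of f] that by (auto simp: Int_commute)
  show "\<exists>g. is_cokernel bif g f" if "epic bif f" for f
    using ttf.monic_is_kernel_CF[OF ttf_opc, of f] that by (simp add: Int_commute)
qed (use ex_kernel_CF monic_is_kernel_CF in blast)+

end

section \<open>Localization\<close>

definition zz_class ::
  "('o, 'm) cat \<Rightarrow> 'm set \<Rightarrow> 'o \<Rightarrow> 'm letter list \<Rightarrow> 'o \<Rightarrow> ('o \<times> 'm letter list \<times> 'o) set" where
  "zz_class A W X p Y = zigzag_rel A W `` {(X, p, Y)}"

lemma zigzag_Nil [simp]: "zigzag A W X [] Y \<longleftrightarrow> X \<in> Obj A \<and> Y = X"
  by (auto intro: zigzag.empty elim: zigzag.cases)

lemma zigzag_Fwd [simp]: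
  "zigzag A W X (Fwd f # p) Y \<longleftrightarrow> f \<in> Mor A \<and> X = Dom A f \<and> zigzag A W (Cod A f) p Y"
  by (auto intro: zigzag.forward elim: zigzag.cases)

lemma zigzag_Bwd [simp]:
  "zigzag A W X (Bwd w # p) Y \<longleftrightarrow> w \<in> Mor A \<and> w \<in> W \<and> X = Cod A w \<and> zigzag A W (Dom A w) p Y"
  by (auto intro: zigzag.backward elim: zigzag.cases)

lemma zigzag_unique: "\<lbrakk>zigzag A W X p Y; zigzag A W X p Z\<rbrakk> \<Longrightarrow> Y = Z"
proof (induction p arbitrary: X)
  case (Cons l p)
  then show ?case by (cases l) auto
qed simp

lemma zigzag_eq_zigzags: "zigzag_eq A W P Q \<Longrightarrow> P \<in> zigzags A W \<and> Q \<in> zigzags A W"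
  by (induction rule: zigzag_eq.induct) (auto simp: zigzags_def)

lemma zigzag_eq_ends: "zigzag_eq A W P Q \<Longrightarrow> fst P = fst Q \<and> snd (snd P) = snd (snd Q)"
  by (induction rule: zigzag_eq.induct) auto

context category
begin

lemma zigzag_rule_ends:
  "\<lbrakk>zigzag_rule A W l r; zigzag A W X l Y; zigzag A W X r Z\<rbrakk> \<Longrightarrow> Y = Z"
  by (erule zigzag_rule.cases) auto

lemma zigzag_Obj: "zigzag A W X p Y \<Longrightarrow> X \<in> Obj A \<and> Y \<in> Obj A"
  by (induction rule: zigzag.induct) auto

lemma zigzag_append_iff:
  "zigzag A W X (p @ q) Z \<longleftrightarrow> (\<exists>Y. zigzag A W X p Y \<and> zigzag A W Y q Z)"
proof (induction p arbitrary: X)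
  case Nil
  then show ?case using zigzag_Obj by auto
next
  case (Cons l p)
  then show ?case by (cases l) auto
qed

text \<open>The context \<open>v\<close> of a rewriting step absorbs the appended zigzag. With its
  mirror image, this makes composition of classes well defined.\<close>

lemma zigzag_eq_append_right:
  "zigzag_eq A W P Q \<Longrightarrow> zigzag A W (snd (snd P)) q Z \<Longrightarrow>
    zigzag_eq A W (fst P, fst (snd P) @ q, Z) (fst Q, fst (snd Q) @ q, Z)"
proof (induction rule: zigzag_eq.induct)
  case (step l r X u v Y)
  have "zigzag A W X (u @ l @ v @ q) Z" "zigzag A W X (u @ r @ v @ q) Z"
    using step unfolding zigzag_append_iff by auto
  then show ?case using zigzag_eq.step[OF step(1), of X u "v @ q" Z] by simp
next
  case (refl P)
  then have "zigzag A W (fst P) (fst (snd P) @ q) Z"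
    unfolding zigzag_append_iff by (auto simp: zigzags_def)
  then show ?case by (auto intro!: zigzag_eq.refl simp: zigzags_def)
next
  case (sym P Q)
  then show ?case using zigzag_eq_ends[OF sym.hyps] zigzag_eq.sym[OF sym.IH] by simp
next
  case (trans P Q R)
  then show ?case
    using zigzag_eq_ends[OF trans.hyps(1)] zigzag_eq.trans[OF trans.IH] by simp
qed

lemma zigzag_eq_append_left:
  "zigzag_eq A W P Q \<Longrightarrow> zigzag A W X q (fst P) \<Longrightarrow>
    zigzag_eq A W (X, q @ fst (snd P), snd (snd P)) (X, q @ fst (snd Q), snd (snd Q))"
proof (induction rule: zigzag_eq.induct)
  case (step l r X' u v Y)
  have "zigzag A W X ((q @ u) @ l @ v) Y" "zigzag A W X ((q @ u) @ r @ v) Y"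
    using step unfolding zigzag_append_iff by auto
  then show ?case using zigzag_eq.step[OF step(1), of X "q @ u" v Y] by simp
next
  case (refl P)
  then have "zigzag A W X (q @ fst (snd P)) (snd (snd P))"
    unfolding zigzag_append_iff by (auto simp: zigzags_def)
  then show ?case by (auto intro!: zigzag_eq.refl simp: zigzags_def)
next
  case (sym P Q)
  then show ?case using zigzag_eq_ends[OF sym.hyps] zigzag_eq.sym[OF sym.IH] by simp
next
  case (trans P Q R)
  then show ?case
    using zigzag_eq_ends[OF trans.hyps(1)] zigzag_eq.trans[OF trans.IH] by simp
qed

lemma zz_class_mem: "P \<in> zz_class A W X p Y \<longleftrightarrow> zigzag_eq A W (X, p, Y) P"
  by (simp add: zz_class_def zigzag_rel_def)

lemma zz_class_self: "zigzag A W X p Y \<Longrightarrow> (X, p, Y) \<in> zz_class A W X p Y"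
  unfolding zz_class_mem by (auto intro: zigzag_eq.refl simp: zigzags_def)

lemma zz_class_eqI: "zigzag_eq A W (X, p, Y) (X', q, Y') \<Longrightarrow> zz_class A W X p Y = zz_class A W X' q Y'"
  unfolding set_eq_iff zz_class_mem by (blast intro: zigzag_eq.sym zigzag_eq.trans)

lemma zz_class_ruleI:
  "\<lbrakk>zigzag_rule A W l r; zigzag A W X l Y; zigzag A W X r Y\<rbrakk>
    \<Longrightarrow> zz_class A W X l Y = zz_class A W X r Y"
  using zigzag_eq.step[of A W l r X "[]" "[]" Y] by (intro zz_class_eqI) simp

lemma zz_class_ends:
  "\<lbrakk>(X', q, Y') \<in> zz_class A W X p Y\<rbrakk> \<Longrightarrow> X' = X \<and> Y' = Y \<and> zigzag A W X q Y"
  unfolding zz_class_mem using zigzag_eq_ends zigzag_eq_zigzags by (fastforce simp: zigzags_def)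

lemma localization_Obj [simp]: "Obj (localization A W) = Obj A"
  by (simp add: localization_def)

lemma localization_Mor: "\<phi> \<in> Mor (localization A W) \<longleftrightarrow> (\<exists>X p Y. zigzag A W X p Y \<and> \<phi> = zz_class A W X p Y)"
  by (auto simp: localization_def quotient_def zigzags_def zz_class_def)

lemma localization_Dom: "zigzag A W X p Y \<Longrightarrow> Dom (localization A W) (zz_class A W X p Y) = X"
  using zz_class_self[of W X p Y] by (auto simp: localization_def dest: zz_class_ends intro!: the_equality)

lemma localization_Cod: "zigzag A W X p Y \<Longrightarrow> Cod (localization A W) (zz_class A W X p Y) = Y"
  using zz_class_self[of W X p Y] by (auto simp: localization_def dest: zz_class_ends intro!: the_equality)

lemma localization_Id: "Id (localization A W) X = zz_class A W X [] X"
  by (simp add: localization_def zz_class_def)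

text \<open>Composition concatenates all pairs of matching representatives; by the two congruence
  lemmas these are all equivalent, so the result is a single class.\<close>

lemma localization_Comp:
  assumes p: "zigzag A W X p Y" and q: "zigzag A W Y q Z"
  shows "zz_class A W Y q Z \<cdot>\<^bsub>localization A W\<^esub> zz_class A W X p Y = zz_class A W X (p @ q) Z"
proof -
  let ?S = "{(X', p' @ q', Z') | X' p' q' Z'.
    \<exists>Y'. (X', p', Y') \<in> zz_class A W X p Y \<and> (Y', q', Z') \<in> zz_class A W Y q Z}"
  have S: "zigzag_eq A W (X, p @ q, Z) P" if P: "P \<in> ?S" for P
  proof -
    obtain X' p' q' Z' Y' where *: "P = (X', p' @ q', Z')" "(X', p', Y') \<in> zz_class A W X p Y"
      "(Y', q', Z') \<in> zz_class A W Y q Z" using P by blast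
    then have e: "X' = X" "Y' = Y" "Z' = Z" "zigzag A W X p' Y" using zz_class_ends by blast+
    have "zigzag_eq A W (X, p @ q, Z) (X, p' @ q, Z)"
      using zigzag_eq_append_right[OF *(2)[unfolded zz_class_mem]] q e by simp
    moreover have "zigzag_eq A W (X, p' @ q, Z) (X, p' @ q', Z)"
      using zigzag_eq_append_left[OF *(3)[unfolded zz_class_mem]] e by simp
    ultimately show ?thesis using * e zigzag_eq.trans by blast
  qed
  have pq: "(X, p @ q, Z) \<in> ?S" using zz_class_self p q by blast
  have "zigzag_rel A W `` ?S = zz_class A W X (p @ q) Z"
  proof (intro equalityI subsetI)
    fix P assume "P \<in> zigzag_rel A W `` ?S"
    then obtain Q where Q: "Q \<in> ?S" "(Q, P) \<in> zigzag_rel A W" by (rule ImageE)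
    then have "zigzag_eq A W Q P" by (simp add: zigzag_rel_def)
    from zigzag_eq.trans[OF S[OF Q(1)] this] show "P \<in> zz_class A W X (p @ q) Z"
      by (simp add: zz_class_mem)
  next
    fix P assume "P \<in> zz_class A W X (p @ q) Z"
    then have "((X, p @ q, Z), P) \<in> zigzag_rel A W" by (simp add: zz_class_mem zigzag_rel_def)
    then show "P \<in> zigzag_rel A W `` ?S" using pq by (rule ImageI)
  qed
  then show ?thesis by (simp add: localization_def)
qed

lemma localization_Hom:
  "\<phi> \<in> Hom (localization A W) X Y \<longleftrightarrow> (\<exists>p. zigzag A W X p Y \<and> \<phi> = zz_class A W X p Y)"
  unfolding Hom_def localization_Mor by (auto simp: localization_Dom localization_Cod)

lemma category_localization: "category (localization A W)"
proof
  fix f assume "f \<in> Mor (localization A W)"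
  then obtain X p Y where f: "zigzag A W X p Y" "f = zz_class A W X p Y" unfolding localization_Mor by blast
  then show "Dom (localization A W) f \<in> Obj (localization A W)" "Cod (localization A W) f \<in> Obj (localization A W)"
    using localization_Dom localization_Cod zigzag_Obj by simp_all
  have "zigzag A W X [] X" "zigzag A W Y [] Y" using zigzag_Obj[OF f(1)] by simp_all
  then show "f \<cdot>\<^bsub>localization A W\<^esub> Id (localization A W) (Dom (localization A W) f) = f"
    "Id (localization A W) (Cod (localization A W) f) \<cdot>\<^bsub>localization A W\<^esub> f = f"
    using localization_Comp f localization_Dom localization_Cod localization_Id by simp_all
next
  fix X assume "X \<in> Obj (localization A W)"
  then have z: "zigzag A W X [] X" by simp
  then show "Id (localization A W) X \<in> Mor (localization A W)"
    "Dom (localization A W) (Id (localization A W) X) = X" "Cod (localization A W) (Id (localization A W) X) = X"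
    unfolding localization_Id localization_Mor using localization_Dom localization_Cod by blast+
next
  fix f g assume fg: "f \<in> Mor (localization A W)" "g \<in> Mor (localization A W)"
    "Cod (localization A W) f = Dom (localization A W) g"
  then obtain X p Y q Z where f: "zigzag A W X p Y" "f = zz_class A W X p Y"
    and g: "zigzag A W Y q Z" "g = zz_class A W Y q Z"
    unfolding localization_Mor using localization_Dom localization_Cod by metis
  have pq: "zigzag A W X (p @ q) Z" using f g zigzag_append_iff by blast
  have c: "g \<cdot>\<^bsub>localization A W\<^esub> f = zz_class A W X (p @ q) Z" using localization_Comp f g by simp
  then show "g \<cdot>\<^bsub>localization A W\<^esub> f \<in> Mor (localization A W)" using pq localization_Mor by blast
  show "Dom (localization A W) (g \<cdot>\<^bsub>localization A W\<^esub> f) = Dom (localization A W) f"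
    "Cod (localization A W) (g \<cdot>\<^bsub>localization A W\<^esub> f) = Cod (localization A W) g"
    using c localization_Dom localization_Cod pq f g by simp_all
next
  fix f g h assume fg: "f \<in> Mor (localization A W)" "g \<in> Mor (localization A W)" "h \<in> Mor (localization A W)"
    "Cod (localization A W) f = Dom (localization A W) g" "Cod (localization A W) g = Dom (localization A W) h"
  then obtain X p Y q Z where f: "zigzag A W X p Y" "f = zz_class A W X p Y"
    and g: "zigzag A W Y q Z" "g = zz_class A W Y q Z"
    unfolding localization_Mor using localization_Dom localization_Cod by metis
  obtain r V where h: "zigzag A W Z r V" "h = zz_class A W Z r V"
    using fg g unfolding localization_Mor using localization_Dom localization_Cod by metis
  have "zigzag A W X (p @ q) Z" "zigzag A W Y (q @ r) V" using f g h zigzag_append_iff by blast+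
  then show "h \<cdot>\<^bsub>localization A W\<^esub> (g \<cdot>\<^bsub>localization A W\<^esub> f) = (h \<cdot>\<^bsub>localization A W\<^esub> g) \<cdot>\<^bsub>localization A W\<^esub> f"
    using localization_Comp f g h by simp
qed

end

section \<open>Functors out of the localization\<close>

definition loc_map :: "('o, 'm) cat \<Rightarrow> 'm set \<Rightarrow> 'm \<Rightarrow> ('o \<times> 'm letter list \<times> 'o) set" where
  "loc_map A W f = zz_class A W (Dom A f) [Fwd f] (Cod A f)"

definition loc_inv :: "('o, 'm) cat \<Rightarrow> 'm set \<Rightarrow> 'm \<Rightarrow> ('o \<times> 'm letter list \<times> 'o) set" where
  "loc_inv A W w = zz_class A W (Cod A w) [Bwd w] (Dom A w)"

definition mor_inv :: "('o, 'm) cat \<Rightarrow> 'm \<Rightarrow> 'm" where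
  "mor_inv B f = (SOME g. g \<in> Hom B (Cod B f) (Dom B f) \<and> g \<cdot>\<^bsub>B\<^esub> f = Id B (Dom B f) \<and>
     f \<cdot>\<^bsub>B\<^esub> g = Id B (Cod B f))"

text \<open>The starting object is an argument because the empty zigzag has no letter from which to
  read off its identity.\<close>

primrec zz_eval :: "('o, 'm) cat \<Rightarrow> ('p, 'n) cat \<Rightarrow> ('o \<Rightarrow> 'p) \<Rightarrow> ('m \<Rightarrow> 'n) \<Rightarrow> 'm letter list \<Rightarrow> 'o \<Rightarrow> 'n" where
  "zz_eval A B Fo Fm [] = (\<lambda>X. Id B (Fo X))"
| "zz_eval A B Fo Fm (l # p) = (\<lambda>X. case l of
     Fwd f \<Rightarrow> zz_eval A B Fo Fm p (Cod A f) \<cdot>\<^bsub>B\<^esub> Fm f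
   | Bwd w \<Rightarrow> zz_eval A B Fo Fm p (Dom A w) \<cdot>\<^bsub>B\<^esub> mor_inv B (Fm w))"

text \<open>The functor induced on fractions, evaluated at an arbitrary representative;
  \<open>ev_zigzag_eq\<close> shows that the choice does not matter.\<close>

definition loc_lift ::
  "('o, 'm) cat \<Rightarrow> ('p, 'n) cat \<Rightarrow> ('o \<Rightarrow> 'p) \<Rightarrow> ('m \<Rightarrow> 'n) \<Rightarrow> ('o \<times> 'm letter list \<times> 'o) set \<Rightarrow> 'n" where
  "loc_lift A B Fo Fm \<phi> = (let P = SOME P. P \<in> \<phi> in zz_eval A B Fo Fm (fst (snd P)) (fst P))"

lemma (in category) mor_inv:
  assumes "iso_mor A f" "f \<in> Hom A X Y"
  shows "mor_inv A f \<in> Hom A Y X" "mor_inv A f \<cdot> f = Id A X" "f \<cdot> mor_inv A f = Id A Y"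
proof -
  have d: "Dom A f = X" "Cod A f = Y" using assms(2) by (simp_all add: Hom_def)
  have "\<exists>g. g \<in> Hom A Y X \<and> g \<cdot> f = Id A X \<and> f \<cdot> g = Id A Y"
    using assms iso_mor_iff by blast
  from someI_ex[OF this] show "mor_inv A f \<in> Hom A Y X" "mor_inv A f \<cdot> f = Id A X" "f \<cdot> mor_inv A f = Id A Y"
    unfolding mor_inv_def d by blast+
qed

context category
begin

lemma loc_map_Hom: "f \<in> Hom A X Y \<Longrightarrow> loc_map A W f \<in> Hom (localization A W) X Y"
  unfolding loc_map_def localization_Hom by (auto simp: Hom_def intro!: exI[of _ "[Fwd f]"])

lemma loc_inv_Hom: "\<lbrakk>w \<in> Hom A X Y; w \<in> W\<rbrakk> \<Longrightarrow> loc_inv A W w \<in> Hom (localization A W) Y X"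
  unfolding loc_inv_def localization_Hom by (auto simp: Hom_def intro!: exI[of _ "[Bwd w]"])

lemma loc_map_Id: "X \<in> Obj A \<Longrightarrow> loc_map A W (Id A X) = Id (localization A W) X"
  unfolding loc_map_def localization_Id using zz_class_ruleI[OF zigzag_rule.identity[of X], of W X X] by simp

lemma loc_map_comp:
  assumes "f \<in> Hom A X Y" "g \<in> Hom A Y Z"
  shows "loc_map A W (g \<cdot> f) = loc_map A W g \<cdot>\<^bsub>localization A W\<^esub> loc_map A W f"
proof -
  have f: "f \<in> Mor A" "Dom A f = X" "Cod A f = Y" and g: "g \<in> Mor A" "Dom A g = Y" "Cod A g = Z"
    using assms by (simp_all add: Hom_def)
  have "zz_class A W X [Fwd f, Fwd g] Z = zz_class A W X [Fwd (g \<cdot> f)] Z"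
    by (rule zz_class_ruleI[OF zigzag_rule.composite]) (use f g Hom_Obj[OF assms(2)] in simp_all)
  then show ?thesis
    using localization_Comp[of W X "[Fwd f]" Y "[Fwd g]" Z] f g Hom_Obj[OF assms(1)]
      Hom_Obj[OF assms(2)] by (simp add: loc_map_def)
qed

lemma loc_inv_comp:
  assumes "w \<in> Hom A X Y" "w \<in> W"
  shows "loc_inv A W w \<cdot>\<^bsub>localization A W\<^esub> loc_map A W w = Id (localization A W) X"
    "loc_map A W w \<cdot>\<^bsub>localization A W\<^esub> loc_inv A W w = Id (localization A W) Y"
proof -
  have w: "w \<in> Mor A" "Dom A w = X" "Cod A w = Y" "X \<in> Obj A" "Y \<in> Obj A"
    using assms Hom_Obj[OF assms(1)] by (simp_all add: Hom_def)
  have "zz_class A W X [Fwd w, Bwd w] X = zz_class A W X [] X"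
    by (rule zz_class_ruleI[OF zigzag_rule.left_inverse]) (use w assms(2) in auto)
  moreover have "zz_class A W Y [Bwd w, Fwd w] Y = zz_class A W Y [] Y"
    by (rule zz_class_ruleI[OF zigzag_rule.right_inverse]) (use w assms(2) in auto)
  ultimately show "loc_inv A W w \<cdot>\<^bsub>localization A W\<^esub> loc_map A W w = Id (localization A W) X"
    "loc_map A W w \<cdot>\<^bsub>localization A W\<^esub> loc_inv A W w = Id (localization A W) Y"
    using localization_Comp[of W X "[Fwd w]" Y "[Bwd w]" X] localization_Comp[of W Y "[Bwd w]" X "[Fwd w]" Y]
      w assms(2) by (simp_all add: loc_map_def loc_inv_def localization_Id)
qed

end

locale inverting_functor = category A + B: category B
  for A :: "('o, 'm) cat" (structure) and B :: "('p, 'n) cat" +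
  fixes W :: "'m set" and Fo :: "'o \<Rightarrow> 'p" and Fm :: "'m \<Rightarrow> 'n"
  assumes functor_F: "is_functor A B Fo Fm"
    and inverts: "\<lbrakk>w \<in> Mor A; w \<in> W\<rbrakk> \<Longrightarrow> iso_mor B (Fm w)"
begin

abbreviation "ev \<equiv> zz_eval A B Fo Fm"

lemma F_Obj: "X \<in> Obj A \<Longrightarrow> Fo X \<in> Obj B"
  and F_Id: "X \<in> Obj A \<Longrightarrow> Fm (Id A X) = Id B (Fo X)"
  and F_Hom: "f \<in> Mor A \<Longrightarrow> Fm f \<in> Hom B (Fo (Dom A f)) (Fo (Cod A f))"
  and F_comp: "\<lbrakk>f \<in> Mor A; g \<in> Mor A; Cod A f = Dom A g\<rbrakk> \<Longrightarrow> Fm (g \<cdot> f) = Fm g \<cdot>\<^bsub>B\<^esub> Fm f"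
  using functor_F unfolding is_functor_def by blast+

lemmas F_inv = B.mor_inv[OF inverts F_Hom]

lemma ev_Hom: "zigzag A W X p Y \<Longrightarrow> ev p X \<in> Hom B (Fo X) (Fo Y)"
  by (induction rule: zigzag.induct) (auto intro: B.Id_Hom F_Obj F_Hom F_inv B.comp_Hom)

lemma ev_append: "\<lbrakk>zigzag A W X p Y; zigzag A W Y q Z\<rbrakk> \<Longrightarrow> ev (p @ q) X = ev q Y \<cdot>\<^bsub>B\<^esub> ev p X"
proof (induction rule: zigzag.induct)
  case (empty X)
  then show ?case using B.comp_Id[OF ev_Hom] by simp
next
  case (forward f p Y)
  then show ?case using B.comp_assoc[OF F_Hom ev_Hom ev_Hom] by simp
next
  case (backward w p Y)
  then show ?case using B.comp_assoc[OF F_inv(1) ev_Hom ev_Hom] by simp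
qed

lemma ev_rule:
  assumes "zigzag_rule A W l r" "zigzag A W X l Y"
  shows "ev l X = ev r X"
  using assms
proof (cases rule: zigzag_rule.cases)
  case (identity Z)
  then show ?thesis using assms B.comp_Id[OF B.Id_Hom] F_Obj F_Id by auto
next
  case (composite f g)
  then have "Fm f \<in> Hom B (Fo (Dom A f)) (Fo (Dom A g))" using F_Hom[of f] by simp
  from B.comp_assoc[OF this F_Hom B.Id_Hom] composite show ?thesis
    using F_Obj F_comp by auto
next
  case (left_inverse w)
  then show ?thesis using assms B.comp_Id[OF F_inv(1)] F_inv by auto
next
  case (right_inverse w)
  then show ?thesis using assms B.comp_Id[OF F_Hom] F_inv by auto
qed

lemma ev_zigzag_eq: "zigzag_eq A W P Q \<Longrightarrow> ev (fst (snd P)) (fst P) = ev (fst (snd Q)) (fst Q)"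
proof (induction rule: zigzag_eq.induct)
  case (step l r X u v Y)
  obtain Z Z' where Z: "zigzag A W X u Z" "zigzag A W Z l Z'" "zigzag A W Z' v Y"
    using step(2) unfolding zigzag_append_iff by blast
  obtain V V' where V: "zigzag A W X u V" "zigzag A W V r V'" "zigzag A W V' v Y"
    using step(3) unfolding zigzag_append_iff by blast
  \<comment> \<open>The two zigzags are split separately, so the intermediate objects have to be
    identified: on the left by the common prefix, on the right because a rule preserves
    endpoints.\<close>
  have VZ: "V = Z" "V' = Z'"
    using zigzag_unique[OF V(1) Z(1)] zigzag_rule_ends[OF step(1) Z(2)] V(2) by auto
  have "zigzag A W Z (l @ v) Y" "zigzag A W Z (r @ v) Y"
    using Z V VZ unfolding zigzag_append_iff by blast+
  then show ?case
    using ev_append[OF Z(1)] ev_append[OF Z(2,3)] ev_append[OF V(2,3)] ev_rule[OF step(1) Z(2)] VZ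
    by simp
qed auto

abbreviation "lift \<equiv> loc_lift A B Fo Fm"

lemma lift_class:
  assumes "zigzag A W X p Y"
  shows "lift (zz_class A W X p Y) = ev p X"
proof -
  have "(SOME P. P \<in> zz_class A W X p Y) \<in> zz_class A W X p Y"
    using someI[of "\<lambda>P. P \<in> zz_class A W X p Y"] zz_class_self[OF assms] by blast
  then show ?thesis
    unfolding loc_lift_def Let_def using ev_zigzag_eq[of "(X, p, Y)"] by (simp add: zz_class_mem)
qed

lemma lift_functor: "is_functor (localization A W) B Fo lift"
  unfolding is_functor_def
proof (intro conjI ballI impI)
  fix X assume "X \<in> Obj (localization A W)"
  then have X: "X \<in> Obj A" by simp
  show "Fo X \<in> Obj B" using F_Obj X .
  show "lift (Id (localization A W) X) = Id B (Fo X)"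
    using lift_class[of X "[]" X] X by (simp add: localization_Id)
next
  fix f assume "f \<in> Mor (localization A W)"
  then obtain X p Y where f: "zigzag A W X p Y" "f = zz_class A W X p Y" unfolding localization_Mor by blast
  then show "lift f \<in> Hom B (Fo (Dom (localization A W) f)) (Fo (Cod (localization A W) f))"
    using ev_Hom lift_class localization_Dom localization_Cod by simp
next
  fix f g assume fg: "f \<in> Mor (localization A W)" "g \<in> Mor (localization A W)"
    "Cod (localization A W) f = Dom (localization A W) g"
  then obtain X p Y q Z where f: "zigzag A W X p Y" "f = zz_class A W X p Y"
    and g: "zigzag A W Y q Z" "g = zz_class A W Y q Z"
    unfolding localization_Mor using localization_Dom localization_Cod by metis
  have "zigzag A W X (p @ q) Z" using f g zigzag_append_iff by blast
  then show "lift (g \<cdot>\<^bsub>localization A W\<^esub> f) = lift g \<cdot>\<^bsub>B\<^esub> lift f"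
    using f g localization_Comp lift_class ev_append by simp
qed

lemma lift_loc_map: "f \<in> Hom A X Y \<Longrightarrow> lift (loc_map A W f) = Fm f"
  using lift_class[of X "[Fwd f]" Y] F_Hom[of f] B.comp_Id(2)[of "Fm f"] F_Obj
  by (auto simp: loc_map_def Hom_def)

end

section \<open>Transport of abelian structures\<close>

text \<open>Surjectivity on objects is strict rather than up to isomorphism, so objects and
  morphisms of \<open>B\<close> are lifted without conjugating by chosen isomorphisms.\<close>

locale fully_faithful = category A + B: category B
  for A :: "('o, 'm) cat" (structure) and B :: "('p, 'n) cat" +
  fixes Fo :: "'o \<Rightarrow> 'p" and Fm :: "'m \<Rightarrow> 'n"
  assumes functor_F: "is_functor A B Fo Fm"
    and bij: "\<lbrakk>X \<in> Obj A; Y \<in> Obj A\<rbrakk> \<Longrightarrow> bij_betw Fm (Hom A X Y) (Hom B (Fo X) (Fo Y))"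
    and surj: "Z \<in> Obj B \<Longrightarrow> \<exists>X\<in>Obj A. Fo X = Z"
begin

lemma F_Obj: "X \<in> Obj A \<Longrightarrow> Fo X \<in> Obj B"
  and F_Id: "X \<in> Obj A \<Longrightarrow> Fm (Id A X) = Id B (Fo X)"
  using functor_F unfolding is_functor_def by blast+

lemma F_Hom: "f \<in> Hom A X Y \<Longrightarrow> Fm f \<in> Hom B (Fo X) (Fo Y)"
  and F_comp: "\<lbrakk>f \<in> Hom A X Y; g \<in> Hom A Y Z\<rbrakk> \<Longrightarrow> Fm (g \<cdot> f) = Fm g \<cdot>\<^bsub>B\<^esub> Fm f"
  using functor_F unfolding is_functor_def by (auto simp: Hom_def)

lemma F_inj: "\<lbrakk>f \<in> Hom A X Y; g \<in> Hom A X Y; Fm f = Fm g\<rbrakk> \<Longrightarrow> f = g"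
  using bij[of X Y] Hom_Obj[of f X Y] unfolding bij_betw_def inj_on_def by blast

lemma F_full: "\<lbrakk>X \<in> Obj A; Y \<in> Obj A; g \<in> Hom B (Fo X) (Fo Y)\<rbrakk> \<Longrightarrow> \<exists>f\<in>Hom A X Y. Fm f = g"
  using bij_betw_imp_surj_on[OF bij, of X Y] by (metis imageE)

lemma fully_faithful_opc: "fully_faithful (opc A) (opc B) Fo Fm"
  using category_opc B.category_opc functor_F bij surj
  by (simp add: fully_faithful_def fully_faithful_axioms_def is_functor_def)

end

text \<open>Kernels and monomorphisms are expressed through zero morphisms, so compatibility with
  \<open>zero\<close> is what reflecting them from \<open>B\<close> to \<open>A\<close> asks of the
  functor.\<close>

locale additive_fully_faithful =
  additive_category A add zero + B: additive_category B add' zero' + fully_faithful A B Fo Fm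
  for A :: "('o, 'm) cat" (structure) and add zero and B :: "('p, 'n) cat" and add' zero' Fo Fm +
  assumes F_zero: "\<lbrakk>X \<in> Obj A; Y \<in> Obj A\<rbrakk> \<Longrightarrow> Fm (zero X Y) = zero' (Fo X) (Fo Y)"
begin

lemma additive_fully_faithful_opc:
  "additive_fully_faithful (opc A) add (\<lambda>X Y. zero Y X) (opc B) add' (\<lambda>X Y. zero' Y X) Fo Fm"
  using additive_category_opc B.additive_category_opc fully_faithful_opc F_zero
  by (simp add: additive_fully_faithful_def additive_fully_faithful_axioms_def)

lemma F_zero_iff: "f \<in> Hom A X Y \<Longrightarrow> Fm f = zero' (Fo X) (Fo Y) \<longleftrightarrow> f = zero X Y"
  using F_inj[of f X Y "zero X Y"] F_zero zero_Hom Hom_Obj[of f X Y] by metis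

lemma monic_F_iff:
  assumes f: "f \<in> Hom A X Y"
  shows "monic B (Fm f) \<longleftrightarrow> monic A f"
proof
  assume m: "monic B (Fm f)"
  show "monic A f"
  proof (rule monicI_null[OF f])
    fix T u assume u: "u \<in> Hom A T X" "f \<cdot> u = zero T Y"
    then have "Fm f \<cdot>\<^bsub>B\<^esub> Fm u = zero' (Fo T) (Fo Y)"
      using F_comp[OF u(1) f] F_zero Hom_Obj[OF u(1)] Hom_Obj[OF f] by simp
    then show "u = zero T X" using B.monic_null[OF m F_Hom[OF f] F_Hom[OF u(1)]] F_zero_iff u(1) by blast
  qed
next
  assume m: "monic A f"
  show "monic B (Fm f)"
  proof (rule B.monicI_null[OF F_Hom[OF f]])
    fix T u assume u: "u \<in> Hom B T (Fo X)" "Fm f \<cdot>\<^bsub>B\<^esub> u = zero' T (Fo Y)"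
    obtain T' where T: "T' \<in> Obj A" "Fo T' = T" using surj B.Hom_Obj[OF u(1)] by blast
    then obtain u' where u': "u' \<in> Hom A T' X" "Fm u' = u" using F_full u(1) Hom_Obj[OF f] by blast
    then have "f \<cdot> u' = zero T' Y"
      using F_zero_iff[OF comp_Hom[OF u'(1) f]] F_comp[OF u'(1) f] u(2) T by simp
    then have "u' = zero T' X" using monic_null[OF m f u'(1)] by simp
    then show "u = zero' T (Fo X)" using F_zero_iff[OF u'(1)] u'(2) T by simp
  qed
qed

lemma is_kernel_F:
  assumes f: "f \<in> Hom A X Y" and k: "k \<in> Hom A K X" and ker: "is_kernel B (Fm f) (Fm k)"
  shows "is_kernel A f k"
proof (rule is_kernelI[OF f k])
  note ker' = B.is_kernelD[OF ker F_Hom[OF f]]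
  show "f \<cdot> k = zero K Y"
    using ker'(2)[OF F_Hom[OF k]] F_zero_iff[OF comp_Hom[OF k f]] F_comp[OF k f] by simp
  show "monic A k" using ker'(4) monic_F_iff[OF k] by blast
  fix T g assume g: "g \<in> Hom A T X" "f \<cdot> g = zero T Y"
  then have "Fm f \<cdot>\<^bsub>B\<^esub> Fm g = zero' (Fo T) (Fo Y)"
    using F_comp[OF g(1) f] F_zero Hom_Obj[OF g(1)] Hom_Obj[OF f] by simp
  then obtain u where u: "u \<in> Hom B (Fo T) (Fo K)" "Fm k \<cdot>\<^bsub>B\<^esub> u = Fm g"
    using ker'(3)[OF F_Hom[OF k] F_Hom[OF g(1)]] by blast
  then obtain u' where u': "u' \<in> Hom A T K" "Fm u' = u"
    using F_full Hom_Obj[OF g(1)] Hom_Obj[OF k] by blast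
  then have "k \<cdot> u' = g" using F_inj[OF comp_Hom[OF u'(1) k] g(1)] F_comp[OF u'(1) k] u(2) by simp
  then show "\<exists>u\<in>Hom A T K. k \<cdot> u = g" using u' by blast
qed

lemma ex_kernel_F:
  assumes ker: "\<And>g. g \<in> Mor B \<Longrightarrow> \<exists>k. is_kernel B g k" and f: "f \<in> Mor A"
  shows "\<exists>k. is_kernel A f k"
proof -
  have fH: "f \<in> Hom A (Dom A f) (Cod A f)" using f by (rule Mor_Hom)
  note FH = F_Hom[OF fH]
  obtain k where k: "is_kernel B (Fm f) k" using ker B.Hom_Mor[OF FH] by blast
  obtain K where K: "K \<in> Obj B" "k \<in> Hom B K (Fo (Dom A f))" using B.is_kernelD(1)[OF k FH] by blast
  obtain K' where K': "K' \<in> Obj A" "Fo K' = K" using surj K by blast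
  obtain k' where "k' \<in> Hom A K' (Dom A f)" "Fm k' = k" using F_full K K' Hom_Obj[OF fH] by blast
  then show ?thesis using is_kernel_F[OF fH] k by blast
qed

lemma monic_is_kernel_F:
  assumes ker: "\<And>g. monic B g \<Longrightarrow> \<exists>h. is_kernel B h g" and f: "monic A f"
  shows "\<exists>h. is_kernel A h f"
proof -
  have fH: "f \<in> Hom A (Dom A f) (Cod A f)" using f by (simp add: monic_def Mor_Hom)
  obtain h where h: "is_kernel B h (Fm f)" using ker monic_F_iff[OF fH] f by blast
  then have "h \<in> Hom B (Fo (Cod A f)) (Cod B h)"
    using F_Hom[OF fH] unfolding is_kernel_def by (auto simp: Hom_def)
  moreover from this obtain Z where Z: "Z \<in> Obj A" "Fo Z = Cod B h" using surj B.Hom_Obj by metis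
  ultimately obtain h' where "h' \<in> Hom A (Cod A f) Z" "Fm h' = h" using F_full Hom_Obj[OF fH] by metis
  then show ?thesis using is_kernel_F[OF _ fH] h by blast
qed

lemma abelian_F:
  assumes "abelian B add' zero'"
  shows "abelian A add zero"
proof -
  interpret B': abelian B add' zero' by fact
  interpret D: additive_fully_faithful "opc A" add "\<lambda>X Y. zero Y X" "opc B" add' "\<lambda>X Y. zero' Y X" Fo Fm
    by (rule additive_fully_faithful_opc)
  show ?thesis
  proof (intro abelian.intro additive_category_axioms abelian_axioms.intro)
    show "\<exists>k. is_kernel A f k" if "f \<in> Mor A" for f
      using ex_kernel_F[OF B'.ex_kernel that] .
    show "\<exists>k. is_cokernel A f k" if "f \<in> Mor A" for f
      using D.ex_kernel_F[of f] B'.ex_cokernel that by simp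
    show "\<exists>g. is_kernel A g f" if "monic A f" for f
      using monic_is_kernel_F[OF B'.monic_is_kernel that] .
    show "\<exists>g. is_cokernel A g f" if "epic A f" for f
      using D.monic_is_kernel_F[of f] B'.epic_is_cokernel that by simp
  qed
qed

end

text \<open>The hom-groups are pulled back along the bijections \<open>Fm\<close>; each law is
  checked after applying \<open>Fm\<close> and reflected by injectivity. Biproducts and (co)kernels
  are lifted from \<open>B\<close>.\<close>

theorem (in fully_faithful) transport_abelian:
  assumes "abelian B add' zero'"
  shows "\<exists>add zero. abelian A add zero"
proof -
  interpret B': abelian B add' zero' by fact
  \<comment> \<open>The endpoints are taken from the first summand, since one binary operation has
    to serve every hom-set.\<close>
  define plus where "plus = (\<lambda>f g. inv_into (Hom A (Dom A f) (Cod A f)) Fm (add' (Fm f) (Fm g)))"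
  define zer where "zer = (\<lambda>X Y. inv_into (Hom A X Y) Fm (zero' (Fo X) (Fo Y)))"
  have preimage: "inv_into (Hom A X Y) Fm g \<in> Hom A X Y" "Fm (inv_into (Hom A X Y) Fm g) = g"
    if "X \<in> Obj A" "Y \<in> Obj A" "g \<in> Hom B (Fo X) (Fo Y)" for X Y g
  proof -
    have "g \<in> Fm ` Hom A X Y" using F_full[OF that] by blast
    then show "inv_into (Hom A X Y) Fm g \<in> Hom A X Y" "Fm (inv_into (Hom A X Y) Fm g) = g"
      by (rule inv_into_into, rule f_inv_into_f)
  qed
  have plus: "plus f g \<in> Hom A X Y" "Fm (plus f g) = add' (Fm f) (Fm g)"
    if "f \<in> Hom A X Y" "g \<in> Hom A X Y" for f g X Y
  proof -
    have "Dom A f = X" "Cod A f = Y" using that by (simp_all add: Hom_def)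
    then show "plus f g \<in> Hom A X Y" "Fm (plus f g) = add' (Fm f) (Fm g)"
      using preimage[OF Hom_Obj[OF that(1)] B'.add_Hom[OF F_Hom[OF that(1)] F_Hom[OF that(2)]]]
      unfolding plus_def by simp_all
  qed
  have zer: "zer X Y \<in> Hom A X Y" "Fm (zer X Y) = zero' (Fo X) (Fo Y)"
    if "X \<in> Obj A" "Y \<in> Obj A" for X Y
    using preimage[OF that B'.zero_Hom] F_Obj that unfolding zer_def by simp_all
  interpret P: preadditive_category A plus zer
  proof (intro preadditive_category.intro category_axioms preadditive_category_axioms.intro)
    fix X Y assume X: "X \<in> Obj A" and Y: "Y \<in> Obj A"
    interpret G: comm_group "B'.homgrp (Fo X) (Fo Y)"
      using B'.hom_group F_Obj X Y by blast
    show "comm_group \<lparr>carrier = Hom A X Y, monoid.mult = plus, one = zer X Y\<rparr>"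
    proof (rule comm_groupI; simp)
      fix f assume f: "f \<in> Hom A X Y"
      obtain g where g: "g \<in> Hom A X Y" "Fm g = B'.neg (Fo X) (Fo Y) (Fm f)"
        using F_full[OF X Y B'.neg_Hom[OF F_Hom[OF f]]] by blast
      have "Fm (plus g f) = Fm (zer X Y)"
        using plus[OF g(1) f] g(2) zer[OF X Y] B'.add_neg[OF F_Hom[OF f]]
          G.m_comm[of "Fm f" "Fm g"] F_Hom[OF f] F_Hom[OF g(1)] by simp
      then show "\<exists>g\<in>Hom A X Y. plus g f = zer X Y"
        using F_inj[OF plus(1)[OF g(1) f] zer(1)[OF X Y]] g(1) by blast
      show "plus (zer X Y) f = f"
        using F_inj[OF plus(1)[OF zer(1)[OF X Y] f] f] plus(2)[OF zer(1)[OF X Y] f] zer(2)[OF X Y]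
          B'.add_zero[OF F_Hom[OF f]] by simp
    next
      fix f g assume fg: "f \<in> Hom A X Y" "g \<in> Hom A X Y"
      show "plus f g \<in> Hom A X Y" using plus(1)[OF fg] .
      show "plus f g = plus g f"
        using F_inj[OF plus(1)[OF fg] plus(1)[OF fg(2,1)]] plus(2)[OF fg] plus(2)[OF fg(2,1)]
          G.m_comm[of "Fm f" "Fm g"] F_Hom[OF fg(1)] F_Hom[OF fg(2)] by simp
      fix h assume h: "h \<in> Hom A X Y"
      have gh: "plus g h \<in> Hom A X Y" and fg': "plus f g \<in> Hom A X Y" using plus(1) fg h by blast+
      show "plus (plus f g) h = plus f (plus g h)"
        using F_inj[OF plus(1)[OF fg' h] plus(1)[OF fg(1) gh]] plus(2)[OF fg' h] plus(2)[OF fg(1) gh]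
          plus(2)[OF fg] plus(2)[OF fg(2) h] G.m_assoc[of "Fm f" "Fm g" "Fm h"]
          F_Hom[OF fg(1)] F_Hom[OF fg(2)] F_Hom[OF h] by simp
    qed (use zer X Y in simp)
  next
    fix X Y Z f f' g assume XYZ: "X \<in> Obj A" "Y \<in> Obj A" "Z \<in> Obj A"
      and f: "f \<in> Hom A X Y" "f' \<in> Hom A X Y" "g \<in> Hom A Y Z"
    note c = comp_Hom[OF f(1,3)] comp_Hom[OF f(2,3)]
    have "Fm (g \<cdot> plus f f') = Fm (plus (g \<cdot> f) (g \<cdot> f'))"
      using F_comp[OF plus(1)[OF f(1,2)] f(3)] plus(2)[OF f(1,2)] plus(2)[OF c] F_comp[OF f(1,3)]
        F_comp[OF f(2,3)] B'.Comp_add_right[OF F_Obj F_Obj F_Obj F_Hom F_Hom F_Hom, OF XYZ f] by simp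
    then show "g \<cdot> plus f f' = plus (g \<cdot> f) (g \<cdot> f')"
      using F_inj[OF comp_Hom[OF plus(1)[OF f(1,2)] f(3)] plus(1)[OF c]] by blast
  next
    fix X Y Z f g g' assume XYZ: "X \<in> Obj A" "Y \<in> Obj A" "Z \<in> Obj A"
      and f: "f \<in> Hom A X Y" "g \<in> Hom A Y Z" "g' \<in> Hom A Y Z"
    note c = comp_Hom[OF f(1,2)] comp_Hom[OF f(1,3)]
    have "Fm (plus g g' \<cdot> f) = Fm (plus (g \<cdot> f) (g' \<cdot> f))"
      using F_comp[OF f(1) plus(1)[OF f(2,3)]] plus(2)[OF f(2,3)] plus(2)[OF c] F_comp[OF f(1,2)]
        F_comp[OF f(1,3)] B'.Comp_add_left[OF F_Obj F_Obj F_Obj F_Hom F_Hom F_Hom, OF XYZ f] by simp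
    then show "plus g g' \<cdot> f = plus (g \<cdot> f) (g' \<cdot> f)"
      using F_inj[OF comp_Hom[OF f(1) plus(1)[OF f(2,3)]] plus(1)[OF c]] by blast
  qed
  interpret Q: additive_category A plus zer
  proof (intro additive_category.intro P.preadditive_category_axioms additive_category_axioms.intro)
    obtain Z' where Z': "zero_object B Z'" using B'.ex_zero_object by blast
    then obtain Z where Z: "Z \<in> Obj A" "Fo Z = Z'" using surj B'.zero_object_Obj by blast
    then have "Fm (Id A Z) = Fm (zer Z Z)" using F_Id zer Z' B'.zero_object_iff by simp
    then show "\<exists>Z. zero_object A Z"
      using F_inj[OF Id_Hom zer(1)] Z P.zero_objectI by blast
    fix X Y assume XY: "X \<in> Obj A" "Y \<in> Obj A"
    obtain S' i' j' p' q' where S': "S' \<in> Obj B" "i' \<in> Hom B (Fo X) S'" "j' \<in> Hom B (Fo Y) S'"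
      "p' \<in> Hom B S' (Fo X)" "q' \<in> Hom B S' (Fo Y)"
      and e: "p' \<cdot>\<^bsub>B\<^esub> i' = Id B (Fo X)" "q' \<cdot>\<^bsub>B\<^esub> j' = Id B (Fo Y)" "p' \<cdot>\<^bsub>B\<^esub> j' = zero' (Fo Y) (Fo X)"
      "q' \<cdot>\<^bsub>B\<^esub> i' = zero' (Fo X) (Fo Y)" "add' (i' \<cdot>\<^bsub>B\<^esub> p') (j' \<cdot>\<^bsub>B\<^esub> q') = Id B S'"
      using B'.ex_biproduct[OF F_Obj F_Obj, OF XY] unfolding has_biproduct_def by blast
    obtain S where S: "S \<in> Obj A" "Fo S = S'" using surj S' by blast
    obtain i where i: "i \<in> Hom A X S" "Fm i = i'" using F_full S S' XY by blast
    obtain j where j: "j \<in> Hom A Y S" "Fm j = j'" using F_full S S' XY by blast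
    obtain p where p: "p \<in> Hom A S X" "Fm p = p'" using F_full S S' XY by blast
    obtain q where q: "q \<in> Hom A S Y" "Fm q = q'" using F_full S S' XY by blast
    note c = comp_Hom[OF p(1) i(1)] comp_Hom[OF q(1) j(1)]
    have "p \<cdot> i = Id A X"
      using F_inj[OF comp_Hom[OF i(1) p(1)] Id_Hom[OF XY(1)]] F_comp[OF i(1) p(1)] F_Id XY e i p by simp
    moreover have "q \<cdot> j = Id A Y"
      using F_inj[OF comp_Hom[OF j(1) q(1)] Id_Hom[OF XY(2)]] F_comp[OF j(1) q(1)] F_Id XY e j q by simp
    moreover have "p \<cdot> j = zer Y X"
      using F_inj[OF comp_Hom[OF j(1) p(1)] zer(1)] F_comp[OF j(1) p(1)] zer XY e j p by simp
    moreover have "q \<cdot> i = zer X Y"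
      using F_inj[OF comp_Hom[OF i(1) q(1)] zer(1)] F_comp[OF i(1) q(1)] zer XY e i q by simp
    moreover have "plus (i \<cdot> p) (j \<cdot> q) = Id A S"
      using F_inj[OF plus(1)[OF c] Id_Hom[OF S(1)]] plus(2)[OF c] F_comp[OF p(1) i(1)]
        F_comp[OF q(1) j(1)] F_Id S e i j p q by simp
    ultimately show "has_biproduct A plus zer X Y"
      unfolding has_biproduct_def using S i j p q by blast
  qed
  interpret additive_fully_faithful A plus zer B add' zero' Fo Fm
    by unfold_locales (use zer in simp)
  show ?thesis using abelian_F[OF assms] by blast
qed

section \<open>The homotopy category\<close>

context ttf
begin

abbreviation "Wq \<equiv> Ker_in A W \<inter> Coker_in A W"

text \<open>
  The maps \<open>X \<leftarrow> D \<rightarrow> L\<close> present \<open>L\<close> as the part of \<open>X\<close> in \<open>C \<inter> F\<close>: first the \<open>C\<close>-torsion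
  part \<open>D\<close> of \<open>X\<close>, then the torsion-free quotient of \<open>D\<close> for \<open>(W, F)\<close>.
\<close>

definition is_core where
  "is_core X D m L e \<longleftrightarrow> D \<in> C \<and> L \<in> C \<inter> F \<and> m \<in> Hom A D X \<and> e \<in> Hom A D L \<and> weq m \<and> weq e \<and>
     (\<forall>T\<in>C. \<forall>g\<in>Hom A T X. \<exists>!u. u \<in> Hom A T D \<and> m \<cdot> u = g) \<and>
     (\<forall>G\<in>F. \<forall>g\<in>Hom A D G. \<exists>!u. u \<in> Hom A L G \<and> u \<cdot> e = g)"

text \<open>The cokernel of \<open>m\<close> and the kernel of \<open>e\<close> lie in
  \<open>W\<close>, so both are weak equivalences. The two universal properties restate that
  morphisms from \<open>C\<close> to \<open>W\<close> and from \<open>W\<close> to \<open>F\<close>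
  vanish.\<close>

lemma ex_core:
  assumes X: "X \<in> Obj A"
  shows "\<exists>D m L e. is_core X D m L e"
proof -
  obtain D V m r where m: "D \<in> C" "V \<in> W" "m \<in> Hom A D X" "r \<in> Hom A X V" "is_kernel A r m"
    "is_cokernel A m r" using torsion_seq[OF CW X] .
  have D: "D \<in> Obj A" using Hom_Obj[OF m(3)] by simp
  obtain V' L j e where e: "V' \<in> W" "L \<in> F" "j \<in> Hom A V' D" "e \<in> Hom A D L" "is_kernel A e j"
    "is_cokernel A j e" using torsion_seq[OF WF D] .
  have mm: "monic A m" and ee: "epic A e" using is_kernelD(4)[OF m(5,4)] is_cokernelD(4)[OF e(6,3)] .
  have "L \<in> C" using torsion_quotient[OF CW e(4) ee m(1)] .
  moreover have "weq m"
    unfolding weq_def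
  proof
    show "null_monic A zero C m" using monic_null_monic[OF mm] .
    show "null_epic A zero F m"
    proof (rule null_epicI[OF m(3)])
      fix G u assume u: "G \<in> F" "u \<in> Hom A X G" "u \<cdot> m = zero D G"
      then obtain u' where u': "u' \<in> Hom A V G" "u' \<cdot> r = u" using is_cokernelD(3)[OF m(6,3,4)] by blast
      have "u' = zero V G" using torsion_null[OF WF m(2) u(1) u'(1)] .
      then show "u = zero X G" using u'(2) comp_zero(2)[OF m(4)] Hom_Obj[OF u(2)] by simp
    qed
  qed
  moreover have "weq e"
    unfolding weq_def
  proof
    show "null_epic A zero F e" using epic_null_epic[OF ee] .
    show "null_monic A zero C e"
    proof (rule null_monicI[OF e(4)])
      fix T u assume u: "T \<in> C" "u \<in> Hom A T D" "e \<cdot> u = zero T L"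
      then obtain u' where u': "u' \<in> Hom A T V'" "j \<cdot> u' = u" using is_kernelD(3)[OF e(5,4,3)] by blast
      have "u' = zero T V'" using torsion_null[OF CW u(1) e(1) u'(1)] .
      then show "u = zero T D" using u'(2) comp_zero(1)[OF e(3)] Hom_Obj[OF u(2)] by simp
    qed
  qed
  moreover have "\<exists>!u. u \<in> Hom A T D \<and> m \<cdot> u = g" if T: "T \<in> C" and g: "g \<in> Hom A T X" for T g
  proof -
    have "r \<cdot> g = zero T V" using torsion_null[OF CW T m(2) comp_Hom[OF g m(4)]] .
    then have "\<exists>u\<in>Hom A T D. m \<cdot> u = g" using is_kernelD(3)[OF m(5,4,3) g] by blast
    then show ?thesis using monicD[OF mm m(3)] by metis
  qed
  moreover have "\<exists>!u. u \<in> Hom A L G \<and> u \<cdot> e = g" if G: "G \<in> F" and g: "g \<in> Hom A D G" for G g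
  proof -
    have "g \<cdot> j = zero V' G" using torsion_null[OF WF e(1) G comp_Hom[OF e(3) g]] .
    then have "\<exists>u\<in>Hom A L G. u \<cdot> e = g" using is_cokernelD(3)[OF e(6,3,4) g] by blast
    then show ?thesis using epicD[OF ee e(4)] by metis
  qed
  ultimately have "is_core X D m L e" unfolding is_core_def using m(1,3) e(2,4) by blast
  then show ?thesis by blast
qed

lemma Id_core:
  assumes X: "X \<in> C \<inter> F"
  shows "is_core X X (Id A X) X (Id A X)"
proof -
  have XO: "X \<in> Obj A" using X CF_Obj by blast
  have "iso_mor A (Id A X)" using iso_mor_Id[OF XO] .
  then have "weq (Id A X)"
    unfolding weq_def using monic_null_monic iso_mor_monic epic_null_epic iso_mor_epic by blast
  moreover have "\<exists>!u. u \<in> Hom A T X \<and> Id A X \<cdot> u = g" if "g \<in> Hom A T X" for T g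
    using that comp_Id(2) by metis
  moreover have "\<exists>!u. u \<in> Hom A X G \<and> u \<cdot> Id A X = g" if "g \<in> Hom A X G" for G g
    using that comp_Id(1) by metis
  ultimately show ?thesis
    unfolding is_core_def using X Id_Hom[OF XO] by blast
qed

text \<open>Taking the identities as core of the objects of \<open>C \<inter> F\<close> makes \<open>cL\<close> the identity there.\<close>

definition core where
  "core X = (SOME q. (case q of (D, m, L, e) \<Rightarrow> is_core X D m L e) \<and>
     (X \<in> C \<inter> F \<longrightarrow> q = (X, Id A X, X, Id A X)))"

section \<open>Functoriality of the core\<close>

definition "cD X = fst (core X)"
definition "cm X = fst (snd (core X))"
definition "cL X = fst (snd (snd (core X)))"
definition "ce X = snd (snd (snd (core X)))"

lemma core:
  assumes X: "X \<in> Obj A"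
  shows "is_core X (cD X) (cm X) (cL X) (ce X)"
    "X \<in> C \<inter> F \<Longrightarrow> cD X = X \<and> cm X = Id A X \<and> cL X = X \<and> ce X = Id A X"
proof -
  have "\<exists>q. (case q of (D, m, L, e) \<Rightarrow> is_core X D m L e) \<and> (X \<in> C \<inter> F \<longrightarrow> q = (X, Id A X, X, Id A X))"
    using ex_core[OF X] Id_core[of X] by (cases "X \<in> C \<inter> F") auto
  from someI_ex[OF this] show "is_core X (cD X) (cm X) (cL X) (ce X)"
    "X \<in> C \<inter> F \<Longrightarrow> cD X = X \<and> cm X = Id A X \<and> cL X = X \<and> ce X = Id A X"
    unfolding core_def[symmetric] cD_def cm_def cL_def ce_def by (auto split: prod.splits)
qed

lemma core_simps:
  assumes X: "X \<in> Obj A"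
  shows "cD X \<in> C" "cL X \<in> C \<inter> F" "cm X \<in> Hom A (cD X) X" "ce X \<in> Hom A (cD X) (cL X)"
    "weq (cm X)" "weq (ce X)" "cm X \<in> Wq" "ce X \<in> Wq"
  using core(1)[OF X] Weq_iff unfolding is_core_def by blast+

lemma core_lift:
  assumes X: "X \<in> Obj A"
  shows "\<lbrakk>T \<in> C; g \<in> Hom A T X\<rbrakk> \<Longrightarrow> \<exists>u\<in>Hom A T (cD X). cm X \<cdot> u = g"
    "\<lbrakk>T \<in> C; u \<in> Hom A T (cD X); v \<in> Hom A T (cD X); cm X \<cdot> u = cm X \<cdot> v\<rbrakk> \<Longrightarrow> u = v"
    "\<lbrakk>G \<in> F; h \<in> Hom A (cD X) G\<rbrakk> \<Longrightarrow> \<exists>u\<in>Hom A (cL X) G. u \<cdot> ce X = h"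
    "\<lbrakk>G \<in> F; w \<in> Hom A (cL X) G; x \<in> Hom A (cL X) G; w \<cdot> ce X = x \<cdot> ce X\<rbrakk> \<Longrightarrow> w = x"
proof -
  have 1: "\<forall>T\<in>C. \<forall>g\<in>Hom A T X. \<exists>!u. u \<in> Hom A T (cD X) \<and> cm X \<cdot> u = g"
    and 2: "\<forall>G\<in>F. \<forall>g\<in>Hom A (cD X) G. \<exists>!u. u \<in> Hom A (cL X) G \<and> u \<cdot> ce X = g"
    using core(1)[OF X] unfolding is_core_def by blast+
  show "\<exists>u\<in>Hom A T (cD X). cm X \<cdot> u = g" if "T \<in> C" "g \<in> Hom A T X"
    using 1[rule_format, OF that] by blast
  show "u = v" if "T \<in> C" "u \<in> Hom A T (cD X)" "v \<in> Hom A T (cD X)" "cm X \<cdot> u = cm X \<cdot> v"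
    using 1[rule_format, OF that(1) comp_Hom[OF that(2) core_simps(3)[OF X]]] that by metis
  show "\<exists>u\<in>Hom A (cL X) G. u \<cdot> ce X = h" if "G \<in> F" "h \<in> Hom A (cD X) G"
    using 2[rule_format, OF that] by blast
  show "w = x" if "G \<in> F" "w \<in> Hom A (cL X) G" "x \<in> Hom A (cL X) G" "w \<cdot> ce X = x \<cdot> ce X"
    using 2[rule_format, OF that(1) comp_Hom[OF core_simps(4)[OF X] that(2)]] that by metis
qed

text \<open>Keeping the morphism \<open>f'\<close> between the \<open>C\<close>-parts explicit
  reduces functoriality of \<open>cF\<close> to pasting squares.\<close>

definition core_square where
  "core_square f f' g \<longleftrightarrow> f' \<in> Hom A (cD (Dom A f)) (cD (Cod A f)) \<and>
     g \<in> Hom A (cL (Dom A f)) (cL (Cod A f)) \<and> cm (Cod A f) \<cdot> f' = f \<cdot> cm (Dom A f) \<and>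
     g \<cdot> ce (Dom A f) = ce (Cod A f) \<cdot> f'"

definition "cF f = (THE g. \<exists>f'. core_square f f' g)"

lemma core_squareI:
  "\<lbrakk>f \<in> Hom A X Y; f' \<in> Hom A (cD X) (cD Y); g \<in> Hom A (cL X) (cL Y); cm Y \<cdot> f' = f \<cdot> cm X;
    g \<cdot> ce X = ce Y \<cdot> f'\<rbrakk> \<Longrightarrow> core_square f f' g"
  unfolding core_square_def by (auto simp: Hom_def)

lemma core_squareD:
  assumes "core_square f f' g" "f \<in> Hom A X Y"
  shows "f' \<in> Hom A (cD X) (cD Y)" "g \<in> Hom A (cL X) (cL Y)" "cm Y \<cdot> f' = f \<cdot> cm X"
    "g \<cdot> ce X = ce Y \<cdot> f'"
  using assms unfolding core_square_def by (auto simp: Hom_def)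

lemma ex_core_square:
  assumes f: "f \<in> Hom A X Y"
  shows "\<exists>f' g. core_square f f' g"
proof -
  have O: "X \<in> Obj A" "Y \<in> Obj A" using Hom_Obj[OF f] .
  note x = core_simps[OF O(1)] and y = core_simps[OF O(2)]
  obtain f' where f': "f' \<in> Hom A (cD X) (cD Y)" "cm Y \<cdot> f' = f \<cdot> cm X"
    using core_lift(1)[OF O(2) x(1) comp_Hom[OF x(3) f]] by blast
  obtain g where "g \<in> Hom A (cL X) (cL Y)" "g \<cdot> ce X = ce Y \<cdot> f'"
    using core_lift(3)[OF O(1) _ comp_Hom[OF f'(1) y(4)]] y(2) by blast
  then show ?thesis using core_squareI[OF f f'(1) _ f'(2)] by blast
qed

lemma core_square_unique:
  assumes f: "f \<in> Hom A X Y" and s: "core_square f f' g" "core_square f f'' g'"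
  shows "g = g'"
proof -
  have O: "X \<in> Obj A" "Y \<in> Obj A" using Hom_Obj[OF f] .
  note x = core_simps[OF O(1)] and y = core_simps[OF O(2)]
  note s' = core_squareD[OF s(1) f] and s'' = core_squareD[OF s(2) f]
  have "f' = f''" using core_lift(2)[OF O(2) x(1) s'(1) s''(1)] s'(3) s''(3) by simp
  then show ?thesis using core_lift(4)[OF O(1) _ s'(2) s''(2)] s'(4) s''(4) y(2) by simp
qed

lemma cF_eqI: "\<lbrakk>f \<in> Hom A X Y; core_square f f' g\<rbrakk> \<Longrightarrow> cF f = g"
  unfolding cF_def using core_square_unique by (intro the_equality) blast+

lemma cF_square:
  assumes f: "f \<in> Hom A X Y"
  obtains f' where "core_square f f' (cF f)"
  using ex_core_square[OF f] cF_eqI[OF f] by metis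

lemma cF_Hom: "f \<in> Hom A X Y \<Longrightarrow> cF f \<in> Hom A (cL X) (cL Y)"
  using cF_square core_squareD(2) by metis

lemma cF_comp:
  assumes f: "f \<in> Hom A X Y" and g: "g \<in> Hom A Y Z"
  shows "cF (g \<cdot> f) = cF g \<cdot> cF f"
proof -
  obtain f' where s: "core_square f f' (cF f)" using cF_square[OF f] .
  obtain g' where t: "core_square g g' (cF g)" using cF_square[OF g] .
  note s = core_squareD[OF s f] and t = core_squareD[OF t g]
  have O: "X \<in> Obj A" "Y \<in> Obj A" "Z \<in> Obj A" using Hom_Obj[OF f] Hom_Obj[OF g] by auto
  note x = core_simps[OF O(1)] and y = core_simps[OF O(2)] and z = core_simps[OF O(3)]
  have "core_square (g \<cdot> f) (g' \<cdot> f') (cF g \<cdot> cF f)"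
  proof (rule core_squareI[OF comp_Hom[OF f g] comp_Hom[OF s(1) t(1)] comp_Hom[OF s(2) t(2)]])
    show "cm Z \<cdot> (g' \<cdot> f') = (g \<cdot> f) \<cdot> cm X"
      using comp_assoc[OF s(1) t(1) z(3)] t(3) comp_assoc[OF s(1) y(3) g] s(3) comp_assoc[OF x(3) f g]
      by simp
    show "(cF g \<cdot> cF f) \<cdot> ce X = ce Z \<cdot> (g' \<cdot> f')"
      using comp_assoc[OF x(4) s(2) t(2)] s(4) comp_assoc[OF s(1) y(4) t(2)] t(4)
        comp_assoc[OF s(1) t(1) z(4)] by simp
  qed
  then show ?thesis using cF_eqI[OF comp_Hom[OF f g]] by blast
qed

lemma cF_CF:
  assumes f: "f \<in> Hom A X Y" and XY: "X \<in> C \<inter> F" "Y \<in> C \<inter> F"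
  shows "cF f = f"
proof -
  have O: "X \<in> Obj A" "Y \<in> Obj A" using Hom_Obj[OF f] .
  have "core_square f f f"
    using core(2)[OF O(1) XY(1)] core(2)[OF O(2) XY(2)] f comp_Id[OF f] by (intro core_squareI[OF f]) auto
  then show ?thesis using cF_eqI[OF f] by blast
qed

lemma cF_Id:
  assumes X: "X \<in> Obj A"
  shows "cF (Id A X) = Id A (cL X)"
proof -
  note x = core_simps[OF X]
  have O: "cD X \<in> Obj A" "cL X \<in> Obj A" using Hom_Obj[OF x(4)] .
  have "core_square (Id A X) (Id A (cD X)) (Id A (cL X))"
    using core_squareI[OF Id_Hom Id_Hom Id_Hom] X O comp_Id[OF x(3)] comp_Id[OF x(4)] by simp
  then show ?thesis using cF_eqI[OF Id_Hom[OF X]] by blast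
qed

text \<open>The kernel lies in \<open>W\<close> and in \<open>F\<close>, the cokernel in
  \<open>C\<close> and in \<open>W\<close>, so both are zero.\<close>

lemma weq_CF_iso:
  assumes f: "f \<in> Hom A X Y" and XY: "X \<in> C \<inter> F" "Y \<in> C \<inter> F" and w: "weq f"
  shows "iso_mor bif f"
proof -
  have fW: "f \<in> Ker_in A W" "f \<in> Coker_in A W" using w Weq_iff by blast+
  have O: "X \<in> Obj A" "Y \<in> Obj A" using Hom_Obj[OF f] .
  obtain k where k: "is_kernel A f k" "Dom A k \<in> W" using fW unfolding Ker_in_def by blast
  then obtain K where K: "k \<in> Hom A K X" "K \<in> W" using is_kernelD(1)[OF k(1) f] by (auto simp: Hom_def)
  have kz: "zero_object A K"
    using WF_zero K(2) torsion_free_sub[OF WF K(1) is_kernelD(4)[OF k(1) f]] XY by blast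
  obtain q where q: "is_cokernel A f q" "Cod A q \<in> W" using fW unfolding Coker_in_def by blast
  then obtain Q where Q: "q \<in> Hom A Y Q" "Q \<in> W" using is_cokernelD(1)[OF q(1) f] by (auto simp: Hom_def)
  have qz: "zero_object A Q"
    using WC_zero[OF torsion_quotient[OF CW Q(1) is_cokernelD(4)[OF q(1) f]] Q(2)] XY by blast
  have "monic A f"
  proof (rule monicI_null[OF f])
    fix T u assume u: "u \<in> Hom A T X" "f \<cdot> u = zero T Y"
    then obtain u' where u': "u' \<in> Hom A T K" "k \<cdot> u' = u" using is_kernelD(3)[OF k(1) f K(1)] by blast
    then show "u = zero T X"
      using zero_object_Hom(2)[OF kz u'(1)] comp_zero(1)[OF K(1)] Hom_Obj[OF u(1)] by simp
  qed
  moreover have "epic A f"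
  proof (rule epicI_null[OF f])
    fix T u assume u: "u \<in> Hom A Y T" "u \<cdot> f = zero X T"
    then obtain u' where u': "u' \<in> Hom A Q T" "u' \<cdot> q = u" using is_cokernelD(3)[OF q(1) f Q(1)] by blast
    then show "u = zero Y T"
      using zero_object_Hom(1)[OF qz u'(1)] comp_zero(2)[OF Q(1)] Hom_Obj[OF u(1)] by simp
  qed
  ultimately obtain g where "g \<in> Hom A Y X" "g \<cdot> f = Id A X" "f \<cdot> g = Id A Y"
    using monic_epic_iso iso_mor_iff[OF f] by blast
  then show ?thesis
    unfolding iso_mor_def using f XY by (auto simp: Hom_full_subcategory Hom_def)
qed

text \<open>Two-out-of-three carries the property from \<open>f\<close> to \<open>f'\<close> across
  the square of the \<open>cm\<close>, then to \<open>cF f\<close> across that of the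
  \<open>ce\<close>.\<close>

lemma cF_weq:
  assumes f: "f \<in> Hom A X Y" and w: "weq f"
  shows "iso_mor bif (cF f)"
proof -
  obtain f' where "core_square f f' (cF f)" using cF_square[OF f] .
  note s = core_squareD[OF this f]
  have O: "X \<in> Obj A" "Y \<in> Obj A" using Hom_Obj[OF f] .
  note x = core_simps[OF O(1)] and y = core_simps[OF O(2)]
  have "weq (f \<cdot> cm X)" using weq_comp[OF x(3) f x(5) w] .
  then have "weq f'" using weq_cancel_left[OF s(1) y(3) y(5)] s(3) by simp
  then have "weq (ce Y \<cdot> f')" using weq_comp[OF s(1) y(4) _ y(6)] by blast
  then have "weq (cF f)" using weq_cancel_right[OF x(4) s(2) x(6)] s(4) by simp
  then show ?thesis using weq_CF_iso[OF s(2) x(2) y(2)] by blast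
qed

section \<open>The homotopy category and the intersection of C and F\<close>

abbreviation "Ho \<equiv> localization A Wq"
abbreviation "\<gamma> \<equiv> loc_map A Wq"
abbreviation "\<delta> \<equiv> loc_inv A Wq"

lemma category_bif: "category bif"
  using category_full_subcategory[OF CF_Obj] .

lemma cF_inverting: "inverting_functor A bif Wq cL cF"
proof (intro inverting_functor.intro category_axioms category_bif inverting_functor_axioms.intro)
  show "is_functor A bif cL cF"
    unfolding is_functor_def
  proof (intro conjI ballI impI)
    fix X assume X: "X \<in> Obj A"
    show "cL X \<in> Obj bif" using core_simps(2)[OF X] by simp
    show "cF (Id A X) = Id bif (cL X)" using cF_Id[OF X] by simp
  next
    fix f assume "f \<in> Mor A"
    then show "cF f \<in> Hom bif (cL (Dom A f)) (cL (Cod A f))"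
      using cF_Hom[OF Mor_Hom] core_simps(2) by (simp add: Hom_full_subcategory)
  next
    fix f g assume "f \<in> Mor A" "g \<in> Mor A" "Cod A f = Dom A g"
    then show "cF (g \<cdot> f) = cF g \<cdot>\<^bsub>bif\<^esub> cF f"
      using cF_comp[of f "Dom A f" "Cod A f" g "Cod A g"] by (simp add: Hom_def)
  qed
  show "iso_mor bif (cF w)" if "w \<in> Mor A" "w \<in> Wq" for w
    using cF_weq[OF Mor_Hom[OF that(1)]] that(2) Weq_iff by blast
qed

sublocale S: inverting_functor A bif Wq cL cF
  by (rule cF_inverting)

sublocale Ho: category Ho
  by (rule category_localization)

text \<open>Both legs of the core become invertible in \<open>Ho\<close>; \<open>\<eta>\<close> and
  \<open>\<theta>\<close> traverse it in opposite directions and identify \<open>cL X\<close> with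
  \<open>X\<close>.\<close>

definition "\<eta> X = \<gamma> (cm X) \<cdot>\<^bsub>Ho\<^esub> \<delta> (ce X)"
definition "\<theta> X = \<gamma> (ce X) \<cdot>\<^bsub>Ho\<^esub> \<delta> (cm X)"

lemma \<eta>_Hom: "X \<in> Obj A \<Longrightarrow> \<eta> X \<in> Hom Ho (cL X) X"
  unfolding \<eta>_def using Ho.comp_Hom[OF loc_inv_Hom loc_map_Hom] core_simps by blast

lemma \<theta>_Hom: "X \<in> Obj A \<Longrightarrow> \<theta> X \<in> Hom Ho X (cL X)"
  unfolding \<theta>_def using Ho.comp_Hom[OF loc_inv_Hom loc_map_Hom] core_simps by blast

lemma \<eta>_\<theta>:
  assumes X: "X \<in> Obj A"
  shows "\<theta> X \<cdot>\<^bsub>Ho\<^esub> \<eta> X = Id Ho (cL X)" "\<eta> X \<cdot>\<^bsub>Ho\<^esub> \<theta> X = Id Ho X"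
proof -
  note x = core_simps[OF X]
  note m = loc_map_Hom[OF x(3), of Wq] loc_inv_Hom[OF x(3,7)] loc_inv_comp[OF x(3,7)]
  note e = loc_map_Hom[OF x(4), of Wq] loc_inv_Hom[OF x(4,8)] loc_inv_comp[OF x(4,8)]
  show "\<theta> X \<cdot>\<^bsub>Ho\<^esub> \<eta> X = Id Ho (cL X)"
    unfolding \<eta>_def \<theta>_def
    using Ho.comp_assoc4[OF e(2) m(1,2) e(1)] m(3) Ho.comp_Id(2)[OF e(2)] e(4) by simp
  show "\<eta> X \<cdot>\<^bsub>Ho\<^esub> \<theta> X = Id Ho X"
    unfolding \<eta>_def \<theta>_def
    using Ho.comp_assoc4[OF m(2) e(1,2) m(1)] e(3) Ho.comp_Id(2)[OF m(2)] m(4) by simp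
qed

text \<open>The square of the \<open>ce\<close> also commutes with its \<open>ce\<close>-sides
  replaced by their formal inverses; pasted to the square of the \<open>cm\<close> it gives the
  claim.\<close>

lemma \<eta>_natural_map:
  assumes f: "f \<in> Hom A X Y"
  shows "\<gamma> f \<cdot>\<^bsub>Ho\<^esub> \<eta> X = \<eta> Y \<cdot>\<^bsub>Ho\<^esub> \<gamma> (cF f)"
proof -
  obtain f' where "core_square f f' (cF f)" using cF_square[OF f] .
  note s = core_squareD[OF this f]
  have O: "X \<in> Obj A" "Y \<in> Obj A" using Hom_Obj[OF f] .
  note x = core_simps[OF O(1)] and y = core_simps[OF O(2)]
  note \<gamma> = loc_map_Hom[of _ _ _ Wq]
  note h = \<gamma>[OF f] \<gamma>[OF s(1)] \<gamma>[OF s(2)] \<gamma>[OF x(3)] \<gamma>[OF y(3)] \<gamma>[OF x(4)] \<gamma>[OF y(4)]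
    loc_inv_Hom[OF x(4,8)] loc_inv_Hom[OF y(4,8)]
  have "\<delta> (ce Y) \<cdot>\<^bsub>Ho\<^esub> \<gamma> (cF f) = \<delta> (ce Y) \<cdot>\<^bsub>Ho\<^esub> (\<gamma> (cF f) \<cdot>\<^bsub>Ho\<^esub> (\<gamma> (ce X) \<cdot>\<^bsub>Ho\<^esub> \<delta> (ce X)))"
    using loc_inv_comp(2)[OF x(4,8)] Ho.comp_Id(1)[OF h(3)] by simp
  also have "\<dots> = \<delta> (ce Y) \<cdot>\<^bsub>Ho\<^esub> ((\<gamma> (ce Y) \<cdot>\<^bsub>Ho\<^esub> \<gamma> f') \<cdot>\<^bsub>Ho\<^esub> \<delta> (ce X))"
    using Ho.comp_assoc[OF h(8,6,3)] loc_map_comp[OF x(4) s(2)] s(4) loc_map_comp[OF s(1) y(4)] by simp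
  also have "\<dots> = \<gamma> f' \<cdot>\<^bsub>Ho\<^esub> \<delta> (ce X)"
    using Ho.comp_assoc[OF h(8,2,7)] Ho.comp_assoc[OF Ho.comp_Hom[OF h(8,2)] h(7,9)]
      loc_inv_comp(1)[OF y(4,8)] Ho.comp_Id(2)[OF Ho.comp_Hom[OF h(8,2)]] by simp
  finally have 1: "\<delta> (ce Y) \<cdot>\<^bsub>Ho\<^esub> \<gamma> (cF f) = \<gamma> f' \<cdot>\<^bsub>Ho\<^esub> \<delta> (ce X)" .
  have "\<gamma> f \<cdot>\<^bsub>Ho\<^esub> \<eta> X = (\<gamma> (cm Y) \<cdot>\<^bsub>Ho\<^esub> \<gamma> f') \<cdot>\<^bsub>Ho\<^esub> \<delta> (ce X)"
    unfolding \<eta>_def using Ho.comp_assoc[OF h(8,4,1)] loc_map_comp[OF x(3) f] s(3)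
      loc_map_comp[OF s(1) y(3)] by simp
  also have "\<dots> = \<eta> Y \<cdot>\<^bsub>Ho\<^esub> \<gamma> (cF f)"
    unfolding \<eta>_def using Ho.comp_assoc[OF h(8,2,5)] 1 Ho.comp_assoc[OF h(3,9,5)] by simp
  finally show ?thesis .
qed

text \<open>Naturality at \<open>w\<close>, composed with the inverse of \<open>w\<close> in
  \<open>Ho\<close> on one side and of \<open>cF w\<close> on the other.\<close>

lemma \<eta>_natural_inv:
  assumes w: "w \<in> Hom A X Y" "w \<in> Wq"
  shows "\<delta> w \<cdot>\<^bsub>Ho\<^esub> \<eta> Y = \<eta> X \<cdot>\<^bsub>Ho\<^esub> \<gamma> (mor_inv bif (cF w))"
proof -
  have O: "X \<in> Obj A" "Y \<in> Obj A" using Hom_Obj[OF w(1)] .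
  have cw: "cF w \<in> Hom bif (cL X) (cL Y)"
    using cF_Hom[OF w(1)] core_simps(2) O by (simp add: Hom_full_subcategory)
  have iso: "iso_mor bif (cF w)" using cF_weq[OF w(1)] w(2) Weq_iff by blast
  define v where "v = mor_inv bif (cF w)"
  have v: "v \<in> Hom A (cL Y) (cL X)" "cF w \<cdot> v = Id A (cL Y)"
    using category.mor_inv[OF category_bif iso cw] v_def by (simp_all add: Hom_full_subcategory)
  have h: "\<gamma> v \<in> Hom Ho (cL Y) (cL X)" "\<gamma> (cF w) \<in> Hom Ho (cL X) (cL Y)" "\<gamma> w \<in> Hom Ho X Y"
    "\<delta> w \<in> Hom Ho Y X"
    using loc_map_Hom loc_inv_Hom v cF_Hom[OF w(1)] w by blast+
  note \<eta> = \<eta>_Hom[OF O(1)] \<eta>_Hom[OF O(2)]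
  have "\<gamma> (cF w) \<cdot>\<^bsub>Ho\<^esub> \<gamma> v = Id Ho (cL Y)"
    using loc_map_comp[OF v(1) cF_Hom[OF w(1)]] v(2) loc_map_Id Hom_Obj[OF v(1)] by metis
  then have "\<delta> w \<cdot>\<^bsub>Ho\<^esub> \<eta> Y = \<delta> w \<cdot>\<^bsub>Ho\<^esub> ((\<eta> Y \<cdot>\<^bsub>Ho\<^esub> \<gamma> (cF w)) \<cdot>\<^bsub>Ho\<^esub> \<gamma> v)"
    using Ho.comp_assoc[OF h(1,2) \<eta>(2)] Ho.comp_Id(1)[OF \<eta>(2)] by simp
  also have "\<dots> = \<delta> w \<cdot>\<^bsub>Ho\<^esub> (\<gamma> w \<cdot>\<^bsub>Ho\<^esub> (\<eta> X \<cdot>\<^bsub>Ho\<^esub> \<gamma> v))"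
    using \<eta>_natural_map[OF w(1)] Ho.comp_assoc[OF h(1) \<eta>(1) h(3)] by simp
  also have "\<dots> = \<eta> X \<cdot>\<^bsub>Ho\<^esub> \<gamma> v"
    using Ho.comp_assoc[OF Ho.comp_Hom[OF h(1) \<eta>(1)] h(3,4)] loc_inv_comp(1)[OF w]
      Ho.comp_Id(2)[OF Ho.comp_Hom[OF h(1) \<eta>(1)]] by simp
  finally show ?thesis unfolding v_def .
qed

lemma ev_Hom_A: "zigzag A Wq X p Y \<Longrightarrow> S.ev p X \<in> Hom A (cL X) (cL Y)"
  using S.ev_Hom by (simp add: Hom_full_subcategory)

text \<open>The letters of a zigzag are treated one at a time by the two preceding lemmas. Thus
  every morphism of \<open>Ho\<close> is, up to the isomorphisms \<open>\<eta>\<close>, the image of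
  a morphism of \<open>C \<inter> F\<close>.\<close>

lemma \<eta>_natural_zigzag:
  "zigzag A Wq X p Y \<Longrightarrow> zz_class A Wq X p Y \<cdot>\<^bsub>Ho\<^esub> \<eta> X = \<eta> Y \<cdot>\<^bsub>Ho\<^esub> \<gamma> (S.ev p X)"
proof (induction rule: zigzag.induct)
  case (empty X)
  then have "\<gamma> (Id A (cL X)) = Id Ho (cL X)" using loc_map_Id core_simps(2) CF_Obj by blast
  then show ?case
    using Ho.comp_Id[OF \<eta>_Hom[OF empty]] by (simp flip: localization_Id)
next
  case (forward f p Y)
  have O: "Dom A f \<in> Obj A" "Cod A f \<in> Obj A" "Y \<in> Obj A" using forward zigzag_Obj by auto
  have f: "f \<in> Hom A (Dom A f) (Cod A f)" using Mor_Hom forward by blast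
  have c: "zz_class A Wq (Cod A f) p Y \<in> Hom Ho (Cod A f) Y"
    using forward localization_Hom by blast
  note e = ev_Hom_A[OF forward(2)]
  note h = loc_map_Hom[OF f, of Wq] loc_map_Hom[OF cF_Hom[OF f], of Wq] loc_map_Hom[OF e, of Wq]
  note \<eta> = \<eta>_Hom[OF O(1)] \<eta>_Hom[OF O(2)] \<eta>_Hom[OF O(3)]
  have "zz_class A Wq (Dom A f) (Fwd f # p) Y = zz_class A Wq (Cod A f) p Y \<cdot>\<^bsub>Ho\<^esub> \<gamma> f"
    unfolding loc_map_def
    using localization_Comp[of Wq "Dom A f" "[Fwd f]" "Cod A f" p Y] forward O by simp
  then have "zz_class A Wq (Dom A f) (Fwd f # p) Y \<cdot>\<^bsub>Ho\<^esub> \<eta> (Dom A f) =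
      (zz_class A Wq (Cod A f) p Y \<cdot>\<^bsub>Ho\<^esub> \<eta> (Cod A f)) \<cdot>\<^bsub>Ho\<^esub> \<gamma> (cF f)"
    using Ho.comp_assoc[OF \<eta>(1) h(1) c] \<eta>_natural_map[OF f] Ho.comp_assoc[OF h(2) \<eta>(2) c] by simp
  also have "\<dots> = \<eta> Y \<cdot>\<^bsub>Ho\<^esub> \<gamma> (S.ev p (Cod A f) \<cdot> cF f)"
    using forward.IH Ho.comp_assoc[OF h(2,3) \<eta>(3)] loc_map_comp[OF cF_Hom[OF f] e] by simp
  finally show ?case by simp
next
  case (backward w p Y)
  have O: "Dom A w \<in> Obj A" "Cod A w \<in> Obj A" "Y \<in> Obj A" using backward zigzag_Obj by auto
  have w: "w \<in> Hom A (Dom A w) (Cod A w)" "w \<in> Wq" using Mor_Hom backward by auto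
  have c: "zz_class A Wq (Dom A w) p Y \<in> Hom Ho (Dom A w) Y"
    using backward localization_Hom by blast
  have v: "mor_inv bif (cF w) \<in> Hom A (cL (Cod A w)) (cL (Dom A w))"
    using S.F_inv(1)[OF backward(1,2)] backward(1) by (simp add: Hom_full_subcategory)
  note e = ev_Hom_A[OF backward(3)]
  note h = loc_inv_Hom[OF w] loc_map_Hom[OF v, of Wq] loc_map_Hom[OF e, of Wq]
  note \<eta> = \<eta>_Hom[OF O(1)] \<eta>_Hom[OF O(2)] \<eta>_Hom[OF O(3)]
  have "zz_class A Wq (Cod A w) (Bwd w # p) Y = zz_class A Wq (Dom A w) p Y \<cdot>\<^bsub>Ho\<^esub> \<delta> w"
    unfolding loc_inv_def
    using localization_Comp[of Wq "Cod A w" "[Bwd w]" "Dom A w" p Y] backward O by simp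
  then have "zz_class A Wq (Cod A w) (Bwd w # p) Y \<cdot>\<^bsub>Ho\<^esub> \<eta> (Cod A w) =
      (zz_class A Wq (Dom A w) p Y \<cdot>\<^bsub>Ho\<^esub> \<eta> (Dom A w)) \<cdot>\<^bsub>Ho\<^esub> \<gamma> (mor_inv bif (cF w))"
    using Ho.comp_assoc[OF \<eta>(2) h(1) c] \<eta>_natural_inv[OF w] Ho.comp_assoc[OF h(2) \<eta>(1) c] by simp
  also have "\<dots> = \<eta> Y \<cdot>\<^bsub>Ho\<^esub> \<gamma> (S.ev p (Dom A w) \<cdot> mor_inv bif (cF w))"
    using backward.IH Ho.comp_assoc[OF h(2,3) \<eta>(3)] loc_map_comp[OF v e] by simp
  finally show ?case by simp
qed

lemma \<eta>_natural:
  assumes "\<phi> \<in> Hom Ho X Y"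
  shows "\<phi> \<cdot>\<^bsub>Ho\<^esub> \<eta> X = \<eta> Y \<cdot>\<^bsub>Ho\<^esub> \<gamma> (S.lift \<phi>)"
  using assms \<eta>_natural_zigzag S.lift_class unfolding localization_Hom by auto

lemma lift_Hom:
  assumes "\<phi> \<in> Hom Ho X Y"
  shows "S.lift \<phi> \<in> Hom bif (cL X) (cL Y)"
  using assms S.lift_functor unfolding is_functor_def by (auto simp: Hom_def)

lemma lift_comp:
  assumes "\<phi> \<in> Hom Ho X Y" "\<psi> \<in> Hom Ho Y Z"
  shows "S.lift (\<psi> \<cdot>\<^bsub>Ho\<^esub> \<phi>) = S.lift \<psi> \<cdot> S.lift \<phi>"
  using assms S.lift_functor unfolding is_functor_def by (auto simp: Hom_def)

lemma lift_bij:
  assumes O: "X \<in> Obj A" "Y \<in> Obj A"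
  shows "bij_betw S.lift (Hom Ho X Y) (Hom bif (cL X) (cL Y))"
  unfolding bij_betw_def
proof
  note \<eta> = \<eta>_Hom[OF O(1)] \<eta>_Hom[OF O(2)] and \<theta> = \<theta>_Hom[OF O(1)] \<theta>_Hom[OF O(2)]
  show "inj_on S.lift (Hom Ho X Y)"
  proof (rule inj_onI)
    fix \<phi> \<psi> assume h: "\<phi> \<in> Hom Ho X Y" "\<psi> \<in> Hom Ho X Y" "S.lift \<phi> = S.lift \<psi>"
    have "\<phi> \<cdot>\<^bsub>Ho\<^esub> \<eta> X = \<psi> \<cdot>\<^bsub>Ho\<^esub> \<eta> X" using \<eta>_natural[OF h(1)] \<eta>_natural[OF h(2)] h(3) by simp
    then have "\<phi> \<cdot>\<^bsub>Ho\<^esub> (\<eta> X \<cdot>\<^bsub>Ho\<^esub> \<theta> X) = \<psi> \<cdot>\<^bsub>Ho\<^esub> (\<eta> X \<cdot>\<^bsub>Ho\<^esub> \<theta> X)"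
      using Ho.comp_assoc[OF \<theta>(1) \<eta>(1) h(1)] Ho.comp_assoc[OF \<theta>(1) \<eta>(1) h(2)] by simp
    then show "\<phi> = \<psi>"
      using \<eta>_\<theta>(2)[OF O(1)] Ho.comp_Id(1)[OF h(1)] Ho.comp_Id(1)[OF h(2)] by simp
  qed
  have "g \<in> S.lift ` Hom Ho X Y" if g: "g \<in> Hom bif (cL X) (cL Y)" for g
  proof -
    have gA: "g \<in> Hom A (cL X) (cL Y)" using g by (simp add: Hom_full_subcategory)
    \<comment> \<open>\<open>S.lift (\<eta> X)\<close> starts at \<open>cL (cL X)\<close>, which is
      \<open>cL X\<close> because cores are trivial on \<open>C \<inter> F\<close>.\<close>
    have l: "S.lift (\<eta> X) \<in> Hom A (cL X) (cL X)" "S.lift (\<theta> Y) \<in> Hom A (cL Y) (cL Y)"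
      "S.lift (\<eta> Y) \<in> Hom A (cL Y) (cL Y)" "S.lift (\<theta> X) \<in> Hom A (cL X) (cL X)"
      using lift_Hom[OF \<eta>(1)] lift_Hom[OF \<theta>(2)] lift_Hom[OF \<eta>(2)] lift_Hom[OF \<theta>(1)]
        core(2)[of "cL X"] core(2)[of "cL Y"] core_simps(2)[OF O(1)] core_simps(2)[OF O(2)] CF_Obj
      by (auto simp: Hom_full_subcategory)
    \<comment> \<open>Lifting \<open>h\<close> below multiplies by the lifts of
      \<open>\<eta> Y\<close> and \<open>\<theta> X\<close>. Instead of showing that these are
      identities, \<open>g\<close> is first multiplied by their inverses, so that everything
      cancels.\<close>
    define g' where "g' = (S.lift (\<theta> Y) \<cdot> g) \<cdot> S.lift (\<eta> X)"
    note tg = comp_Hom[OF gA l(2)]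
    have g': "g' \<in> Hom A (cL X) (cL Y)" unfolding g'_def using comp_Hom[OF l(1) tg] .
    have "S.lift (\<gamma> g') = g'"
      using S.lift_loc_map[OF g'] cF_CF[OF g'] core_simps(2) O by simp
    moreover define h where "h = (\<eta> Y \<cdot>\<^bsub>Ho\<^esub> \<gamma> g') \<cdot>\<^bsub>Ho\<^esub> \<theta> X"
    note \<gamma>g = loc_map_Hom[OF g', of Wq]
    have h: "h \<in> Hom Ho X Y"
      unfolding h_def using Ho.comp_Hom[OF \<theta>(1) Ho.comp_Hom[OF \<gamma>g \<eta>(2)]] .
    have Id: "S.lift (\<eta> X) \<cdot> S.lift (\<theta> X) = Id A (cL X)" "S.lift (\<eta> Y) \<cdot> S.lift (\<theta> Y) = Id A (cL Y)"
      using lift_comp[OF \<theta>(1) \<eta>(1)] lift_comp[OF \<theta>(2) \<eta>(2)] \<eta>_\<theta>(2) O S.lift_functor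
      unfolding is_functor_def by simp_all
    ultimately have "S.lift h = (S.lift (\<eta> Y) \<cdot> g') \<cdot> S.lift (\<theta> X)"
      unfolding h_def using lift_comp[OF \<theta>(1) Ho.comp_Hom[OF \<gamma>g \<eta>(2)]] lift_comp[OF \<gamma>g \<eta>(2)] by simp
    also have "S.lift (\<eta> Y) \<cdot> g' = (S.lift (\<eta> Y) \<cdot> (S.lift (\<theta> Y) \<cdot> g)) \<cdot> S.lift (\<eta> X)"
      unfolding g'_def using comp_assoc[OF l(1) tg l(3)] .
    also have "S.lift (\<eta> Y) \<cdot> (S.lift (\<theta> Y) \<cdot> g) = g"
      using comp_assoc[OF gA l(2,3)] Id(2) comp_Id(2)[OF gA] by simp
    also have "(g \<cdot> S.lift (\<eta> X)) \<cdot> S.lift (\<theta> X) = g"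
      using comp_assoc[OF l(4,1) gA] Id(1) comp_Id(1)[OF gA] by simp
    finally show ?thesis using h by blast
  qed
  then show "S.lift ` Hom Ho X Y = Hom bif (cL X) (cL Y)" using lift_Hom by blast
qed

text \<open>Strict surjectivity on objects is where the choice of identities as cores on
  \<open>C \<inter> F\<close> pays off.\<close>

lemma fully_faithful_lift: "fully_faithful Ho bif cL S.lift"
proof (intro fully_faithful.intro Ho.category_axioms category_bif fully_faithful_axioms.intro S.lift_functor)
  show "bij_betw S.lift (Hom Ho X Y) (Hom bif (cL X) (cL Y))" if "X \<in> Obj Ho" "Y \<in> Obj Ho" for X Y
    using lift_bij that by simp
  show "\<exists>X\<in>Obj Ho. cL X = Z" if "Z \<in> Obj bif" for Z
    using core(2)[of Z] that CF_Obj by auto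
qed

theorem abelian_Ho: "abelian_category Ho"
  using fully_faithful.transport_abelian[OF fully_faithful_lift abelian_CF] abelian_category_iff by blast

theorem equivalent_Ho: "equivalent_categories Ho bif"
  unfolding equivalent_categories_def
proof (intro exI conjI)
  show "is_functor Ho bif cL S.lift" by (rule S.lift_functor)
  \<comment> \<open>The quasi-inverse is the inclusion of \<open>C \<inter> F\<close> followed by
    localization.\<close>
  show "is_functor bif Ho id \<gamma>"
    unfolding is_functor_def
  proof (intro conjI ballI impI)
    fix X assume "X \<in> Obj bif"
    then have X: "X \<in> Obj A" using CF_Obj by auto
    then show "id X \<in> Obj Ho" "\<gamma> (Id bif X) = Id Ho (id X)" using loc_map_Id[OF X] by simp_all
  next
    fix f assume "f \<in> Mor bif"
    then show "\<gamma> f \<in> Hom Ho (id (Dom bif f)) (id (Cod bif f))"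
      using loc_map_Hom[OF Mor_Hom, of f] by simp
  next
    fix f g assume "f \<in> Mor bif" "g \<in> Mor bif" "Cod bif f = Dom bif g"
    then show "\<gamma> (g \<cdot>\<^bsub>bif\<^esub> f) = \<gamma> g \<cdot>\<^bsub>Ho\<^esub> \<gamma> f"
      using loc_map_comp[of f "Dom A f" "Cod A f" g "Cod A g"] by (simp add: Hom_def)
  qed
  show "naturally_isomorphic Ho Ho (id \<circ> cL) (\<gamma> \<circ> S.lift) id id"
    unfolding naturally_isomorphic_def
  proof (intro exI conjI ballI)
    fix X assume "X \<in> Obj Ho"
    then have X: "X \<in> Obj A" by simp
    then show "\<eta> X \<in> Hom Ho ((id \<circ> cL) X) (id X)" using \<eta>_Hom by simp
    show "iso_mor Ho (\<eta> X)"
      using Ho.iso_mor_iff[OF \<eta>_Hom[OF X]] \<theta>_Hom[OF X] \<eta>_\<theta>[OF X] by blast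
  next
    fix f assume "f \<in> Mor Ho"
    then show "id f \<cdot>\<^bsub>Ho\<^esub> \<eta> (Dom Ho f) = \<eta> (Cod Ho f) \<cdot>\<^bsub>Ho\<^esub> (\<gamma> \<circ> S.lift) f"
      using \<eta>_natural[OF Ho.Mor_Hom] by simp
  qed
  \<comment> \<open>On \<open>C \<inter> F\<close> the composite is the identity on the nose, so
    identities form the natural isomorphism.\<close>
  show "naturally_isomorphic bif bif (cL \<circ> id) (S.lift \<circ> \<gamma>) id id"
    unfolding naturally_isomorphic_def
  proof (intro exI conjI ballI)
    fix X assume X: "X \<in> Obj bif"
    then have "cL X = X" using core(2)[of X] CF_Obj by auto
    then show "Id bif X \<in> Hom bif ((cL \<circ> id) X) (id X)" using S.B.Id_Hom[OF X] by simp
    show "iso_mor bif (Id bif X)" using S.B.iso_mor_Id[OF X] .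
  next
    fix f assume "f \<in> Mor bif"
    then have f: "f \<in> Hom A (Dom A f) (Cod A f)" "Dom A f \<in> C \<inter> F" "Cod A f \<in> C \<inter> F"
      by (simp_all add: Hom_def)
    have "S.lift (\<gamma> f) = f" using S.lift_loc_map[OF f(1)] cF_CF[OF f] by simp
    then show "id f \<cdot>\<^bsub>bif\<^esub> Id bif (Dom bif f) = Id bif (Cod bif f) \<cdot>\<^bsub>bif\<^esub> (S.lift \<circ> \<gamma>) f"
      using comp_Id[OF f(1)] by simp
  qed
qed

end

theorem theoremB:
  fixes A :: "('o, 'm) cat"
  assumes "abelian_category A"
  shows "bij_betw (TTF_to_model A) (TTF_triples A) (TTF_model_structures A) \<and>
    (\<forall>M \<in> TTF_model_structures A.
       model_to_TTF A M \<in> TTF_triples A \<and> TTF_to_model A (model_to_TTF A M) = M) \<and>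
    (\<forall>T \<in> TTF_triples A. model_to_TTF A (TTF_to_model A T) = T) \<and>
    (\<forall>C W F CoFib Fib Weq.
       (C, W, F) \<in> TTF_triples A \<and> TTF_to_model A (C, W, F) = (CoFib, Fib, Weq) \<longrightarrow>
         abelian_category (localization A Weq) \<and>
         equivalent_categories (localization A Weq) (full_subcategory A (C \<inter> F)) \<and>
         abelian_category (full_subcategory A (C \<inter> F)))"
proof -
  obtain add zero where "abelian A add zero"
    using assms abelian_category_iff by blast
  then interpret abelian A add zero .
  have "bij_betw (TTF_to_model A) (TTF_triples A) (TTF_model_structures A)"
    by (rule bij_betw_byWitness[where f' = "model_to_TTF A"]) (use bij_TTF_to_model in auto)
  moreover have "abelian_category (localization A Weq) \<and>
      equivalent_categories (localization A Weq) (full_subcategory A (C \<inter> F)) \<and>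
      abelian_category (full_subcategory A (C \<inter> F))"
    if T: "(C, W, F) \<in> TTF_triples A" "TTF_to_model A (C, W, F) = (CoFib, Fib, Weq)"
    for C W F CoFib Fib Weq
  proof -
    have "torsion_pair A C W" "torsion_pair A W F" using T(1) unfolding TTF_triples_def by auto
    then interpret ttf A add zero C W F by unfold_locales
    have "Weq = Ker_in A W \<inter> Coker_in A W" using T(2) by simp
    then show ?thesis using abelian_Ho equivalent_Ho abelian_CF abelian_category_iff by blast
  qed
  ultimately show ?thesis using bij_TTF_to_model by blast
qed

end
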